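(* There is a constant $C>0$ such that the following holds. Let $\epsilon>0$ and let $u_0:\mathbb{R}\to\mathbb{R}$ satisfy $$\|u_0\|_{H^1}+\|x^2u_0\|_{L^2}\le \epsilon .$$ Let $u$ be the corresponding solution of the linear KdV equation $u_t+u_{xxx}=0$, $u(0)=u_0$. Then for all $t>0$ and $x\in\mathbb{R}$, $$t^{\frac14}\langle x\rangle^{\frac14}|u(t,x)|+t^{\frac34}\langle x\rangle^{-\frac14}|u_x(t,x)|\le C\epsilon .$$ Furthermore, in the elliptic region $E$ one has the better bound $$\langle x\rangle|u(t,x)|+t^{\frac12}\langle x\rangle^{\frac12}|u_x(t,x)|\le C\epsilon\,\ln\!\big(t^{-\frac13}\langle x\rangle\big).$$
   Context: The bracket is time dependent: $\langle x\rangle:=(x^2+|t|^{2/3})^{1/2}$. The elliptic region is $E=\{(t,x): t>0,\ x\gtrsim t^{1/3}\}$, i.e. $x\ge c_0t^{1/3}$ for a fixed constant $c_0>0$ (the constant $C$ in the bound on $E$ may depend on $c_0$). *)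

theory Defs
  imports "HOL-Analysis.Analysis"
begin

definition square_integrable :: "(real \<Rightarrow> real) \<Rightarrow> bool" where
  "square_integrable f \<longleftrightarrow>
     f \<in> borel_measurable lebesgue \<and> integrable lebesgue (\<lambda>x. (f x)\<^sup>2)"

(* Meaningful only for square-integrable f: a divergent Bochner integral is 0, so every
   statement about these norms also has to assume finiteness. *)
definition L2_norm :: "(real \<Rightarrow> real) \<Rightarrow> real" where
  "L2_norm f = sqrt (\<integral>x. (f x)\<^sup>2 \<partial>lebesgue)"

definition test_function :: "(real \<Rightarrow> real) \<Rightarrow> bool" where
  "test_function \<phi> \<longleftrightarrow>
     (\<forall>n x. (deriv ^^ n) \<phi> differentiable (at x)) \<and> compact (closure {x. \<phi> x \<noteq> 0})"

definition is_weak_deriv :: "(real \<Rightarrow> real) \<Rightarrow> (real \<Rightarrow> real) \<Rightarrow> bool" where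
  "is_weak_deriv f g \<longleftrightarrow>
     (\<forall>\<phi>. test_function \<phi> \<longrightarrow>
        (\<integral>x. f x * deriv \<phi> x \<partial>lebesgue) = - (\<integral>x. g x * \<phi> x \<partial>lebesgue))"

definition H1 :: "(real \<Rightarrow> real) \<Rightarrow> bool" where
  "H1 f \<longleftrightarrow> square_integrable f \<and> (\<exists>g. square_integrable g \<and> is_weak_deriv f g)"

(* Determined up to null sets, so the choice does not affect the norm below. *)
definition weak_deriv :: "(real \<Rightarrow> real) \<Rightarrow> real \<Rightarrow> real" where
  "weak_deriv f = (SOME g. square_integrable g \<and> is_weak_deriv f g)"

definition H1_norm :: "(real \<Rightarrow> real) \<Rightarrow> real" where
  "H1_norm f = sqrt ((L2_norm f)\<^sup>2 + (L2_norm (weak_deriv f))\<^sup>2)"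

(* u is the solution in C([0,\<infinity>); L^2) of u_t + u_xxx = 0, u(0) = u0. The equation holds in
   the sense of distributions in x: d/dt <u(t), \<phi>> = <u(t), \<phi>'''>, the three integrations by
   parts cancelling the sign of -u_xxx. The continuity of u(t,.) only picks, for each t > 0,
   the representative whose pointwise values are meant. *)
definition linear_KdV_solution :: "(real \<Rightarrow> real) \<Rightarrow> (real \<Rightarrow> real \<Rightarrow> real) \<Rightarrow> bool" where
  "linear_KdV_solution u0 u \<longleftrightarrow>
     (\<forall>t\<ge>0. square_integrable (u t)) \<and>
     (\<forall>t\<ge>0. ((\<lambda>s. L2_norm (\<lambda>x. u s x - u t x)) \<longlongrightarrow> 0) (at t within {0..})) \<and>
     (AE x in lebesgue. u 0 x = u0 x) \<and>
     (\<forall>\<phi>. test_function \<phi> \<longrightarrow>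
        (\<forall>t>0. ((\<lambda>s. \<integral>x. u s x * \<phi> x \<partial>lebesgue) has_real_derivative
                  (\<integral>x. u t x * (deriv ^^ 3) \<phi> x \<partial>lebesgue)) (at t))) \<and>
     (\<forall>t>0. continuous_on UNIV (u t))"

definition bracket :: "real \<Rightarrow> real \<Rightarrow> real" where
  "bracket t x = sqrt (x\<^sup>2 + \<bar>t\<bar> powr (2/3))"

definition elliptic_region :: "real \<Rightarrow> (real \<times> real) set" where
  "elliptic_region c0 = {(t, x). t > 0 \<and> x \<ge> c0 * t powr (1/3)}"

end

theory Submission
  imports Defs "HOL-Probability.Probability" "HOL-Real_Asymp.Real_Asymp"
begin

text \<open>
  Pairing the solution with the adjoint evolution of a Gaussian, an explicit absolutely convergent
  Fourier integral, and letting the Gaussian shrink shows that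
  \<open>u(t,x) = t\<^sup>-\<^sup>1\<^sup>/\<^sup>3 \<integral> A((x - y) t\<^sup>-\<^sup>1\<^sup>/\<^sup>3) u\<^sub>0(y) dy\<close>, where \<open>A\<close> is the Airy function normalised by
  \<open>3 A'' = x A\<close>. The bounds of the proposition are invariant under the scaling of the equation, which
  reduces them to unit time for data \<open>V\<close> with \<open>\<parallel>V'\<parallel>\<^sup>2 \<le> T\<close> and \<open>\<parallel>y\<^sup>2 V\<parallel>\<^sup>2 \<le> 1/T\<close> for an arbitrary \<open>T > 0\<close>;
  such \<open>V\<close> are bounded in \<open>L\<^sup>1\<close> and satisfy \<open>\<bar>y V(y)\<bar> \<le> 2\<close>. The kernel is of size \<open>\<bar>z\<bar>\<^sup>-\<^sup>1\<^sup>/\<^sup>4\<close> and its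
  derivative of size \<open>\<bar>z\<bar>\<^sup>1\<^sup>/\<^sup>4\<close> on the oscillating side, and both decay rapidly on the other side.
  The oscillation is exploited, where needed, by integrating by parts onto \<open>V'\<close> beyond the distance
  at which the estimate through \<open>V'\<close> becomes better than the one through \<open>y\<^sup>2 V\<close>. In the elliptic region this
  gives the improved decay even without the logarithm, which is bounded below there.
\<close>

section \<open>Integrals on the real line\<close>

text \<open>The estimates have to be uniform in \<open>T\<close>. Of the unit-time data only the L1
  norm and the supremum of |y V(y)| are bounded independently of \<open>T\<close>; the L2 norms of
  V' and of y^2 V are bounded by sqrt T and 1 / sqrt T. An integral is therefore split at a distance
  that depends on \<open>T\<close>, the one where the two L2 estimates coincide, and there
  \<open>T\<close> drops out. One crossover point suffices, so no sum over dyadic distances, a usual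
  source of a logarithm, arises. In the elliptic region the kernel is small only for sources y < x;
  sources y > x reach x through its oscillating side, so the gain has to be taken from the decay of
  V and from cancellation. The other obstacle is that the Airy integral does not converge
  absolutely, while solutions are weak and are tested only with compactly supported functions of x.
  Hence the work is done with Gaussian-damped integrals, for which differentiation under the
  integral and integration by parts are legitimate. The same damped integrals appear when the
  contour of the Airy integral is shifted, and this is how the undamped kernel is recovered.\<close>

lemma has_real_derivative_integral:
  fixes f f' :: "real \<Rightarrow> 'a \<Rightarrow> real"
  assumes d: "d > 0"
    and der: "\<And>t x. \<bar>t - t0\<bar> < d \<Longrightarrow> x \<in> space M \<Longrightarrow>
      ((\<lambda>t. f t x) has_real_derivative f' t x) (at t)"
    and bd: "\<And>t x. \<bar>t - t0\<bar> < d \<Longrightarrow> x \<in> space M \<Longrightarrow> \<bar>f' t x\<bar> \<le> w x"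
    and w: "integrable M w"
    and int: "\<And>t. \<bar>t - t0\<bar> < d \<Longrightarrow> integrable M (f t)"
    and meas: "f' t0 \<in> borel_measurable M"
  shows "((\<lambda>t. \<integral>x. f t x \<partial>M) has_real_derivative (\<integral>x. f' t0 x \<partial>M)) (at t0)"
  unfolding has_field_derivative_iff tendsto_at_iff_sequentially
proof (intro allI impI)
  fix X :: "nat \<Rightarrow> real"
  assume X: "\<forall>i. X i \<in> UNIV - {t0}" and lim: "X \<longlonglongrightarrow> t0"
  \<comment> \<open>Discarding the first \<open>N\<close> terms puts the whole sequence into the
    neighbourhood where the derivative is dominated.\<close>
  obtain N where N: "\<And>n. n \<ge> N \<Longrightarrow> \<bar>X n - t0\<bar> < d"
    using lim d unfolding lim_sequentially dist_real_def by blast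
  let ?q = "\<lambda>n x. (f (X (n + N)) x - f t0 x) / (X (n + N) - t0)"
  have XN: "\<bar>X (n + N) - t0\<bar> < d" "X (n + N) \<noteq> t0" for n
    using N[of "n + N"] X by auto
  have XNlim: "(\<lambda>n. X (n + N)) \<longlonglongrightarrow> t0"
    using lim by (rule LIMSEQ_ignore_initial_segment)
  have "(\<lambda>n. \<integral>x. ?q n x \<partial>M) \<longlonglongrightarrow> (\<integral>x. f' t0 x \<partial>M)"
  proof (rule integral_dominated_convergence[where w = w])
    show "(\<lambda>x. ?q n x) \<in> borel_measurable M" for n
      using int[OF XN(1), of n] int[of t0] d by simp
    show "AE x in M. (\<lambda>n. ?q n x) \<longlonglongrightarrow> f' t0 x"
    proof (rule AE_I2)
      fix x assume x: "x \<in> space M"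
      have "((\<lambda>t. f t x) has_real_derivative f' t0 x) (at t0)"
        using der[of t0 x] x d by simp
      then have "((\<lambda>y. (f y x - f t0 x) / (y - t0)) \<longlongrightarrow> f' t0 x) (at t0)"
        by (simp add: has_field_derivative_iff)
      then show "(\<lambda>n. ?q n x) \<longlonglongrightarrow> f' t0 x"
        unfolding tendsto_at_iff_sequentially comp_def
        using XN(2) XNlim by (auto dest!: spec[of _ "\<lambda>n. X (n + N)"])
    qed
    show "AE x in M. norm (?q n x) \<le> w x" for n
    proof (rule AE_I2)
      fix x assume x: "x \<in> space M"
      \<comment> \<open>The mean value inequality turns the bound on the derivative into a majorant
        of the difference quotients.\<close>
      have "norm (f (X (n + N)) x - f t0 x) \<le> w x * norm (X (n + N) - t0)"
      proof (rule field_differentiable_bound[where S = "{t. \<bar>t - t0\<bar> < d}" and f' = "\<lambda>t. f' t x"])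
        have "{t. \<bar>t - t0\<bar> < d} = {t0 - d<..<t0 + d}" by auto
        then show "convex {t. \<bar>t - t0\<bar> < d}" by simp
      next
        fix t assume "t \<in> {t. \<bar>t - t0\<bar> < d}"
        then show "((\<lambda>t. f t x) has_field_derivative f' t x) (at t within {t. \<bar>t - t0\<bar> < d})"
          using der[of t x] x by (auto intro: has_field_derivative_at_within)
      qed (use bd x XN d in auto)
      then show "norm (?q n x) \<le> w x"
        using XN(2)[of n] by (simp add: divide_simps)
    qed
  qed (use meas w in auto)
  moreover have "(\<integral>x. ?q n x \<partial>M) = ((\<integral>x. f (X (n + N)) x \<partial>M) - (\<integral>x. f t0 x \<partial>M)) / (X (n + N) - t0)" for n
    using int[OF XN(1), of n] int[of t0] d by simp
  ultimately show "((\<lambda>y. ((\<integral>x. f y x \<partial>M) - (\<integral>x. f t0 x \<partial>M)) / (y - t0)) \<circ> X)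
      \<longlonglongrightarrow> (\<integral>x. f' t0 x \<partial>M)"
    unfolding comp_def by (subst LIMSEQ_offset[where k = N]) (simp_all only:)
qed

lemma integral_deriv_eq_0:
  fixes f f' :: "real \<Rightarrow> real"
  assumes der: "\<And>x. (f has_real_derivative f' x) (at x)"
    and cont: "\<And>x. isCont f' x"
    and int: "integrable lborel f'"
    and bot: "(f \<longlongrightarrow> 0) at_bot" and top: "(f \<longlongrightarrow> 0) at_top"
  shows "(\<integral>x. f' x \<partial>lborel) = 0"
proof -
  have "(LBINT x=-\<infinity>..\<infinity>. f' x) = 0 - 0"
    by (rule interval_integral_FTC_integrable[where F = f])
      (use assms in \<open>auto simp: has_real_derivative_iff_has_vector_derivative set_integrable_def
        ereal_tendsto_simps1\<close>)
  then show ?thesis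
    by (simp add: interval_integral_to_infinity_eq interval_lebesgue_integral_def set_lebesgue_integral_def)
qed

lemma integrable_gaussian_moment:
  assumes "a > 0"
  shows "integrable lborel (\<lambda>x::real. \<bar>x\<bar> ^ n * exp (- a * x\<^sup>2))"
proof -
  let ?s = "sqrt (1 / (2 * a))"
  have s2: "?s\<^sup>2 = 1 / (2 * a)" using assms by (simp add: real_sqrt_pow2)
  have "integrable lborel (\<lambda>x. sqrt (2 * pi * ?s\<^sup>2) * (normal_density 0 ?s x * \<bar>x - 0\<bar> ^ n))"
    using assms by (intro integrable_mult_right integrable_normal_moment_abs) simp
  moreover have "(\<lambda>x. sqrt (2 * pi * ?s\<^sup>2) * (normal_density 0 ?s x * \<bar>x - 0\<bar> ^ n)) =
      (\<lambda>x. \<bar>x\<bar> ^ n * exp (- a * x\<^sup>2))"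
    using assms by (intro ext) (simp add: normal_density_def s2)
  ultimately show ?thesis by (simp only:)
qed

lemma integral_gaussian:
  assumes "a > 0"
  shows "(\<integral>x. exp (- a * x\<^sup>2) \<partial>lborel) = sqrt (pi / a)"
proof -
  let ?s = "sqrt (1 / (2 * a))"
  have s2: "?s\<^sup>2 = 1 / (2 * a)" using assms by (simp add: real_sqrt_pow2)
  have "(\<integral>x. exp (- a * x\<^sup>2) \<partial>lborel) = (\<integral>x. sqrt (2 * pi * ?s\<^sup>2) * normal_density 0 ?s x \<partial>lborel)"
    by (rule Bochner_Integration.integral_cong) (use assms in \<open>simp_all add: normal_density_def s2\<close>)
  also have "\<dots> = sqrt (pi / a)"
    using assms integral_normal_density[of ?s 0] by (simp add: s2)
  finally show ?thesis .
qed

lemma gaussian_moment_tendsto: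
  assumes "a > 0"
  shows "((\<lambda>x::real. \<bar>x\<bar> ^ n * exp (- a * x\<^sup>2)) \<longlongrightarrow> 0) at_top"
    and "((\<lambda>x::real. \<bar>x\<bar> ^ n * exp (- a * x\<^sup>2)) \<longlongrightarrow> 0) at_bot"
proof -
  have 1: "((\<lambda>x::real. x ^ n * exp (- a * x\<^sup>2)) \<longlongrightarrow> 0) at_top"
    using assms by real_asymp
  show 2: "((\<lambda>x::real. \<bar>x\<bar> ^ n * exp (- a * x\<^sup>2)) \<longlongrightarrow> 0) at_top"
    by (rule Lim_transform_eventually[OF 1], rule eventually_mono[OF eventually_ge_at_top[of 0]]) simp
  show "((\<lambda>x::real. \<bar>x\<bar> ^ n * exp (- a * x\<^sup>2)) \<longlongrightarrow> 0) at_bot"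
    using 2 by (simp add: filterlim_at_bot_mirror)
qed

section \<open>Smooth functions and bump functions\<close>

definition smooth :: "(real \<Rightarrow> real) \<Rightarrow> bool" where
  "smooth f \<longleftrightarrow> (\<forall>n x. (deriv ^^ n) f differentiable (at x))"

text \<open>The way smoothness is established throughout: exhibit a sequence of functions, each the
  derivative of the one before.\<close>

lemma smooth_deriv_sequence:
  fixes F :: "nat \<Rightarrow> real \<Rightarrow> real"
  assumes "\<And>n x. (F n has_real_derivative F (Suc n) x) (at x)"
  shows "(deriv ^^ n) (F 0) = F n" and "smooth (F 0)"
proof -
  have 1: "deriv (F n) = F (Suc n)" for n
    using assms by (intro ext DERIV_imp_deriv)
  show 2: "(deriv ^^ n) (F 0) = F n" for n
    by (induction n) (simp_all add: 1)
  show "smooth (F 0)"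
    unfolding smooth_def 2 using assms real_differentiable_def by blast
qed

lemma smooth_has_derivative:
  assumes "smooth f"
  shows "((deriv ^^ n) f has_real_derivative (deriv ^^ Suc n) f x) (at x)"
  using assms unfolding smooth_def
  by (metis DERIV_deriv_iff_real_differentiable funpow.simps(2) comp_apply)

lemma smooth_deriv: "smooth f \<Longrightarrow> smooth (deriv f)"
  using smooth_deriv_sequence(2)[of "\<lambda>n. (deriv ^^ Suc n) f"] smooth_has_derivative[of f "Suc _"]
  by simp

lemma smooth_add:
  assumes "smooth f" "smooth g"
  shows "smooth (\<lambda>x. f x + g x)"
  using smooth_deriv_sequence(2)[of "\<lambda>n x. (deriv ^^ n) f x + (deriv ^^ n) g x"]
    DERIV_add[OF smooth_has_derivative[OF assms(1)] smooth_has_derivative[OF assms(2)]]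
  by simp

lemma smooth_affine:
  assumes "smooth f"
  shows "smooth (\<lambda>x. f (c * x + d))"
proof -
  have "((\<lambda>x. c ^ n * (deriv ^^ n) f (c * x + d)) has_real_derivative
      c ^ Suc n * (deriv ^^ Suc n) f (c * x + d)) (at x)" for n x
    by (rule derivative_eq_intros DERIV_chain2[OF smooth_has_derivative[OF assms]] refl | simp)+
  then show ?thesis
    using smooth_deriv_sequence(2)[of "\<lambda>n x. c ^ n * (deriv ^^ n) f (c * x + d)"] by simp
qed

text \<open>An explicit Leibniz sum is avoided by counting how often a function can be
  differentiated. The derivative of a product is a sum of two products of smooth functions, so the
  induction has to quantify over both factors.\<close>

lemma smooth_mult:
  assumes "smooth f" "smooth g"
  shows "smooth (\<lambda>x. f x * g x)"
proof -
  define D where "D n = {h. \<forall>k<n. \<forall>x::real. (deriv ^^ k) h differentiable (at x)}" for n :: nat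
  have D_Suc: "h \<in> D (Suc n) \<longleftrightarrow> (\<forall>x. h differentiable (at x)) \<and> deriv h \<in> D n" for h n
    unfolding D_def mem_Collect_eq All_less_Suc2 funpow_Suc_right comp_apply by simp
  have D_add: "(\<lambda>x. p x + q x) \<in> D n" if "p \<in> D n" "q \<in> D n" for p q n
    using that
  proof (induction n arbitrary: p q)
    case (Suc n)
    then have d: "(p has_real_derivative deriv p x) (at x)" "(q has_real_derivative deriv q x) (at x)" for x
      by (auto simp: D_Suc DERIV_deriv_iff_real_differentiable)
    have "deriv (\<lambda>x. p x + q x) = (\<lambda>x. deriv p x + deriv q x)"
      by (intro ext DERIV_imp_deriv DERIV_add d)
    then show ?case
      using Suc by (auto simp: D_Suc)
  qed (simp add: D_def)
  have "(\<lambda>x. p x * q x) \<in> D n" if "smooth p" "smooth q" for p q n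
    using that
  proof (induction n arbitrary: p q)
    case (Suc n)
    have d: "(p has_real_derivative deriv p x) (at x)" "(q has_real_derivative deriv q x) (at x)" for x
      using smooth_has_derivative[OF Suc.prems(1), of 0] smooth_has_derivative[OF Suc.prems(2), of 0]
      by simp_all
    have "deriv (\<lambda>x. p x * q x) = (\<lambda>x. deriv p x * q x + p x * deriv q x)"
      by (intro ext DERIV_imp_deriv) (auto intro!: derivative_eq_intros d)
    moreover have "(\<lambda>x. deriv p x * q x + p x * deriv q x) \<in> D n"
      by (intro D_add Suc.IH smooth_deriv Suc.prems)
    moreover have "(\<lambda>x. p x * q x) differentiable (at x)" for x
      unfolding real_differentiable_def using DERIV_mult[OF d] by blast
    ultimately show ?case by (simp add: D_Suc)
  qed (simp add: D_def)
  then show ?thesis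
    using assms unfolding smooth_def D_def by blast
qed

lemma poly_div_exp_tendsto_0:
  fixes p :: "real poly"
  shows "((\<lambda>x. poly p x / exp x) \<longlongrightarrow> 0) at_top"
proof -
  have "((\<lambda>x. \<Sum>i\<le>degree p. coeff p i * (x ^ i / exp x)) \<longlongrightarrow> (\<Sum>i\<le>degree p. coeff p i * 0)) at_top"
    by (intro tendsto_intros tendsto_power_div_exp_0)
  moreover have "(\<Sum>i\<le>degree p. coeff p i * (x ^ i / exp x)) = poly p x / exp x" for x
    by (simp add: poly_altdef sum_divide_distrib)
  ultimately show ?thesis by simp
qed

text \<open>Functions of this form are closed under differentiation, and \<open>exp_inv 1\<close> is \<open>exp (- 1 / x)\<close> on \<open>x > 0\<close>.\<close>

definition exp_inv :: "real poly \<Rightarrow> real \<Rightarrow> real" where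
  "exp_inv p x = (if x > 0 then poly p (1 / x) * exp (- (1 / x)) else 0)"

text \<open>With X = 1/x the chain rule gives X^2 (p - p')(X) exp(-X) for x > 0, which is the new
  polynomial. The only delicate point is x = 0, where the difference quotient from the right is X
  p(X) exp(-X) and tends to 0.\<close>

lemma exp_inv_has_derivative:
  "(exp_inv p has_real_derivative exp_inv (monom 1 2 * (p - pderiv p)) x) (at x)"
proof -
  consider "x > 0" | "x < 0" | "x = 0" by linarith
  then show ?thesis
  proof cases
    case 1
    have "((\<lambda>x. poly p (1 / x) * exp (- (1 / x))) has_real_derivative
        exp_inv (monom 1 2 * (p - pderiv p)) x) (at x)"
      using 1 by (auto intro!: derivative_eq_intros poly_DERIV[THEN DERIV_chain2]
        simp: exp_inv_def poly_monom power2_eq_square field_simps)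
    then show ?thesis
      by (rule DERIV_cong_ev[THEN iffD1, rotated -1])
        (use 1 in \<open>auto simp: exp_inv_def eventually_nhds intro!: exI[of _ "{0<..}"]\<close>)
  next
    case 2
    have "((\<lambda>_. 0::real) has_real_derivative exp_inv (monom 1 2 * (p - pderiv p)) x) (at x)"
      using 2 by (simp add: exp_inv_def)
    then show ?thesis
      by (rule DERIV_cong_ev[THEN iffD1, rotated -1])
        (use 2 in \<open>auto simp: exp_inv_def eventually_nhds intro!: exI[of _ "{..<0}"]\<close>)
  next
    case 3
    have "((\<lambda>y. exp_inv p y / y) \<longlongrightarrow> 0) (at_right 0)"
    proof -
      have "((\<lambda>y. poly (monom 1 1 * p) (inverse y) / exp (inverse y)) \<longlongrightarrow> 0) (at_right 0)"
        by (rule filterlim_compose[OF poly_div_exp_tendsto_0 filterlim_inverse_at_top_right])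
      then show ?thesis
        by (rule Lim_transform_eventually)
          (auto simp: eventually_at_filter exp_inv_def poly_monom exp_minus field_simps)
    qed
    moreover have "((\<lambda>y. exp_inv p y / y) \<longlongrightarrow> 0) (at_left 0)"
      by (rule Lim_transform_eventually[OF tendsto_const]) (auto simp: eventually_at_filter exp_inv_def)
    ultimately have "((\<lambda>y. exp_inv p y / y) \<longlongrightarrow> 0) (at 0)"
      by (simp add: filterlim_split_at)
    then show ?thesis
      using 3 by (simp add: has_field_derivative_iff exp_inv_def[of _ 0])
  qed
qed

lemma smooth_exp_inv: "smooth (exp_inv 1)"
  using smooth_deriv_sequence(2)[of "\<lambda>n. exp_inv (((\<lambda>p. monom 1 2 * (p - pderiv p)) ^^ n) 1)"]
    exp_inv_has_derivative by simp

definition bump :: "real \<Rightarrow> real" where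
  "bump x = exp_inv 1 x"

lemma bump_simps: "x \<le> 0 \<Longrightarrow> bump x = 0" "x > 0 \<Longrightarrow> bump x = exp (- (1 / x))"
  by (simp_all add: bump_def exp_inv_def)

lemma bump_bounds: "0 \<le> bump x" "bump x \<le> 1"
  by (simp_all add: bump_def exp_inv_def)

lemma smooth_bump: "smooth bump"
  using smooth_exp_inv unfolding bump_def by simp

lemma smooth_bump_interval: "smooth (\<lambda>x. bump (n * (x - a)) * bump (n * (b - x)))"
  using smooth_mult[OF smooth_affine[OF smooth_bump, of n "- n * a"]
    smooth_affine[OF smooth_bump, of "- n" "n * b"]]
  by (simp add: algebra_simps)

lemma test_functionI:
  assumes "smooth f" and "\<And>x. x \<notin> {a..b} \<Longrightarrow> f x = 0"
  shows "test_function f"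
  unfolding test_function_def
proof
  have "closure {x. f x \<noteq> 0} \<subseteq> {a..b}"
    by (rule closure_minimal) (use assms(2) in force)+
  then show "compact (closure {x. f x \<noteq> 0})"
    by (meson bounded_closed_interval bounded_subset closed_closure compact_eq_bounded_closed)
qed (use assms(1) smooth_def in auto)

lemma test_functionD:
  assumes "test_function f"
  shows "smooth f" and "\<exists>R>0. \<forall>x. \<bar>x\<bar> > R \<longrightarrow> f x = 0"
proof -
  show "smooth f" using assms by (simp add: test_function_def smooth_def)
  have "bounded {x. f x \<noteq> 0}"
    by (rule bounded_subset[OF compact_imp_bounded closure_subset])
      (use assms in \<open>simp add: test_function_def\<close>)
  then obtain R where R: "R > 0" "\<And>x. x \<in> {x. f x \<noteq> 0} \<Longrightarrow> norm x \<le> R"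
    by (auto simp: bounded_pos)
  have "f x = 0" if "\<bar>x\<bar> > R" for x
    using R(2)[of x] that by (cases "f x = 0") auto
  then show "\<exists>R>0. \<forall>x. \<bar>x\<bar> > R \<longrightarrow> f x = 0" using R(1) by blast
qed

section \<open>Primitives of square integrable functions\<close>

lemma cauchy_schwarz_integral:
  fixes f g :: "'a \<Rightarrow> real"
  assumes [measurable]: "f \<in> borel_measurable M" "g \<in> borel_measurable M"
    and int: "integrable M (\<lambda>x. (f x)\<^sup>2)" "integrable M (\<lambda>x. (g x)\<^sup>2)"
  shows "integrable M (\<lambda>x. f x * g x)"
    and "(\<integral>x. f x * g x \<partial>M)\<^sup>2 \<le> (\<integral>x. (f x)\<^sup>2 \<partial>M) * (\<integral>x. (g x)\<^sup>2 \<partial>M)"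
proof -
  show fg: "integrable M (\<lambda>x. f x * g x)"
  proof (rule Bochner_Integration.integrable_bound[OF Bochner_Integration.integrable_add[OF int]])
    show "AE x in M. norm (f x * g x) \<le> norm ((f x)\<^sup>2 + (g x)\<^sup>2)"
    proof (rule AE_I2)
      fix x
      have "2 * (\<bar>f x\<bar> * \<bar>g x\<bar>) \<le> (f x)\<^sup>2 + (g x)\<^sup>2"
        using sum_squares_bound[of "\<bar>f x\<bar>" "\<bar>g x\<bar>"] by (simp add: algebra_simps)
      moreover have "0 \<le> \<bar>f x\<bar> * \<bar>g x\<bar>" by simp
      ultimately have "\<bar>f x\<bar> * \<bar>g x\<bar> \<le> (f x)\<^sup>2 + (g x)\<^sup>2" by linarith
      then show "norm (f x * g x) \<le> norm ((f x)\<^sup>2 + (g x)\<^sup>2)"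
        by (simp add: abs_mult)
    qed
  qed measurable
  let ?A = "\<integral>x. (f x)\<^sup>2 \<partial>M" and ?B = "\<integral>x. (g x)\<^sup>2 \<partial>M" and ?C = "\<integral>x. f x * g x \<partial>M"
  have q: "0 \<le> k\<^sup>2 * ?A + l\<^sup>2 * ?B - 2 * k * l * ?C" for k l :: real
  proof -
    have "0 \<le> (\<integral>x. (k * f x - l * g x)\<^sup>2 \<partial>M)" by simp
    also have "\<dots> = (\<integral>x. k\<^sup>2 * (f x)\<^sup>2 + l\<^sup>2 * (g x)\<^sup>2 - (2 * k * l) * (f x * g x) \<partial>M)"
      by (rule Bochner_Integration.integral_cong) (simp_all add: power2_eq_square algebra_simps)
    also have "\<dots> = k\<^sup>2 * ?A + l\<^sup>2 * ?B - 2 * k * l * ?C"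
      using int fg by simp
    finally show ?thesis .
  qed
  have nn: "?A \<ge> 0" "?B \<ge> 0" by simp_all
  show "?C\<^sup>2 \<le> ?A * ?B"
  proof (cases "?B = 0")
    case False
    then have "?B > 0" using nn by linarith
    \<comment> \<open>The choice k = ?B, l = ?C in \<open>q\<close> lets ?B be factored out.\<close>
    have "0 \<le> ?B\<^sup>2 * ?A + ?C\<^sup>2 * ?B - 2 * ?B * ?C * ?C" by (rule q)
    also have "\<dots> = ?B * (?A * ?B - ?C\<^sup>2)" by (simp add: power2_eq_square algebra_simps)
    finally have "0 \<le> ?A * ?B - ?C\<^sup>2"
      using \<open>?B > 0\<close> mult_pos_neg[of ?B "?A * ?B - ?C\<^sup>2"] by linarith
    then show ?thesis by linarith
  next
    case True
    have "?C = 0"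
    proof (rule ccontr)
      assume "?C \<noteq> 0"
      \<comment> \<open>If ?B vanishes, k = ?C and l = (?A + 1) / 2 leave exactly -?C^2 on the
        right.\<close>
      have "0 \<le> ?C\<^sup>2 * ?A + ((?A + 1) / 2)\<^sup>2 * ?B - 2 * ?C * ((?A + 1) / 2) * ?C"
        by (rule q)
      also have "\<dots> = - ?C\<^sup>2" using True by (simp add: power2_eq_square field_simps)
      finally show False using \<open>?C \<noteq> 0\<close> by simp
    qed
    then show ?thesis using True by simp
  qed
qed

lemma indicator_square: "(indicator A x :: real)\<^sup>2 = indicator A x"
  by (simp add: indicator_def)

lemma integrable_indicator_of_square:
  fixes g :: "real \<Rightarrow> real"
  assumes [measurable]: "g \<in> borel_measurable borel" and "integrable lborel (\<lambda>x. (g x)\<^sup>2)"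
    and [measurable]: "A \<in> sets borel" and "emeasure lborel A < \<infinity>"
  shows "integrable lborel (\<lambda>x. indicator A x * g x)"
proof (rule cauchy_schwarz_integral(1))
  show "integrable lborel (\<lambda>x. (indicator A x :: real)\<^sup>2)"
    unfolding indicator_square using assms(3,4) by (intro integrable_real_indicator) simp_all
qed (use assms in simp_all)

text \<open>Absolute continuity with derivative \<open>g\<close>, phrased without almost-everywhere
  derivatives. Half-open intervals make adjacent pieces add up exactly.\<close>

definition primitive :: "(real \<Rightarrow> real) \<Rightarrow> (real \<Rightarrow> real) \<Rightarrow> bool" where
  "primitive V g \<longleftrightarrow> (\<forall>x y. x \<le> y \<longrightarrow> V y - V x = (\<integral>z. indicator {x<..y} z * g z \<partial>lborel))"

lemma primitiveD:
  "primitive V g \<Longrightarrow> x \<le> y \<Longrightarrow> V y - V x = (\<integral>z. indicator {x<..y} z * g z \<partial>lborel)"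
  by (simp add: primitive_def)

lemma integral_Ioc_eq_Icc:
  fixes g :: "real \<Rightarrow> real"
  assumes [measurable]: "g \<in> borel_measurable borel"
  shows "(\<integral>z. indicator {a<..b} z * g z \<partial>lborel) = (\<integral>z. indicator {a..b} z * g z \<partial>lborel)"
proof (rule integral_cong_AE)
  show "AE z in lborel. indicator {a<..b} z * g z = indicator {a..b} z * g z"
    using AE_lborel_singleton[of a] by eventually_elim (auto simp: indicator_def)
qed measurable

lemma primitive_exists:
  fixes g :: "real \<Rightarrow> real"
  assumes "\<And>a b. integrable lborel (\<lambda>x. indicator {a<..b} x * g x)"
  shows "\<exists>V. primitive V g"
proof
  let ?V = "\<lambda>x. (\<integral>z. indicator {0<..x} z * g z \<partial>lborel) - (\<integral>z. indicator {x<..0} z * g z \<partial>lborel)"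
  show "primitive ?V g"
    unfolding primitive_def
  proof (intro allI impI)
    fix x y :: real
    assume xy: "x \<le> y"
    have "?V y - ?V x = (\<integral>z. indicator {0<..y} z * g z - indicator {y<..0} z * g z
        - (indicator {0<..x} z * g z - indicator {x<..0} z * g z) \<partial>lborel)"
      by (simp only: Bochner_Integration.integral_diff Bochner_Integration.integrable_diff assms)
    also have "\<dots> = (\<integral>z. indicator {x<..y} z * g z \<partial>lborel)"
      by (rule Bochner_Integration.integral_cong) (use xy in \<open>auto simp: indicator_def\<close>)
    finally show "?V y - ?V x = \<dots>" .
  qed
qed

lemma primitive_holder:
  fixes g :: "real \<Rightarrow> real"
  assumes V: "primitive V g" and [measurable]: "g \<in> borel_measurable borel"
    and int: "integrable lborel (\<lambda>x. (g x)\<^sup>2)"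
  shows "(V y - V x)\<^sup>2 \<le> \<bar>y - x\<bar> * (\<integral>z. (g z)\<^sup>2 \<partial>lborel)"
proof (induction x y rule: linorder_wlog)
  case (le x y)
  have "(V y - V x)\<^sup>2 \<le> (\<integral>z. (indicator {x<..y} z :: real)\<^sup>2 \<partial>lborel) * (\<integral>z. (g z)\<^sup>2 \<partial>lborel)"
    unfolding primitiveD[OF V le]
    by (rule cauchy_schwarz_integral) (use int le in \<open>auto simp: indicator_square\<close>)
  then show ?case using le by (simp add: indicator_square)
next
  case (sym x y)
  then show ?case by (simp add: power2_commute abs_minus_commute)
qed

lemma primitive_continuous:
  fixes g :: "real \<Rightarrow> real"
  assumes V: "primitive V g" and "g \<in> borel_measurable borel"
    and "integrable lborel (\<lambda>x. (g x)\<^sup>2)"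
  shows "continuous_on UNIV V"
proof -
  have "isCont V x" for x
  proof -
    have "((\<lambda>y. sqrt (\<bar>y - x\<bar> * (\<integral>z. (g z)\<^sup>2 \<partial>lborel))) \<longlongrightarrow> sqrt (\<bar>x - x\<bar> * (\<integral>z. (g z)\<^sup>2 \<partial>lborel))) (at x)"
      by (intro tendsto_intros)
    moreover have "norm (V y - V x) \<le> sqrt (\<bar>y - x\<bar> * (\<integral>z. (g z)\<^sup>2 \<partial>lborel))" for y
      using primitive_holder[OF assms, of y x] by (intro real_le_rsqrt) (simp only: real_norm_def power2_abs)
    ultimately have "((\<lambda>y. V y - V x) \<longlongrightarrow> 0) (at x)"
      by - (rule Lim_null_comparison[OF always_eventually], rule allI, assumption, simp only: diff_self abs_zero mult_zero_left real_sqrt_zero)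
    then show ?thesis unfolding isCont_def by (rule LIM_zero_cancel)
  qed
  then show ?thesis by (intro continuous_at_imp_continuous_on ballI)
qed

text \<open>\<open>V\<close> need not be differentiable at every point, so the product rule is
  replaced by Fubini for g(z) f'(y) on the triangle a <= z <= y <= b: integrating over z first
  produces V y - V a, integrating over y first produces f b - f z.\<close>

lemma primitive_integration_by_parts:
  fixes g f f' :: "real \<Rightarrow> real"
  assumes V: "primitive V g" and g[measurable]: "g \<in> borel_measurable borel"
    and int: "integrable lborel (\<lambda>x. (g x)\<^sup>2)"
    and ab: "a \<le> b" and f: "\<And>x. a \<le> x \<Longrightarrow> x \<le> b \<Longrightarrow> (f has_real_derivative f' x) (at x)"
    and f': "continuous_on {a..b} f'"
  shows "(\<integral>y. indicator {a..b} y * (V y * f' y) \<partial>lborel) =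
    V b * f b - V a * f a - (\<integral>y. indicator {a..b} y * (g y * f y) \<partial>lborel)"
proof -
  have [measurable]: "V \<in> borel_measurable borel"
    using primitive_continuous[OF V g int] by (rule borel_measurable_continuous_onI)
  have gi: "integrable lborel (\<lambda>x. indicator {a..b} x * g x)"
    by (rule integrable_indicator_of_square[OF g int]) (simp_all add: emeasure_lborel_Icc_eq)
  have cf: "continuous_on {a..b} f"
    by (rule DERIV_atLeastAtMost_imp_continuous_on) (use f in blast)
  \<comment> \<open>Outside the interval nothing is known about \<open>f'\<close>; the truncation is
    measurable and integrable on the whole line.\<close>
  define F where "F y = indicator {a..b} y * f' y" for y
  have F_meas[measurable]: "F \<in> borel_measurable borel"
    unfolding F_def using borel_measurable_continuous_on_indicator[OF _ f'] by simp
  have Fi: "integrable lborel F"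
    using borel_integrable_atLeastAtMost'[OF f'] unfolding F_def set_integrable_def by simp
  have FTC: "(\<integral>y. indicator {z..b} y * F y \<partial>lborel) = f b - f z" if "a \<le> z" "z \<le> b" for z
  proof -
    have "(\<integral>y. indicator {z..b} y *\<^sub>R f' y \<partial>lborel) = f b - f z"
      using that f by (intro integral_FTC_Icc continuous_on_subset[OF f'])
        (auto simp: has_real_derivative_iff_has_vector_derivative intro: has_vector_derivative_at_within)
    moreover have "indicator {z..b} y * F y = indicator {z..b} y *\<^sub>R f' y" for y
      using that by (auto simp: F_def indicator_def)
    ultimately show ?thesis by (simp only:)
  qed
  let ?h = "\<lambda>y z. (indicator {a..b} z * g z) * (indicator {z..b} y * F y) :: real"
  have h_eq: "(\<lambda>(z, y). ?h y z) = (\<lambda>p. if a \<le> fst p \<and> fst p \<le> b \<and> fst p \<le> snd p \<and> snd p \<le> b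
      then g (fst p) * F (snd p) else 0)"
    by (auto simp: indicator_def fun_eq_iff)
  have h_meas: "(\<lambda>(z, y). ?h y z) \<in> borel_measurable (lborel \<Otimes>\<^sub>M lborel)"
    unfolding h_eq by measurable
  have hi: "integrable (lborel \<Otimes>\<^sub>M lborel) (\<lambda>(z, y). ?h y z)"
  proof (rule lborel_pair.Fubini_integrable[OF h_meas])
    have "integrable lborel (\<lambda>z. (\<integral>y. \<bar>F y\<bar> \<partial>lborel) * \<bar>indicator {a..b} z * g z\<bar>)"
      by (intro integrable_mult_right integrable_abs gi)
    moreover have "(\<lambda>z. \<integral>y. norm (case (z, y) of (z, y) \<Rightarrow> ?h y z) \<partial>lborel) \<in> borel_measurable lborel"
      using h_meas by (intro lborel.borel_measurable_lebesgue_integral) (simp add: split_beta')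
    moreover have "(\<integral>y. norm (?h y z) \<partial>lborel) \<le> (\<integral>y. \<bar>F y\<bar> \<partial>lborel) * \<bar>indicator {a..b} z * g z\<bar>" for z
    proof -
      have "(\<integral>y. norm (?h y z) \<partial>lborel) \<le> (\<integral>y. \<bar>indicator {a..b} z * g z\<bar> * \<bar>F y\<bar> \<partial>lborel)"
        using Fi by (intro integral_mono_AE' AE_I2)
          (auto simp: abs_mult indicator_def intro!: mult_nonneg_nonneg)
      then show ?thesis by (simp add: mult.commute)
    qed
    ultimately show "integrable lborel (\<lambda>z. \<integral>y. norm (case (z, y) of (z, y) \<Rightarrow> ?h y z) \<partial>lborel)"
      by (elim Bochner_Integration.integrable_bound) (auto intro!: AE_I2)
    show "AE z in lborel. integrable lborel (\<lambda>y. case (z, y) of (z, y) \<Rightarrow> ?h y z)"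
    proof (rule AE_I2)
      fix z
      have "integrable lborel (\<lambda>y. indicator {z..b} y *\<^sub>R F y)"
        by (intro integrable_mult_indicator Fi) simp
      then show "integrable lborel (\<lambda>y. case (z, y) of (z, y) \<Rightarrow> ?h y z)" by simp
    qed
  qed
  have inner: "(\<integral>z. ?h y z \<partial>lborel) = indicator {a..b} y * ((V y - V a) * f' y)" for y
  proof (cases "y \<in> {a..b}")
    case True
    have "(\<integral>z. ?h y z \<partial>lborel) = (\<integral>z. (indicator {a..y} z * g z) * f' y \<partial>lborel)"
      by (rule Bochner_Integration.integral_cong) (use True in \<open>auto simp: F_def indicator_def\<close>)
    also have "\<dots> = (V y - V a) * f' y"
      using primitiveD[OF V, of a y] True by (simp add: integral_Ioc_eq_Icc)
    finally show ?thesis using True by simp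
  next
    case False
    then show ?thesis by (auto simp: F_def)
  qed
  have inner2: "(\<integral>y. ?h y z \<partial>lborel) = indicator {a..b} z * (g z * (f b - f z))" for z
    using FTC[of z] by (cases "z \<in> {a..b}") simp_all
  have gfi: "integrable lborel (\<lambda>z. indicator {a..b} z * (g z * f z))"
  proof -
    have "integrable lborel (\<lambda>z. (indicator {a..b} z *\<^sub>R f z) * g z)"
    proof (rule cauchy_schwarz_integral(1))
      show "(\<lambda>z. indicator {a..b} z *\<^sub>R f z) \<in> borel_measurable lborel"
        using borel_measurable_continuous_on_indicator[OF _ cf] by simp
      have "set_integrable lborel {a..b} (\<lambda>z. (f z)\<^sup>2)"
        by (intro borel_integrable_atLeastAtMost' continuous_intros cf)
      then show "integrable lborel (\<lambda>z. (indicator {a..b} z *\<^sub>R f z)\<^sup>2)"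
        by (simp add: set_integrable_def power_mult_distrib indicator_square)
    qed (use int in auto)
    then show ?thesis by (simp add: mult_ac)
  qed
  have Vf: "integrable lborel (\<lambda>y. indicator {a..b} y * (V y * f' y))"
    using borel_integrable_atLeastAtMost'[of a b "\<lambda>y. V y * f' y"] f'
      continuous_on_subset[OF primitive_continuous[OF V g int], of "{a..b}"]
    by (simp add: set_integrable_def continuous_on_mult)
  have "(\<integral>y. indicator {a..b} y * ((V y - V a) * f' y) \<partial>lborel) = (\<integral>y. (\<integral>z. ?h y z \<partial>lborel) \<partial>lborel)"
    unfolding inner ..
  also have "\<dots> = (\<integral>z. (\<integral>y. ?h y z \<partial>lborel) \<partial>lborel)"
    using lborel_pair.Fubini_integral[OF hi] by simp
  also have "\<dots> = (\<integral>z. f b * (indicator {a..b} z * g z) - indicator {a..b} z * (g z * f z) \<partial>lborel)"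
    unfolding inner2 by (rule Bochner_Integration.integral_cong) (simp_all add: algebra_simps)
  also have "\<dots> = f b * (\<integral>z. indicator {a..b} z * g z \<partial>lborel) - (\<integral>z. indicator {a..b} z * (g z * f z) \<partial>lborel)"
    using gi gfi by simp
  also have "(\<integral>z. indicator {a..b} z * g z \<partial>lborel) = V b - V a"
    unfolding primitiveD[OF V ab] integral_Ioc_eq_Icc[OF g] ..
  finally have 1: "(\<integral>y. indicator {a..b} y * ((V y - V a) * f' y) \<partial>lborel) =
      f b * (V b - V a) - (\<integral>z. indicator {a..b} z * (g z * f z) \<partial>lborel)" .
  have "(\<integral>y. indicator {a..b} y * ((V y - V a) * f' y) \<partial>lborel) =
      (\<integral>y. indicator {a..b} y * (V y * f' y) - V a * (indicator {a..b} y * F y) \<partial>lborel)"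
  proof (rule Bochner_Integration.integral_cong)
    fix y
    show "indicator {a..b} y * ((V y - V a) * f' y) =
        indicator {a..b} y * (V y * f' y) - V a * (indicator {a..b} y * F y)"
      unfolding F_def by (cases "y \<in> {a..b}") (simp_all add: algebra_simps)
  qed simp
  also have "\<dots> = (\<integral>y. indicator {a..b} y * (V y * f' y) \<partial>lborel) - V a * (\<integral>y. indicator {a..b} y * F y \<partial>lborel)"
  proof -
    have "integrable lborel (\<lambda>y. V a * (indicator {a..b} y * F y))"
      using integrable_mult_indicator[OF _ Fi, of "{a..b}"] by (intro integrable_mult_right) simp
    then show ?thesis using Vf by (simp only: Bochner_Integration.integral_diff integral_mult_right_zero)
  qed
  also have "(\<integral>y. indicator {a..b} y * F y \<partial>lborel) = f b - f a"
    using ab by (intro FTC) auto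
  finally have "f b * (V b - V a) - (\<integral>z. indicator {a..b} z * (g z * f z) \<partial>lborel) =
      (\<integral>y. indicator {a..b} y * (V y * f' y) \<partial>lborel) - V a * (f b - f a)"
    unfolding 1 .
  then show ?thesis by argo
qed

section \<open>Weak derivatives\<close>

text \<open>After truncation to (-n, n) the positive and the negative part of the function are
  densities of two measures that are finite and equal on all half-lines {x<..}. Such measures
  coincide, and uniqueness of densities makes both parts equal almost everywhere, hence
  zero.\<close>

lemma AE_zero_if_interval_integrals_zero:
  fixes f :: "real \<Rightarrow> real"
  assumes [measurable]: "f \<in> borel_measurable borel"
    and int: "\<And>a b. integrable lborel (\<lambda>x. indicator {a<..<b} x * f x)"
    and zero: "\<And>a b. a < b \<Longrightarrow> (\<integral>x. indicator {a<..<b} x * f x \<partial>lborel) = 0"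
  shows "AE x in lborel. f x = 0"
proof -
  have "AE x in lborel. indicator {-real n<..<real n} x * f x = 0" for n
  proof -
    define h where "h x = indicator {-real n<..<real n} x * f x" for x
    have [measurable]: "h \<in> borel_measurable borel" unfolding h_def by measurable
    have hi: "integrable lborel h" unfolding h_def by (rule int)
    have split: "(\<integral>\<^sup>+ y. ennreal (max 0 (c * h y)) * indicator {x<..} y \<partial>lborel) =
        ennreal (\<integral>y. max 0 (c * h y) * indicator {x<..} y \<partial>lborel)"
      and split_int: "integrable lborel (\<lambda>y. max 0 (c * h y) * indicator {x<..} y)"
      if "\<bar>c\<bar> = 1" for c x
    proof -
      show i: "integrable lborel (\<lambda>y. max 0 (c * h y) * indicator {x<..} y)"
        by (rule Bochner_Integration.integrable_bound[OF hi])
          (use that in \<open>auto intro!: AE_I2 simp: indicator_def max_def abs_if split: if_splits\<close>)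
      have "(\<integral>\<^sup>+ y. ennreal (max 0 (c * h y)) * indicator {x<..} y \<partial>lborel) =
          (\<integral>\<^sup>+ y. ennreal (max 0 (c * h y) * indicator {x<..} y) \<partial>lborel)"
        by (intro nn_integral_cong) (auto simp: indicator_def)
      also have "\<dots> = ennreal (\<integral>y. max 0 (c * h y) * indicator {x<..} y \<partial>lborel)"
        by (rule nn_integral_eq_integral[OF i]) auto
      finally show "(\<integral>\<^sup>+ y. ennreal (max 0 (c * h y)) * indicator {x<..} y \<partial>lborel) =
        ennreal (\<integral>y. max 0 (c * h y) * indicator {x<..} y \<partial>lborel)" .
    qed
    have h0: "(\<integral>y. h y * indicator {x<..} y \<partial>lborel) = 0" for x
    proof (cases "max x (- real n) < real n")
      case True
      have "(\<integral>y. h y * indicator {x<..} y \<partial>lborel) = (\<integral>y. indicator {max x (- real n)<..<real n} y * f y \<partial>lborel)"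
        by (rule Bochner_Integration.integral_cong) (auto simp: h_def indicator_def)
      then show ?thesis using zero[OF True] by simp
    next
      case False
      then have "(\<lambda>y. h y * indicator {x<..} y) = (\<lambda>_. 0)"
        by (auto simp: h_def indicator_def)
      then show ?thesis by (simp only: Bochner_Integration.integral_zero)
    qed
    have "density lborel (\<lambda>y. ennreal (max 0 (1 * h y))) = density lborel (\<lambda>y. ennreal (max 0 (- 1 * h y)))"
    proof (rule measure_eqI_lessThan)
      fix x
      show "emeasure (density lborel (\<lambda>y. ennreal (max 0 (1 * h y)))) {x<..} < \<infinity>"
        using split[of 1 x] by (simp add: emeasure_density)
      have "(\<integral>y. max 0 (1 * h y) * indicator {x<..} y \<partial>lborel) - (\<integral>y. max 0 (-1 * h y) * indicator {x<..} y \<partial>lborel)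
          = (\<integral>y. max 0 (1 * h y) * indicator {x<..} y - max 0 (-1 * h y) * indicator {x<..} y \<partial>lborel)"
        by (intro Bochner_Integration.integral_diff[symmetric] split_int) auto
      also have "\<dots> = (\<integral>y. h y * indicator {x<..} y \<partial>lborel)"
        by (rule Bochner_Integration.integral_cong) (auto simp: indicator_def max_def)
      finally show "emeasure (density lborel (\<lambda>y. ennreal (max 0 (1 * h y)))) {x<..} =
          emeasure (density lborel (\<lambda>y. ennreal (max 0 (- 1 * h y)))) {x<..}"
        using split[of 1 x] split[of "-1" x] h0[of x] by (simp add: emeasure_density)
    qed auto
    then have "AE y in lborel. ennreal (max 0 (1 * h y)) = ennreal (max 0 (- 1 * h y))"
      by (intro sigma_finite_measure.density_unique[OF sigma_finite_lborel]) auto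
    then show ?thesis
      by eventually_elim (auto simp: h_def max_def ennreal_eq_0_iff split: if_splits)
  qed
  then have "AE x in lborel. \<forall>n. indicator {-real n<..<real n} x * f x = 0"
    by (subst AE_all_countable) blast
  then show ?thesis
  proof eventually_elim
    case (elim x)
    obtain n where "\<bar>x\<bar> < real n" using reals_Archimedean2 by blast
    then show ?case using elim[rule_format, of n] by (auto simp: indicator_def split: if_splits)
  qed
qed

lemma smooth_continuous: "smooth f \<Longrightarrow> continuous_on A f"
  using smooth_has_derivative[of f 0]
  by (intro continuous_at_imp_continuous_on) (auto intro: DERIV_isCont)

text \<open>The antiderivative that vanishes at \<open>a\<close> is constant on either side of
  [a, b]; the mean-zero condition is what makes the constant on the right vanish too, so that the
  support stays compact.\<close>

lemma test_function_antiderivative: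
  assumes "smooth \<theta>" and zero: "\<And>x. x \<notin> {a..b} \<Longrightarrow> \<theta> x = 0"
    and int: "(\<integral>x. \<theta> x \<partial>lborel) = 0" and ab: "a \<le> b"
  shows "\<exists>\<Phi>. test_function \<Phi> \<and> deriv \<Phi> = \<theta>"
proof -
  have "isCont \<theta> x" for x
    using smooth_continuous[OF assms(1), of UNIV] by (simp add: continuous_on_eq_continuous_at)
  then obtain F where "\<forall>x. (F has_vector_derivative \<theta> x) (at x)"
    using einterval_antiderivative[of "- \<infinity>" \<infinity> \<theta>] by auto
  then have F: "(F has_real_derivative \<theta> x) (at x)" for x
    by (simp add: has_real_derivative_iff_has_vector_derivative)
  define \<Phi> where "\<Phi> x = F x - F a" for x
  have \<Phi>: "(\<Phi> has_real_derivative \<theta> x) (at x)" for x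
    unfolding \<Phi>_def by (auto intro!: derivative_eq_intros F)
  have "\<Phi> b = 0"
  proof -
    have "(\<integral>x. indicator {a..b} x *\<^sub>R \<theta> x \<partial>lborel) = F b - F a"
      using ab F smooth_continuous[OF assms(1)]
      by (intro integral_FTC_Icc)
        (auto simp: has_real_derivative_iff_has_vector_derivative intro: has_vector_derivative_at_within)
    moreover have "(\<lambda>x. indicator {a..b} x *\<^sub>R \<theta> x) = \<theta>"
      using zero by (fastforce simp: indicator_def)
    ultimately show ?thesis using int by (simp only: \<Phi>_def)
  qed
  have const: "\<Phi> x = \<Phi> y" if "x \<le> y" "{x<..<y} \<inter> {a..b} = {}" for x y
  proof (cases "x < y")
    case True
    then obtain z where "x < z" "z < y" "\<Phi> y - \<Phi> x = (y - x) * \<theta> z"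
      using MVT2[of x y \<Phi> \<theta>] \<Phi> by auto
    moreover have "z \<in> {x<..<y}" using \<open>x < z\<close> \<open>z < y\<close> by simp
    then have "z \<notin> {a..b}" using that by blast
    ultimately show ?thesis using zero[of z] by simp
  qed (use that in auto)
  have "\<Phi> x = 0" if "x \<notin> {a..b}" for x
  proof (cases "x < a")
    case True
    then show ?thesis using const[of x a] by (force simp: \<Phi>_def)
  next
    case False
    then show ?thesis using const[of b x] that \<open>\<Phi> b = 0\<close> by force
  qed
  moreover have d: "deriv \<Phi> = \<theta>" using \<Phi> by (intro ext DERIV_imp_deriv)
  moreover have "smooth \<Phi>"
  proof -
    have "((deriv ^^ n) \<Phi> has_real_derivative (deriv ^^ Suc n) \<Phi> x) (at x)" for n x
    proof (cases n)
      case 0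
      then show ?thesis using \<Phi> d by simp
    next
      case (Suc m)
      then show ?thesis
        using smooth_has_derivative[OF assms(1), of m x] by (simp only: funpow_Suc_right comp_apply d)
    qed
    then show ?thesis using smooth_deriv_sequence(2)[of "\<lambda>n. (deriv ^^ n) \<Phi>"] by simp
  qed
  ultimately show ?thesis using test_functionI by blast
qed

lemma bump_interval_tendsto:
  "(\<lambda>n. bump (real n * (x - a)) * bump (real n * (b - x))) \<longlonglongrightarrow> indicator {a<..<b} x"
proof -
  have 1: "(\<lambda>n. bump (real n * y)) \<longlonglongrightarrow> indicator {0<..} y" for y
  proof (cases "y > 0")
    case True
    have "(\<lambda>n. exp (- (1 / (real n * y)))) \<longlonglongrightarrow> 1"
      using True by real_asymp
    then have "(\<lambda>n. bump (real n * y)) \<longlonglongrightarrow> 1"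
      by (rule Lim_transform_eventually)
        (use True in \<open>auto simp: bump_simps intro!: eventually_mono[OF eventually_gt_at_top[of 0]]\<close>)
    then show ?thesis using True by simp
  next
    case False
    then have "bump (real n * y) = 0" for n
      by (simp add: bump_simps mult_nonneg_nonpos)
    then show ?thesis using False by simp
  qed
  have "(\<lambda>n. bump (real n * (x - a)) * bump (real n * (b - x))) \<longlonglongrightarrow>
      indicator {0<..} (x - a) * indicator {0<..} (b - x)"
    by (intro tendsto_mult 1)
  moreover have "indicator {0<..} (x - a) * indicator {0<..} (b - x) = (indicator {a<..<b} x :: real)"
    by (simp add: indicator_def)
  ultimately show ?thesis by (simp only:)
qed

text \<open>The du Bois-Reymond lemma. A bump on (a, b) minus the right multiple of one fixed bump
  has mean zero, hence is the derivative of a test function and is annihilated by \<open>w\<close>.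
  So \<open>w\<close> acts on bumps like the constant \<open>c\<close>, and sharpening the bumps to
  indicators yields the same for intervals.\<close>

lemma AE_const_if_weak_deriv_zero:
  fixes w :: "real \<Rightarrow> real"
  assumes [measurable]: "w \<in> borel_measurable borel"
    and int: "\<And>a b. integrable lborel (\<lambda>x. indicator {a..b} x * w x)"
    and zero: "\<And>\<phi>. test_function \<phi> \<Longrightarrow> (\<integral>x. w x * deriv \<phi> x \<partial>lborel) = 0"
  shows "\<exists>c. AE x in lborel. w x = c"
proof -
  define B where "B a b n x = bump (real n * (x - a)) * bump (real n * (b - x))" for a b n x
  have B_smooth: "smooth (B a b n)" for a b n
    using smooth_bump_interval[of "real n" a b] unfolding B_def .
  have B01: "0 \<le> B a b n x" "B a b n x \<le> 1" for a b n x
    unfolding B_def using bump_bounds by (auto intro: mult_le_one)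
  have B0: "B a b n x = 0" if "x \<notin> {a..b}" for a b n x
    using that unfolding B_def by (auto simp: bump_simps mult_nonneg_nonpos not_le)
  have B_meas[measurable]: "B a b n \<in> borel_measurable borel" for a b n
    using smooth_continuous[OF B_smooth] by (rule borel_measurable_continuous_onI)
  have B_le: "\<bar>B a b n x\<bar> \<le> indicator {a..b} x" for a b n x
    using B01[of a b n x] B0[of x a b n] by (auto simp: indicator_def)
  have Bi: "integrable lborel (B a b n)" for a b n
    by (rule Bochner_Integration.integrable_bound[of _ "indicator {a..b} :: real \<Rightarrow> real"])
      (use B_le[of a b n] in \<open>auto intro!: AE_I2 simp: emeasure_lborel_Icc_eq\<close>)
  have wBi: "integrable lborel (\<lambda>x. w x * B a b n x)" for a b n
    by (rule Bochner_Integration.integrable_bound[OF int[of a b]])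
      (use mult_mono[OF order_refl B_le[of a b n], of "\<bar>w _\<bar>"] in \<open>auto intro!: AE_I2 simp: abs_mult mult.commute\<close>)
  define m where "m = (\<integral>x. B 0 1 1 x \<partial>lborel)"
  have m0: "m \<noteq> 0"
  proof
    assume "m = 0"
    then have "AE x in lborel. B 0 1 1 x = 0"
      unfolding m_def using integral_nonneg_eq_0_iff_AE[OF Bi[of 0 1 1]] B01 by simp
    moreover have "{x \<in> space lborel. B 0 1 1 x \<noteq> 0} \<in> sets lborel" by measurable
    ultimately have "emeasure lborel {x. B 0 1 1 x \<noteq> 0} = 0"
      using AE_iff_measurable[of "{x. B 0 1 1 x \<noteq> 0}" lborel "\<lambda>x. B 0 1 1 x = 0"] by simp
    moreover have "emeasure lborel {0<..<1::real} \<le> emeasure lborel {x. B 0 1 1 x \<noteq> 0}"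
    proof (rule emeasure_mono)
      show "{0<..<1} \<subseteq> {x. B 0 1 1 x \<noteq> 0}" by (auto simp: B_def bump_simps)
      show "{x. B 0 1 1 x \<noteq> 0} \<in> sets lborel"
        using \<open>{x \<in> space lborel. B 0 1 1 x \<noteq> 0} \<in> sets lborel\<close> by simp
    qed
    ultimately show False by simp
  qed
  define c where "c = (\<integral>x. w x * B 0 1 1 x \<partial>lborel) / m"
  have eq: "(\<integral>x. w x * B a b n x \<partial>lborel) = c * (\<integral>x. B a b n x \<partial>lborel)" if "a < b" for a b n
  proof -
    \<comment> \<open>The multiple of the reference bump on (0, 1) that carries the same mass as
      \<open>B a b n\<close>.\<close>
    define k where "k = (\<integral>x. B a b n x \<partial>lborel) / m"
    let ?\<theta> = "\<lambda>x. B a b n x + (- k) * B 0 1 1 x"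
    have "\<exists>\<Phi>. test_function \<Phi> \<and> deriv \<Phi> = ?\<theta>"
    proof (rule test_function_antiderivative)
      have "smooth (\<lambda>x. (- k) * B 0 1 1 x)"
        using smooth_deriv_sequence(2)[of "\<lambda>i x. (- k) * (deriv ^^ i) (B 0 1 1) x",
          OF DERIV_cmult[OF smooth_has_derivative[OF B_smooth]]] by (simp only: funpow_0)
      then show "smooth ?\<theta>"
        by (intro smooth_add B_smooth)
      show "?\<theta> x = 0" if "x \<notin> {min a 0..max b 1}" for x
      proof -
        have "x \<notin> {a..b}" "x \<notin> {0..1}" using that by auto
        then show ?thesis using B0 by simp
      qed
      show "(\<integral>x. ?\<theta> x \<partial>lborel) = 0"
        using Bi m0 by (simp add: k_def m_def)
    qed (use \<open>a < b\<close> in auto)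
    then obtain \<Phi> where \<Phi>: "test_function \<Phi>" "deriv \<Phi> = ?\<theta>" by blast
    have "0 = (\<integral>x. w x * B a b n x - k * (w x * B 0 1 1 x) \<partial>lborel)"
      using zero[OF \<Phi>(1)] unfolding \<Phi>(2) by (simp add: algebra_simps)
    also have "\<dots> = (\<integral>x. w x * B a b n x \<partial>lborel) - k * (\<integral>x. w x * B 0 1 1 x \<partial>lborel)"
      using wBi by simp
    finally show ?thesis using m0 by (simp add: c_def k_def)
  qed
  have int': "integrable lborel (\<lambda>x. indicator {a..b} x * (w x - c))" for a b
    using Bochner_Integration.integrable_diff[OF int[of a b], of "\<lambda>x. c * indicator {a..b} x"]
    by (simp add: algebra_simps emeasure_lborel_Icc_eq)
  have "AE x in lborel. w x - c = 0"
  proof (rule AE_zero_if_interval_integrals_zero)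
    show "integrable lborel (\<lambda>x. indicator {a<..<b} x * (w x - c))" for a b
      by (rule Bochner_Integration.integrable_bound[OF int'[of a b]]) (auto simp: indicator_def)
    fix a b :: real
    assume "a < b"
    have "(\<lambda>n. \<integral>x. (w x - c) * B a b n x \<partial>lborel) \<longlonglongrightarrow> (\<integral>x. (w x - c) * indicator {a<..<b} x \<partial>lborel)"
    proof (rule integral_dominated_convergence)
      show "integrable lborel (\<lambda>x. \<bar>indicator {a..b} x * (w x - c)\<bar>)"
        using int' by (rule integrable_abs)
      show "AE x in lborel. (\<lambda>n. (w x - c) * B a b n x) \<longlonglongrightarrow> (w x - c) * indicator {a<..<b} x"
        unfolding B_def by (intro AE_I2 tendsto_intros bump_interval_tendsto)
      show "AE x in lborel. norm ((w x - c) * B a b n x) \<le> \<bar>indicator {a..b} x * (w x - c)\<bar>" for n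
        using mult_mono[OF order_refl B_le[of a b n], of "\<bar>w _ - c\<bar>"]
        by (intro AE_I2) (simp add: abs_mult mult.commute)
    qed measurable
    moreover have "(\<integral>x. (w x - c) * B a b n x \<partial>lborel) = 0" for n
      using eq[OF \<open>a < b\<close>, of n] wBi[of a b n] Bi[of a b n] by (simp add: left_diff_distrib)
    ultimately show "(\<integral>x. indicator {a<..<b} x * (w x - c) \<partial>lborel) = 0"
      by (simp add: LIMSEQ_const_iff mult.commute)
  qed simp
  then show ?thesis by (intro exI[of _ c]) simp
qed

text \<open>A primitive of a Borel version of \<open>g\<close> has the same weak derivative as
  \<open>u\<close>, so the two differ almost everywhere by a constant, which is absorbed into
  \<open>V\<close>.\<close>

lemma H1_representative:
  assumes u: "square_integrable u" and g: "square_integrable g" and weak: "is_weak_deriv u g"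
  obtains V g' where "g' \<in> borel_measurable borel" "AE x in lebesgue. g x = g' x"
    "primitive V g'" "AE x in lebesgue. u x = V x"
proof -
  have "\<exists>f'\<in>borel_measurable lborel. (AE x in lebesgue. f x = f' x) \<and> integrable lborel (\<lambda>x. (f' x)\<^sup>2)"
    if f: "square_integrable f" for f
  proof -
    obtain f' where f'[measurable]: "f' \<in> borel_measurable lborel" and ae: "AE x in lborel. f x = f' x"
      using completion_ex_borel_measurable_real[of f lborel] f by (auto simp: square_integrable_def)
    have ae': "AE x in lebesgue. f x = f' x" using ae by (rule AE_completion)
    have "integrable lebesgue (\<lambda>x. (f' x)\<^sup>2)"
      using f ae' unfolding square_integrable_def
      by (elim conjE, elim integrable_cong_AE_imp) (auto intro: measurable_completion)
    then show ?thesis using f' ae' by (auto simp: integrable_completion)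
  qed
  then obtain u' g' where u'[measurable]: "u' \<in> borel_measurable lborel" "AE x in lebesgue. u x = u' x"
      "integrable lborel (\<lambda>x. (u' x)\<^sup>2)"
    and g'[measurable]: "g' \<in> borel_measurable lborel" "AE x in lebesgue. g x = g' x"
      "integrable lborel (\<lambda>x. (g' x)\<^sup>2)"
    using u g by meson
  have [measurable]: "g' \<in> borel_measurable borel" "u' \<in> borel_measurable borel"
    using u'(1) g'(1) by simp_all
  obtain V where V: "primitive V g'"
  proof -
    have "integrable lborel (\<lambda>x. indicator {a<..b} x * g' x)" for a b
    proof (rule integrable_indicator_of_square)
      show "emeasure lborel {a<..b} < \<infinity>"
        by (rule le_less_trans[OF emeasure_mono[of _ "{a..b}"]]) (auto simp: emeasure_lborel_Icc_eq)
    qed (use g' in simp_all)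
    then show ?thesis using primitive_exists that by blast
  qed
  have Vc: "continuous_on A V" for A
    using primitive_continuous[OF V _ g'(3)] continuous_on_subset by auto
  have [measurable]: "V \<in> borel_measurable borel"
    using Vc by (rule borel_measurable_continuous_onI)
  have "\<exists>c. AE x in lborel. u' x - V x = c"
  proof (rule AE_const_if_weak_deriv_zero)
    have ui: "integrable lborel (\<lambda>x. indicator {a..b} x * u' x)" for a b
      by (rule integrable_indicator_of_square) (use u' in \<open>simp_all add: emeasure_lborel_Icc_eq\<close>)
    moreover have "integrable lborel (\<lambda>x. indicator {a..b} x * V x)" for a b
      using borel_integrable_atLeastAtMost'[OF Vc] by (simp add: set_integrable_def)
    ultimately show "integrable lborel (\<lambda>x. indicator {a..b} x * (u' x - V x))" for a b
      using Bochner_Integration.integrable_diff by (simp add: right_diff_distrib)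
    fix \<phi> assume \<phi>: "test_function \<phi>"
    note sm = test_functionD(1)[OF \<phi>]
    have d: "(\<phi> has_real_derivative deriv \<phi> x) (at x)" for x
      using smooth_has_derivative[OF sm, of 0] by simp
    have dc: "continuous_on A (deriv \<phi>)" "continuous_on A \<phi>" for A
      using smooth_continuous smooth_deriv sm by blast+
    have [measurable]: "\<phi> \<in> borel_measurable borel" "deriv \<phi> \<in> borel_measurable borel"
      using dc by (auto intro: borel_measurable_continuous_onI)
    obtain R0 where R0: "R0 > 0" "\<And>x. \<bar>x\<bar> > R0 \<Longrightarrow> \<phi> x = 0"
      using test_functionD(2)[OF \<phi>] by blast
    \<comment> \<open>The extra 1 places the end points of [-R, R] where \<phi> vanishes on a whole
      neighbourhood, so that its derivative vanishes there as well.\<close>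
    define R where "R = R0 + 1"
    have out: "\<phi> x = 0" "deriv \<phi> x = 0" if "x \<notin> {-R<..<R}" for x
    proof -
      have "\<bar>x\<bar> > R0" using that R_def by auto
      then show "\<phi> x = 0" using R0 by blast
      have "eventually (\<lambda>y. y \<in> {y. \<bar>y\<bar> > R0}) (nhds x)"
        using \<open>\<bar>x\<bar> > R0\<close> by (intro eventually_nhds_in_open open_Collect_less continuous_intros) simp
      then have "eventually (\<lambda>y. \<phi> y = 0) (nhds x)"
        by eventually_elim (use R0 in auto)
      then have "deriv \<phi> x = deriv (\<lambda>_. 0) x" by (intro deriv_cong_ev) auto
      then show "deriv \<phi> x = 0" by simp
    qed
    have R: "-R \<le> R" using R0 R_def by simp
    have ind: "indicator {-R..R} x * (h x * deriv \<phi> x) = h x * deriv \<phi> x"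
      "indicator {-R..R} x * (h x * \<phi> x) = h x * \<phi> x" for x and h :: "real \<Rightarrow> real"
      using out[of x] by (cases "x \<in> {-R<..<R}"; simp)+
    have "(\<integral>x. V x * deriv \<phi> x \<partial>lborel) = - (\<integral>x. g' x * \<phi> x \<partial>lborel)"
      using primitive_integration_by_parts[OF V _ g'(3) R d dc(1)] out(1)[of R] out(1)[of "-R"]
      by (simp add: ind)
    moreover have "(\<integral>x. u' x * deriv \<phi> x \<partial>lborel) = - (\<integral>x. g' x * \<phi> x \<partial>lborel)"
    proof -
      have ae: "(\<integral>x. f' x * h x \<partial>lborel) = (\<integral>x. f x * h x \<partial>lebesgue)"
        if "AE x in lebesgue. f x = f' x" "f' \<in> borel_measurable borel" "h \<in> borel_measurable borel"
          "f \<in> borel_measurable lebesgue"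
        for f f' h :: "real \<Rightarrow> real"
      proof -
        have "(\<integral>x. f x * h x \<partial>lebesgue) = (\<integral>x. f' x * h x \<partial>lebesgue)"
        proof (rule integral_cong_AE)
          show "(\<lambda>x. f x * h x) \<in> borel_measurable lebesgue" "(\<lambda>x. f' x * h x) \<in> borel_measurable lebesgue"
            using that measurable_completion[of _ lborel borel] by (auto intro!: borel_measurable_times)
        qed (use that(1) in auto)
        then show ?thesis using that by (simp add: integral_completion)
      qed
      show ?thesis
        using weak \<phi> u g u'(2) g'(2)
        by (simp add: ae[of u u'] ae[of g g'] is_weak_deriv_def square_integrable_def)
    qed
    moreover have "integrable lborel (\<lambda>x. u' x * deriv \<phi> x)"
    proof -
      have "integrable lborel (\<lambda>x. u' x * (indicator {-R..R} x * deriv \<phi> x))"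
      proof (rule cauchy_schwarz_integral(1))
        show "integrable lborel (\<lambda>x. (indicator {-R..R} x * deriv \<phi> x)\<^sup>2)"
          using borel_integrable_atLeastAtMost'[OF continuous_on_power[OF dc(1)], of "-R" R 2]
          by (simp add: set_integrable_def power_mult_distrib indicator_square)
      qed (use u'(3) in auto)
      moreover have "(\<lambda>x. u' x * (indicator {-R..R} x * deriv \<phi> x)) = (\<lambda>x. u' x * deriv \<phi> x)"
        using ind(1)[of _ u'] by (simp only: mult.left_commute)
      ultimately show ?thesis by (simp only:)
    qed
    moreover have "integrable lborel (\<lambda>x. V x * deriv \<phi> x)"
      using borel_integrable_atLeastAtMost'[OF continuous_on_mult[OF Vc dc(1)], of "-R" R] ind(1)[of _ V]
      by (simp add: set_integrable_def)
    ultimately show "(\<integral>x. (u' x - V x) * deriv \<phi> x \<partial>lborel) = 0"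
      by (simp add: left_diff_distrib)
  qed simp
  then obtain c where c: "AE x in lborel. u' x - V x = c" by blast
  show ?thesis
  proof (rule that[of g' "\<lambda>x. V x + c"])
    show "primitive (\<lambda>x. V x + c) g'" using V by (simp add: primitive_def)
    have "AE x in lebesgue. u' x - V x = c" using c by (rule AE_completion)
    then show "AE x in lebesgue. u x = V x + c" using u'(2) by eventually_elim auto
  qed (use g' in auto)
qed

section \<open>Regularised Airy integrals\<close>

text \<open>The phase shift \<open>n * pi / 2\<close> turns \<open>\<partial>\<^sub>x\<close> into \<open>n \<mapsto> n + 1\<close>; with it, \<open>airy_reg n a t\<close> is the \<open>n\<close>-th
  derivative of the solution at time \<open>t\<close> with initial value a Gaussian of variance \<open>2 * a\<close>.\<close>

definition airy_kernel :: "nat \<Rightarrow> real \<Rightarrow> real \<Rightarrow> real \<Rightarrow> real \<Rightarrow> real" where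
  "airy_kernel n a t x \<xi> = \<xi> ^ n * cos (\<xi> * x + \<xi> ^ 3 * t + real n * pi / 2) * exp (- a * \<xi>\<^sup>2)"

definition airy_reg :: "nat \<Rightarrow> real \<Rightarrow> real \<Rightarrow> real \<Rightarrow> real" where
  "airy_reg n a t x = (\<integral>\<xi>. airy_kernel n a t x \<xi> \<partial>lborel) / (2 * pi)"

definition gauss_moment :: "nat \<Rightarrow> real \<Rightarrow> real" where
  "gauss_moment n a = (\<integral>\<xi>. \<bar>\<xi>\<bar> ^ n * exp (- a * \<xi>\<^sup>2) \<partial>lborel) / (2 * pi)"

lemma cos_quarter_shift: "cos (z + real (Suc n) * pi / 2) = - sin (z + real n * pi / 2)"
  and sin_quarter_shift: "sin (z + real (Suc n) * pi / 2) = cos (z + real n * pi / 2)"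
proof -
  have "z + real (Suc n) * pi / 2 = (z + real n * pi / 2) + pi / 2"
    by (simp add: field_simps)
  then show "cos (z + real (Suc n) * pi / 2) = - sin (z + real n * pi / 2)"
    "sin (z + real (Suc n) * pi / 2) = cos (z + real n * pi / 2)"
    by (simp_all only: cos_add[of _ "pi / 2"] sin_add[of _ "pi / 2"] cos_pi_half sin_pi_half mult_zero_right mult_1_right
      diff_0 add_0)
qed

lemma airy_kernel_measurable[measurable]: "airy_kernel n a t x \<in> borel_measurable borel"
  unfolding airy_kernel_def by measurable

lemma airy_kernel_bound: "\<bar>airy_kernel n a t x \<xi>\<bar> \<le> \<bar>\<xi>\<bar> ^ n * exp (- a * \<xi>\<^sup>2)"
proof -
  have "\<bar>airy_kernel n a t x \<xi>\<bar> = \<bar>\<xi>\<bar> ^ n * exp (- a * \<xi>\<^sup>2) * \<bar>cos (\<xi> * x + \<xi> ^ 3 * t + real n * pi / 2)\<bar>"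
    by (simp add: airy_kernel_def abs_mult power_abs)
  also have "\<dots> \<le> \<bar>\<xi>\<bar> ^ n * exp (- a * \<xi>\<^sup>2) * 1"
    by (intro mult_left_mono abs_cos_le_one) simp
  finally show ?thesis by simp
qed

lemma airy_kernel_integrable: "a > 0 \<Longrightarrow> integrable lborel (airy_kernel n a t x)"
  by (rule Bochner_Integration.integrable_bound[OF integrable_gaussian_moment[of a n]])
    (auto intro!: AE_I2 order_trans[OF airy_kernel_bound])

lemma airy_reg_bound:
  assumes "a > 0"
  shows "\<bar>airy_reg n a t x\<bar> \<le> gauss_moment n a"
proof -
  have "\<bar>\<integral>\<xi>. airy_kernel n a t x \<xi> \<partial>lborel\<bar> \<le> (\<integral>\<xi>. \<bar>\<xi>\<bar> ^ n * exp (- a * \<xi>\<^sup>2) \<partial>lborel)"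
    by (rule order_trans[OF integral_abs_bound integral_mono[OF integrable_abs]])
      (intro airy_kernel_integrable integrable_gaussian_moment assms airy_kernel_bound)+
  then show ?thesis
    unfolding airy_reg_def gauss_moment_def by (simp add: abs_divide divide_right_mono)
qed

lemma gauss_moment_nonneg: "gauss_moment n a \<ge> 0"
  unfolding gauss_moment_def by (intro divide_nonneg_nonneg integral_nonneg_AE) auto

lemma airy_kernel_deriv_x:
  "((\<lambda>x. airy_kernel n a t x \<xi>) has_real_derivative airy_kernel (Suc n) a t x \<xi>) (at x)"
  unfolding airy_kernel_def cos_quarter_shift
  by (auto intro!: derivative_eq_intros simp: algebra_simps)

text \<open>Differentiating the phase in t brings down the cube of the frequency, and three quarter
  turns of the phase supply the sign: each Fourier mode solves the linear KdV equation.\<close>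

lemma airy_kernel_deriv_t:
  "((\<lambda>t. airy_kernel n a t x \<xi>) has_real_derivative - airy_kernel (n + 3) a t x \<xi>) (at t)"
proof -
  have "n + 3 = Suc (Suc (Suc n))" by simp
  then show ?thesis
    unfolding airy_kernel_def
    by (simp only: cos_quarter_shift sin_quarter_shift)
      (auto intro!: derivative_eq_intros simp: algebra_simps power_add eval_nat_numeral)
qed

lemma airy_reg_deriv_x:
  assumes "a > 0"
  shows "((\<lambda>x. airy_reg n a t x) has_real_derivative airy_reg (Suc n) a t x) (at x)"
  unfolding airy_reg_def
  by (rule DERIV_cdivide, rule has_real_derivative_integral[where d = 1
        and w = "\<lambda>\<xi>. \<bar>\<xi>\<bar> ^ Suc n * exp (- a * \<xi>\<^sup>2)"])
    (simp_all only: airy_kernel_deriv_x airy_kernel_bound airy_kernel_integrable[OF assms]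
      integrable_gaussian_moment[OF assms] zero_less_one borel_measurable_integrable[OF airy_kernel_integrable[OF assms]])

lemma airy_reg_deriv_t:
  assumes "a > 0"
  shows "((\<lambda>t. airy_reg n a t x) has_real_derivative - airy_reg (n + 3) a t x) (at t)"
proof -
  have "((\<lambda>t. \<integral>\<xi>. airy_kernel n a t x \<xi> \<partial>lborel) has_real_derivative
      (\<integral>\<xi>. - airy_kernel (n + 3) a t x \<xi> \<partial>lborel)) (at t)"
  proof (rule has_real_derivative_integral[where d = 1 and w = "\<lambda>\<xi>. \<bar>\<xi>\<bar> ^ (n + 3) * exp (- a * \<xi>\<^sup>2)"])
    show "(\<lambda>\<xi>. - airy_kernel (n + 3) a t x \<xi>) \<in> borel_measurable lborel" by measurable
    show "\<bar>- airy_kernel (n + 3) a t x \<xi>\<bar> \<le> \<bar>\<xi>\<bar> ^ (n + 3) * exp (- a * \<xi>\<^sup>2)" for t \<xi>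
      using airy_kernel_bound[of "n + 3" a t x \<xi>] by (simp only: abs_minus_cancel)
  qed (simp_all only: airy_kernel_deriv_t airy_kernel_integrable[OF assms]
      integrable_gaussian_moment[OF assms] zero_less_one)
  from DERIV_cdivide[OF this, of "2 * pi"] show ?thesis
    unfolding airy_reg_def by (simp only: Bochner_Integration.integral_minus minus_divide_left)
qed

text \<open>Integration of a total derivative in the frequency variable; it trades a factor x for a
  change of the index. It serves three times: for spatial decay, for the Gaussian at time 0 and for
  the Airy equation. At n = 0 the truncated index \<open>n - 1\<close> is harmless because of its
  factor n.\<close>

lemma airy_reg_recurrence:
  assumes "a > 0"
  shows "real n * airy_reg (n - 1) a t x + x * airy_reg n a t x - 3 * t * airy_reg (n + 2) a t x
    + 2 * a * airy_reg (n + 1) a t x = 0"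
proof -
  \<comment> \<open>The sine belonging to the phase of \<open>airy_kernel n\<close>: its phase
    derivative restores the cosine with the factor x + 3 t times the squared frequency.\<close>
  define f where "f \<xi> = \<xi> ^ n * sin (\<xi> * x + \<xi> ^ 3 * t + real n * pi / 2) * exp (- a * \<xi>\<^sup>2)" for \<xi>
  define f' where "f' \<xi> = real n * airy_kernel (n - 1) a t x \<xi> + x * airy_kernel n a t x \<xi>
    - 3 * t * airy_kernel (n + 2) a t x \<xi> + 2 * a * airy_kernel (n + 1) a t x \<xi>" for \<xi>
  have c1: "cos (z + real (n + 1) * pi / 2) = - sin (z + real n * pi / 2)" for z
    using cos_quarter_shift[of z n] by simp
  have c2: "cos (z + real (n + 2) * pi / 2) = - cos (z + real n * pi / 2)" for z
    using cos_quarter_shift[of z "Suc n"] sin_quarter_shift[of z n] by simp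
  have f'_eq: "f' \<xi> = real n * \<xi> ^ (n - 1) * sin (\<xi> * x + \<xi> ^ 3 * t + real n * pi / 2) * exp (- a * \<xi>\<^sup>2)
     + \<xi> ^ n * (cos (\<xi> * x + \<xi> ^ 3 * t + real n * pi / 2) * (x + 3 * \<xi>\<^sup>2 * t)) * exp (- a * \<xi>\<^sup>2)
     + \<xi> ^ n * sin (\<xi> * x + \<xi> ^ 3 * t + real n * pi / 2) * (exp (- a * \<xi>\<^sup>2) * (- a * (2 * \<xi>)))" for \<xi>
  proof (cases n)
    case 0
    then show ?thesis
      unfolding f'_def airy_kernel_def c1 c2
      by (simp add: algebra_simps power2_eq_square)
  next
    case (Suc m)
    then have c0: "cos (z + real (n - 1) * pi / 2) = sin (z + real n * pi / 2)" for z
      using sin_quarter_shift[of z m] by simp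
    show ?thesis
      unfolding f'_def airy_kernel_def c0 c1 c2
      by (simp add: algebra_simps power2_eq_square power_add)
  qed
  have der: "(f has_real_derivative f' \<xi>) (at \<xi>)" for \<xi>
    unfolding f_def f'_eq
    by (rule derivative_eq_intros refl | simp)+ (simp add: algebra_simps power2_eq_square)
  have int: "integrable lborel f'"
    unfolding f'_def using airy_kernel_integrable[OF assms] by simp
  have lim: "(f \<longlongrightarrow> 0) F" if "((\<lambda>\<xi>. \<bar>\<xi>\<bar> ^ n * exp (- a * \<xi>\<^sup>2)) \<longlongrightarrow> 0) F" for F
  proof (rule Lim_null_comparison[OF always_eventually that], rule allI)
    fix \<xi>
    have "norm (f \<xi>) = \<bar>\<xi>\<bar> ^ n * exp (- a * \<xi>\<^sup>2) * \<bar>sin (\<xi> * x + \<xi> ^ 3 * t + real n * pi / 2)\<bar>"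
      by (simp add: f_def abs_mult power_abs)
    also have "\<dots> \<le> \<bar>\<xi>\<bar> ^ n * exp (- a * \<xi>\<^sup>2) * 1"
      by (intro mult_left_mono abs_sin_le_one) simp
    finally show "norm (f \<xi>) \<le> \<bar>\<xi>\<bar> ^ n * exp (- a * \<xi>\<^sup>2)" by simp
  qed
  have "isCont f' \<xi>" for \<xi>
    unfolding f'_def airy_kernel_def by (intro continuous_intros) auto
  then have "(\<integral>\<xi>. f' \<xi> \<partial>lborel) = 0"
    using integral_deriv_eq_0[OF der _ int lim lim] gaussian_moment_tendsto[OF assms] by blast
  moreover have "(\<integral>\<xi>. f' \<xi> \<partial>lborel) / (2 * pi) = real n * airy_reg (n - 1) a t x + x * airy_reg n a t x
      - 3 * t * airy_reg (n + 2) a t x + 2 * a * airy_reg (n + 1) a t x"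
    unfolding f'_def airy_reg_def using airy_kernel_integrable[OF assms]
    by (simp add: add_divide_distrib diff_divide_distrib)
  ultimately show ?thesis by simp
qed

text \<open>By the recurrence each power of x costs only a shift of the index, and
  \<open>airy_reg_bound\<close> is uniform in x and t. Two powers suffice for all later pairings
  with L2 functions.\<close>

lemma airy_reg_decay:
  assumes a: "a > 0" and T: "T \<ge> 0"
  shows "\<exists>C>0. \<forall>t x. \<bar>t\<bar> \<le> T \<longrightarrow> \<bar>airy_reg n a t x\<bar> \<le> C / (1 + x\<^sup>2)"
proof -
  have step: "\<bar>x * (x ^ k * airy_reg m a t x)\<bar> \<le> 3 * T * \<bar>x ^ k * airy_reg (m + 2) a t x\<bar>
      + 2 * a * \<bar>x ^ k * airy_reg (m + 1) a t x\<bar> + real m * \<bar>x ^ k * airy_reg (m - 1) a t x\<bar>"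
    if "\<bar>t\<bar> \<le> T" for k m t x
  proof -
    have "x * airy_reg m a t x = 3 * t * airy_reg (m + 2) a t x - 2 * a * airy_reg (m + 1) a t x
        - real m * airy_reg (m - 1) a t x"
      using airy_reg_recurrence[OF a, of m t x] by simp
    then have "x * (x ^ k * airy_reg m a t x) = 3 * t * (x ^ k * airy_reg (m + 2) a t x)
        - 2 * a * (x ^ k * airy_reg (m + 1) a t x) - real m * (x ^ k * airy_reg (m - 1) a t x)"
      unfolding mult.left_commute[of x "x ^ k"] by (simp add: right_diff_distrib mult.left_commute)
    moreover have "\<bar>p - q - r\<bar> \<le> \<bar>p\<bar> + \<bar>q\<bar> + \<bar>r\<bar>" for p q r :: real by arith
    ultimately have "\<bar>x * (x ^ k * airy_reg m a t x)\<bar> \<le> \<bar>3 * t * (x ^ k * airy_reg (m + 2) a t x)\<bar>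
        + \<bar>2 * a * (x ^ k * airy_reg (m + 1) a t x)\<bar> + \<bar>real m * (x ^ k * airy_reg (m - 1) a t x)\<bar>"
      by metis
    then have "\<bar>x * (x ^ k * airy_reg m a t x)\<bar> \<le> 3 * \<bar>t\<bar> * \<bar>x ^ k * airy_reg (m + 2) a t x\<bar>
        + 2 * a * \<bar>x ^ k * airy_reg (m + 1) a t x\<bar> + real m * \<bar>x ^ k * airy_reg (m - 1) a t x\<bar>"
      using a by (simp only: abs_mult[of "3 * t"] abs_mult[of "2 * a"] abs_mult[of "real m"]
          abs_mult[of 3] abs_mult[of 2] abs_numeral abs_of_nat abs_of_pos[OF a])
    then show ?thesis
      using mult_right_mono[OF that, of "3 * \<bar>x ^ k * airy_reg (m + 2) a t x\<bar>"] by (simp add: mult_ac)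
  qed
  have bd: "\<exists>C. \<forall>t x. \<bar>t\<bar> \<le> T \<longrightarrow> \<bar>x ^ k * airy_reg m a t x\<bar> \<le> C" for k m
  proof (induction k arbitrary: m)
    case 0
    then show ?case using airy_reg_bound[OF a] by auto
  next
    case (Suc k)
    obtain A where A: "\<And>t x. \<bar>t\<bar> \<le> T \<Longrightarrow> \<bar>x ^ k * airy_reg (m + 2) a t x\<bar> \<le> A"
      using Suc[of "m + 2"] by blast
    obtain B where B: "\<And>t x. \<bar>t\<bar> \<le> T \<Longrightarrow> \<bar>x ^ k * airy_reg (m + 1) a t x\<bar> \<le> B"
      using Suc[of "m + 1"] by blast
    obtain D where D: "\<And>t x. \<bar>t\<bar> \<le> T \<Longrightarrow> \<bar>x ^ k * airy_reg (m - 1) a t x\<bar> \<le> D"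
      using Suc[of "m - 1"] by blast
    have "\<bar>x ^ Suc k * airy_reg m a t x\<bar> \<le> 3 * T * A + 2 * a * B + real m * D" if t: "\<bar>t\<bar> \<le> T" for t x
      unfolding power_Suc mult.assoc[of x "x ^ k"]
      by (rule order_trans[OF step[OF t]])
        (intro add_mono mult_left_mono A[OF t] B[OF t] D[OF t], use T a in simp_all)
    then show ?case by blast
  qed
  obtain C0 where C0: "\<And>t x. \<bar>t\<bar> \<le> T \<Longrightarrow> \<bar>x ^ 0 * airy_reg n a t x\<bar> \<le> C0" using bd by blast
  obtain C2 where C2: "\<And>t x. \<bar>t\<bar> \<le> T \<Longrightarrow> \<bar>x ^ 2 * airy_reg n a t x\<bar> \<le> C2" using bd by blast
  have "\<bar>airy_reg n a t x\<bar> \<le> (\<bar>C0\<bar> + \<bar>C2\<bar> + 1) / (1 + x\<^sup>2)" if "\<bar>t\<bar> \<le> T" for t x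
  proof -
    have "\<bar>airy_reg n a t x\<bar> * (1 + x\<^sup>2) = \<bar>x ^ 0 * airy_reg n a t x\<bar> + \<bar>x ^ 2 * airy_reg n a t x\<bar>"
      by (simp add: abs_mult algebra_simps)
    also have "\<dots> \<le> \<bar>C0\<bar> + \<bar>C2\<bar> + 1" using C0[OF that, of x] C2[OF that, of x] by linarith
    finally show ?thesis by (simp add: pos_le_divide_eq add_pos_nonneg)
  qed
  then show ?thesis by (intro exI[of _ "\<bar>C0\<bar> + \<bar>C2\<bar> + 1"]) auto
qed

text \<open>At t = 0 and n = 0 the recurrence is the first order equation of a Gaussian, whose value
  at 0 is the Gaussian integral.\<close>

lemma airy_reg_time_0:
  assumes "a > 0"
  shows "airy_reg 0 a 0 x = exp (- x\<^sup>2 / (4 * a)) / (2 * sqrt (pi * a))"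
proof -
  have "((\<lambda>x. airy_reg 0 a 0 x * exp (x\<^sup>2 / (4 * a))) has_real_derivative 0) (at x)" for x
  proof -
    have "x * airy_reg 0 a 0 x + 2 * a * airy_reg (Suc 0) a 0 x = 0"
      using airy_reg_recurrence[OF assms, of 0 0 x] by simp
    then have "airy_reg (Suc 0) a 0 x = - (x / (2 * a)) * airy_reg 0 a 0 x"
      using assms by (simp add: field_simps)
    then have "((\<lambda>x. airy_reg 0 a 0 x) has_real_derivative - (x / (2 * a)) * airy_reg 0 a 0 x) (at x)"
      using airy_reg_deriv_x[OF assms, of 0 0 x] by (simp only:)
    then show ?thesis
      using assms by (auto intro!: derivative_eq_intros simp: field_simps)
  qed
  then have "airy_reg 0 a 0 x * exp (x\<^sup>2 / (4 * a)) = airy_reg 0 a 0 0 * exp (0\<^sup>2 / (4 * a))"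
    using DERIV_isconst_all by blast
  moreover have "airy_reg 0 a 0 0 = sqrt (pi / a) / (2 * pi)"
    using integral_gaussian[OF assms] by (simp add: airy_reg_def airy_kernel_def)
  moreover have "sqrt (pi / a) / (2 * pi) = 1 / (2 * sqrt (pi * a))"
    using assms real_sqrt_mult_self[of pi] by (simp add: real_sqrt_divide real_sqrt_mult field_simps)
  ultimately have "airy_reg 0 a 0 x * exp (x\<^sup>2 / (4 * a)) = 1 / (2 * sqrt (pi * a))" by simp
  then have "airy_reg 0 a 0 x * (exp (x\<^sup>2 / (4 * a)) * exp (- x\<^sup>2 / (4 * a))) =
      exp (- x\<^sup>2 / (4 * a)) / (2 * sqrt (pi * a))"
    by (simp add: mult.assoc[symmetric])
  then show ?thesis by (simp add: exp_add[symmetric])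
qed

text \<open>The self-similarity of the equation, by dilating the frequency; it reduces the kernel at
  time s^3 to time 1.\<close>

lemma airy_reg_scale:
  assumes "s > 0"
  shows "airy_reg 0 a (s ^ 3) x = airy_reg 0 (a / s\<^sup>2) 1 (x / s) / s"
proof -
  have "(\<integral>\<xi>. airy_kernel 0 (a / s\<^sup>2) 1 (x / s) \<xi> \<partial>lborel) =
      \<bar>s\<bar> *\<^sub>R (\<integral>\<xi>. airy_kernel 0 (a / s\<^sup>2) 1 (x / s) (0 + s * \<xi>) \<partial>lborel)"
    using assms by (intro lborel_integral_real_affine) simp
  also have "(\<lambda>\<xi>. airy_kernel 0 (a / s\<^sup>2) 1 (x / s) (0 + s * \<xi>)) = airy_kernel 0 a (s ^ 3) x"
    using assms by (auto simp: airy_kernel_def fun_eq_iff field_simps)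
  finally show ?thesis using assms by (simp add: airy_reg_def)
qed

section \<open>The Airy function\<close>

text \<open>This is \<open>1 / (2 * pi)\<close> times the integral of \<open>exp (\<i> * (\<xi>\<^sup>3 + x * \<xi>))\<close>, with the contour moved to \<open>Im \<xi> = 1\<close>
  to make it absolutely convergent.\<close>

definition airy :: "real \<Rightarrow> real" where
  "airy x = exp (1 - x) * airy_reg 0 3 1 (x - 3)"

definition airy' :: "real \<Rightarrow> real" where
  "airy' x = exp (1 - x) * (airy_reg 1 3 1 (x - 3) - airy_reg 0 3 1 (x - 3))"

lemma airy_deriv: "(airy has_real_derivative airy' x) (at x)"
  unfolding airy_def airy'_def
  by (auto intro!: derivative_eq_intros DERIV_chain2[OF airy_reg_deriv_x] simp: algebra_simps)

text \<open>The recurrence at n = 0, t = 1, a = 3 becomes the Airy equation once the exponential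
  factor and the shift by 3 from the contour are taken into account.\<close>

lemma airy'_deriv: "(airy' has_real_derivative x * airy x / 3) (at x)"
proof -
  have "(x - 3) * airy_reg 0 3 1 (x - 3) - 3 * airy_reg (Suc 1) 3 1 (x - 3) + 6 * airy_reg 1 3 1 (x - 3) = 0"
    using airy_reg_recurrence[of 3 0 1 "x - 3"] by (simp add: numeral_2_eq_2)
  then have eq: "airy_reg (Suc 1) 3 1 (x - 3) =
      ((x - 3) * airy_reg 0 3 1 (x - 3) + 6 * airy_reg 1 3 1 (x - 3)) / 3"
    by simp
  have "(airy' has_real_derivative exp (1 - x) * (airy_reg (Suc 1) 3 1 (x - 3) - airy_reg 1 3 1 (x - 3))
      - exp (1 - x) * (airy_reg 1 3 1 (x - 3) - airy_reg 0 3 1 (x - 3))) (at x)"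
    unfolding airy'_def
    by (auto intro!: derivative_eq_intros DERIV_chain2[OF airy_reg_deriv_x] simp: algebra_simps)
  then show ?thesis
    unfolding eq airy_def by (simp add: field_simps)
qed

lemma airy_continuous: "continuous_on A airy" "continuous_on A airy'"
  by (intro continuous_at_imp_continuous_on ballI DERIV_isCont[OF airy_deriv] DERIV_isCont[OF airy'_deriv])+

lemma airy_measurable[measurable]: "airy \<in> borel_measurable borel" "airy' \<in> borel_measurable borel"
  by (intro borel_measurable_continuous_onI airy_continuous)+

text \<open>The rate 1 is the height of the contour. It is far from the true decay, but beats every
  power that occurs later.\<close>

lemma airy_exp_decay: "\<exists>K>0. \<forall>x. \<bar>airy x\<bar> \<le> K * exp (- x) \<and> \<bar>airy' x\<bar> \<le> K * exp (- x)"
proof (intro exI conjI allI)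
  let ?K = "exp 1 * (gauss_moment 0 3 + gauss_moment 1 3 + 1)"
  show "?K > 0" using gauss_moment_nonneg[of 0 3] gauss_moment_nonneg[of 1 3] by simp
  fix x :: real
  have e: "exp (1 - x) = exp 1 * exp (- x)" by (simp add: exp_add[symmetric])
  have "\<bar>airy_reg 0 3 1 (x - 3)\<bar> \<le> gauss_moment 0 3 + gauss_moment 1 3 + 1"
    using airy_reg_bound[of 3 0 1 "x - 3"] gauss_moment_nonneg[of 1 3] by simp
  from mult_left_mono[OF this, of "exp (1 - x)"] show "\<bar>airy x\<bar> \<le> ?K * exp (- x)"
    by (simp add: airy_def abs_mult e mult_ac)
  have "\<bar>airy_reg 1 3 1 (x - 3) - airy_reg 0 3 1 (x - 3)\<bar> \<le> gauss_moment 0 3 + gauss_moment 1 3 + 1"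
    using airy_reg_bound[of 3 0 1 "x - 3"] airy_reg_bound[of 3 1 1 "x - 3"] by simp
  from mult_left_mono[OF this, of "exp (1 - x)"] show "\<bar>airy' x\<bar> \<le> ?K * exp (- x)"
    by (simp add: airy'_def abs_mult e mult_ac)
qed

text \<open>The right-hand side belongs to the contour \<open>Im \<xi> = 1\<close>, the left-hand side to \<open>Im \<xi> = \<alpha>\<close>: moving the
  contour changes the integrand by a total \<open>\<xi>\<close>-derivative.\<close>

lemma airy_contour_shift:
  assumes "\<alpha> > 0"
  shows "airy_reg 0 (3 * \<alpha>) 1 x = exp (\<alpha> * x + 2 * \<alpha> ^ 3) * airy (x + 3 * \<alpha>\<^sup>2)"
proof -
  \<comment> \<open>The argument of the Airy function; it stays fixed while the height \<beta> of
    the contour varies.\<close>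
  define y where "y = x + 3 * \<alpha>\<^sup>2"
  define E where "E \<beta> \<xi> = exp (\<beta> ^ 3 - \<beta> * y) * exp (- (3 * \<beta>) * \<xi>\<^sup>2)" for \<beta> \<xi> :: real
  define th where "th \<beta> \<xi> = \<xi> ^ 3 + (y - 3 * \<beta>\<^sup>2) * \<xi>" for \<beta> \<xi> :: real
  define f where "f \<beta> \<xi> = E \<beta> \<xi> * cos (th \<beta> \<xi>)" for \<beta> \<xi>
  define f' where "f' \<beta> \<xi> = E \<beta> \<xi> * ((3 * \<beta>\<^sup>2 - y - 3 * \<xi>\<^sup>2) * cos (th \<beta> \<xi>) + 6 * \<beta> * \<xi> * sin (th \<beta> \<xi>))" for \<beta> \<xi>
  have f_reg: "(\<integral>\<xi>. f \<beta> \<xi> \<partial>lborel) = exp (\<beta> ^ 3 - \<beta> * y) * (2 * pi * airy_reg 0 (3 * \<beta>) 1 (y - 3 * \<beta>\<^sup>2))" for \<beta>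
    unfolding f_def E_def th_def airy_reg_def airy_kernel_def by (simp add: mult_ac add.commute)
  have f_int: "integrable lborel (f \<beta>)" if "\<beta> > 0" for \<beta>
  proof -
    have "f \<beta> = (\<lambda>\<xi>. exp (\<beta> ^ 3 - \<beta> * y) * airy_kernel 0 (3 * \<beta>) 1 (y - 3 * \<beta>\<^sup>2) \<xi>)"
      unfolding f_def E_def th_def airy_kernel_def by (simp add: mult_ac add.commute fun_eq_iff)
    then show ?thesis using airy_kernel_integrable[of "3 * \<beta>"] that by simp
  qed
  have der: "((\<lambda>\<beta>. f \<beta> \<xi>) has_real_derivative f' \<beta> \<xi>) (at \<beta>)" for \<beta> \<xi>
    unfolding f_def f'_def E_def th_def
    by (rule derivative_eq_intros refl | simp)+ (simp add: algebra_simps power2_eq_square)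
  \<comment> \<open>The real form of the Cauchy-Riemann equations: the same \<open>f'\<close> is the
    derivative of \<open>f\<close> in the height and of a decaying function along the contour, so
    its integral vanishes.\<close>
  have der2: "((\<lambda>\<xi>. - E \<beta> \<xi> * sin (th \<beta> \<xi>)) has_real_derivative f' \<beta> \<xi>) (at \<xi>)" for \<beta> \<xi>
    unfolding f'_def E_def th_def
    by (rule derivative_eq_intros refl | simp)+ (simp add: algebra_simps power2_eq_square)
  have f'_bound: "\<bar>f' \<beta> \<xi>\<bar> \<le> exp (b ^ 3 + b * \<bar>y\<bar>) * (3 * b\<^sup>2 + \<bar>y\<bar> + 3 + 6 * b)
      * (\<bar>\<xi>\<bar> ^ 0 * exp (- (3 * c) * \<xi>\<^sup>2) + \<bar>\<xi>\<bar> ^ 1 * exp (- (3 * c) * \<xi>\<^sup>2) + \<bar>\<xi>\<bar> ^ 2 * exp (- (3 * c) * \<xi>\<^sup>2))"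
    if "0 < c" "c \<le> \<beta>" "\<beta> \<le> b" for b c \<beta> \<xi>
  proof -
    have "\<beta> ^ 3 - \<beta> * y \<le> b ^ 3 + b * \<bar>y\<bar>"
    proof -
      have "\<beta> ^ 3 \<le> b ^ 3" using that by (intro power_mono) auto
      moreover have "- (\<beta> * y) \<le> \<beta> * \<bar>y\<bar>" using that by (simp add: abs_if)
      moreover have "\<beta> * \<bar>y\<bar> \<le> b * \<bar>y\<bar>" using that by (intro mult_right_mono) auto
      ultimately show ?thesis by linarith
    qed
    moreover have "- (3 * \<beta>) * \<xi>\<^sup>2 \<le> - (3 * c) * \<xi>\<^sup>2" using that by (intro mult_right_mono) auto
    ultimately have E: "E \<beta> \<xi> \<le> exp (b ^ 3 + b * \<bar>y\<bar>) * exp (- (3 * c) * \<xi>\<^sup>2)"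
      unfolding E_def by (intro mult_mono) auto
    have b2: "\<beta>\<^sup>2 \<le> b\<^sup>2" using that by (intro power_mono) auto
    have s: "\<bar>u * cos p + v * sin p\<bar> \<le> \<bar>u\<bar> + \<bar>v\<bar>" for u v p :: real
      using abs_cos_le_one[of p] abs_sin_le_one[of p]
      by (intro order_trans[OF abs_triangle_ineq] add_mono) (simp_all add: abs_mult mult_left_le)
    have "\<bar>(3 * \<beta>\<^sup>2 - y - 3 * \<xi>\<^sup>2) * cos (th \<beta> \<xi>) + 6 * \<beta> * \<xi> * sin (th \<beta> \<xi>)\<bar>
        \<le> \<bar>3 * \<beta>\<^sup>2 - y - 3 * \<xi>\<^sup>2\<bar> + \<bar>6 * \<beta> * \<xi>\<bar>" by (rule s)
    also have "\<dots> \<le> (3 * b\<^sup>2 + \<bar>y\<bar>) + 3 * \<xi>\<^sup>2 + 6 * b * \<bar>\<xi>\<bar>"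
    proof -
      have "\<bar>6 * \<beta> * \<xi>\<bar> \<le> 6 * b * \<bar>\<xi>\<bar>" using that by (simp add: abs_mult mult_right_mono)
      moreover have "0 \<le> \<beta>\<^sup>2" "0 \<le> \<xi>\<^sup>2" by simp_all
      ultimately show ?thesis using b2 by linarith
    qed
    also have "\<dots> \<le> (3 * b\<^sup>2 + \<bar>y\<bar> + 3 + 6 * b) * (1 + \<bar>\<xi>\<bar> + \<xi>\<^sup>2)"
    proof -
      have "0 \<le> 3 * b\<^sup>2 + \<bar>y\<bar>" "0 \<le> b" "0 \<le> \<bar>\<xi>\<bar>" "0 \<le> \<xi>\<^sup>2" using that by simp_all
      then have "0 \<le> (3 * b\<^sup>2 + \<bar>y\<bar>) * (\<bar>\<xi>\<bar> + \<xi>\<^sup>2)" "0 \<le> 3 * (1 + \<bar>\<xi>\<bar>)" "0 \<le> 6 * b * (1 + \<xi>\<^sup>2)"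
        by (auto intro!: mult_nonneg_nonneg)
      moreover have "(3 * b\<^sup>2 + \<bar>y\<bar> + 3 + 6 * b) * (1 + \<bar>\<xi>\<bar> + \<xi>\<^sup>2) = (3 * b\<^sup>2 + \<bar>y\<bar>) + 3 * \<xi>\<^sup>2 + 6 * b * \<bar>\<xi>\<bar>
          + (3 * b\<^sup>2 + \<bar>y\<bar>) * (\<bar>\<xi>\<bar> + \<xi>\<^sup>2) + 3 * (1 + \<bar>\<xi>\<bar>) + 6 * b * (1 + \<xi>\<^sup>2)"
        by (simp add: algebra_simps)
      ultimately show ?thesis by linarith
    qed
    finally have "\<bar>f' \<beta> \<xi>\<bar> \<le> (exp (b ^ 3 + b * \<bar>y\<bar>) * exp (- (3 * c) * \<xi>\<^sup>2)) *
        ((3 * b\<^sup>2 + \<bar>y\<bar> + 3 + 6 * b) * (1 + \<bar>\<xi>\<bar> + \<xi>\<^sup>2))"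
      using E unfolding f'_def abs_mult by (intro mult_mono) (auto simp: E_def)
    then show ?thesis by (simp add: algebra_simps)
  qed
  have w_int: "integrable lborel (\<lambda>\<xi>. exp (b ^ 3 + b * \<bar>y\<bar>) * (3 * b\<^sup>2 + \<bar>y\<bar> + 3 + 6 * b)
      * (\<bar>\<xi>\<bar> ^ 0 * exp (- (3 * c) * \<xi>\<^sup>2) + \<bar>\<xi>\<bar> ^ 1 * exp (- (3 * c) * \<xi>\<^sup>2) + \<bar>\<xi>\<bar> ^ 2 * exp (- (3 * c) * \<xi>\<^sup>2)))"
    if "0 < c" for b c
    using that by (intro integrable_mult_right Bochner_Integration.integrable_add integrable_gaussian_moment) simp_all
  have cont: "isCont (f' \<beta>) \<xi>" for \<beta> \<xi>
    unfolding f'_def E_def th_def by (intro continuous_intros)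
  have f'_meas: "f' \<beta> \<in> borel_measurable lborel" for \<beta>
    using borel_measurable_continuous_onI[of "f' \<beta>"] cont by (simp add: continuous_at_imp_continuous_on)
  have zero: "(\<integral>\<xi>. f' \<beta> \<xi> \<partial>lborel) = 0" if "\<beta> > 0" for \<beta>
  proof (rule integral_deriv_eq_0[OF der2 cont])
    show "integrable lborel (f' \<beta>)"
      by (rule Bochner_Integration.integrable_bound[OF w_int[OF that] f'_meas])
        (use f'_bound[OF that order_refl order_refl] in \<open>auto intro!: AE_I2 order_trans[OF _ abs_ge_self]\<close>)
    have *: "((\<lambda>\<xi>. - E \<beta> \<xi> * sin (th \<beta> \<xi>)) \<longlongrightarrow> 0) F"
      if "((\<lambda>\<xi>. \<bar>\<xi>\<bar> ^ 0 * exp (- (3 * \<beta>) * \<xi>\<^sup>2)) \<longlongrightarrow> 0) F" for F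
    proof (rule Lim_null_comparison[OF always_eventually])
      show "((\<lambda>\<xi>. exp (\<beta> ^ 3 - \<beta> * y) * (\<bar>\<xi>\<bar> ^ 0 * exp (- (3 * \<beta>) * \<xi>\<^sup>2))) \<longlongrightarrow> 0) F"
        by (rule tendsto_mult_right_zero[OF that])
      show "\<forall>\<xi>. norm (- E \<beta> \<xi> * sin (th \<beta> \<xi>)) \<le> exp (\<beta> ^ 3 - \<beta> * y) * (\<bar>\<xi>\<bar> ^ 0 * exp (- (3 * \<beta>) * \<xi>\<^sup>2))"
        by (simp add: E_def abs_mult mult_left_le)
    qed
    show "((\<lambda>\<xi>. - E \<beta> \<xi> * sin (th \<beta> \<xi>)) \<longlongrightarrow> 0) at_bot" "((\<lambda>\<xi>. - E \<beta> \<xi> * sin (th \<beta> \<xi>)) \<longlongrightarrow> 0) at_top"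
      using that by (intro * gaussian_moment_tendsto; simp)+
  qed
  have "((\<lambda>\<beta>. \<integral>\<xi>. f \<beta> \<xi> \<partial>lborel) has_real_derivative 0) (at \<beta>)" if "\<beta> > 0" for \<beta>
    unfolding zero[OF that, symmetric]
  proof (rule has_real_derivative_integral[OF _ der])
    show "\<beta> / 2 > 0" using that by simp
    show "\<bar>f' t \<xi>\<bar> \<le> exp ((2 * \<beta>) ^ 3 + (2 * \<beta>) * \<bar>y\<bar>) * (3 * (2 * \<beta>)\<^sup>2 + \<bar>y\<bar> + 3 + 6 * (2 * \<beta>))
      * (\<bar>\<xi>\<bar> ^ 0 * exp (- (3 * (\<beta> / 2)) * \<xi>\<^sup>2) + \<bar>\<xi>\<bar> ^ 1 * exp (- (3 * (\<beta> / 2)) * \<xi>\<^sup>2) + \<bar>\<xi>\<bar> ^ 2 * exp (- (3 * (\<beta> / 2)) * \<xi>\<^sup>2))"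
      if "\<bar>t - \<beta>\<bar> < \<beta> / 2" for t \<xi>
    proof (rule f'_bound)
      show "0 < \<beta> / 2" "\<beta> / 2 \<le> t" "t \<le> 2 * \<beta>" using that \<open>\<beta> > 0\<close> by linarith+
    qed
    show "integrable lborel (f t)" if "\<bar>t - \<beta>\<bar> < \<beta> / 2" for t
      using that \<open>\<beta> > 0\<close> by (intro f_int) linarith
    show "integrable lborel (\<lambda>\<xi>. exp ((2 * \<beta>) ^ 3 + (2 * \<beta>) * \<bar>y\<bar>) * (3 * (2 * \<beta>)\<^sup>2 + \<bar>y\<bar> + 3 + 6 * (2 * \<beta>))
      * (\<bar>\<xi>\<bar> ^ 0 * exp (- (3 * (\<beta> / 2)) * \<xi>\<^sup>2) + \<bar>\<xi>\<bar> ^ 1 * exp (- (3 * (\<beta> / 2)) * \<xi>\<^sup>2) + \<bar>\<xi>\<bar> ^ 2 * exp (- (3 * (\<beta> / 2)) * \<xi>\<^sup>2)))"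
      using that by (intro w_int) simp
  qed (rule f'_meas)
  then have der0: "((\<lambda>\<beta>. \<integral>\<xi>. f \<beta> \<xi> \<partial>lborel) has_real_derivative 0) (at \<beta> within {0<..})" if "\<beta> \<in> {0<..}" for \<beta>
    using that has_field_derivative_at_within by blast
  have "convex {0::real<..}" by simp
  from has_field_derivative_zero_constant[OF this der0]
  obtain c where "\<And>\<beta>. \<beta> \<in> {0<..} \<Longrightarrow> (\<integral>\<xi>. f \<beta> \<xi> \<partial>lborel) = c" by blast
  then have c: "\<And>\<beta>. \<beta> > 0 \<Longrightarrow> (\<integral>\<xi>. f \<beta> \<xi> \<partial>lborel) = c" by (simp only: greaterThan_iff)
  have "(\<integral>\<xi>. f \<alpha> \<xi> \<partial>lborel) = (\<integral>\<xi>. f 1 \<xi> \<partial>lborel)"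
    by (simp only: c[OF assms] c[OF zero_less_one])
  then have "exp (\<alpha> ^ 3 - \<alpha> * y) * airy_reg 0 (3 * \<alpha>) 1 (y - 3 * \<alpha>\<^sup>2) = airy y"
    unfolding f_reg by (simp add: airy_def)
  then have e1: "exp (\<alpha> ^ 3 - \<alpha> * y) * airy_reg 0 (3 * \<alpha>) 1 x = airy y"
    by (simp add: y_def)
  have e2: "exp (\<alpha> * x + 2 * \<alpha> ^ 3) * exp (\<alpha> ^ 3 - \<alpha> * y) = 1"
    by (simp add: exp_add[symmetric] y_def power2_eq_square power3_eq_cube algebra_simps)
  have "exp (\<alpha> * x + 2 * \<alpha> ^ 3) * airy y =
      exp (\<alpha> * x + 2 * \<alpha> ^ 3) * (exp (\<alpha> ^ 3 - \<alpha> * y) * airy_reg 0 (3 * \<alpha>) 1 x)"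
    by (simp only: e1)
  also have "\<dots> = airy_reg 0 (3 * \<alpha>) 1 x"
    by (simp only: mult.assoc[symmetric] e2 mult_1_left)
  finally show ?thesis by (simp only: y_def)
qed

text \<open>The last term of the energy \<open>N\<close> below cancels the non-integrable part of the logarithmic derivative of
  the first two terms divided by \<open>sqrt s\<close>.\<close>

lemma airy_oscillatory_bound:
  "\<exists>K>0. \<forall>s\<ge>1. (airy (- s))\<^sup>2 \<le> K / sqrt s \<and> (airy' (- s))\<^sup>2 \<le> K * sqrt s"
proof -
  define b where "b s = airy (- s)" for s
  define b' where "b' s = - airy' (- s)" for s
  have db: "(b has_real_derivative b' s) (at s)" for s
  proof -
    have "((\<lambda>s. airy (- s)) has_real_derivative airy' (- s) * - 1) (at s)"
      by (rule DERIV_chain2[where g = uminus, OF airy_deriv]) (auto intro!: derivative_eq_intros)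
    then show ?thesis unfolding b_def b'_def by simp
  qed
  have db': "(b' has_real_derivative - s * b s / 3) (at s)" for s
  proof -
    have "((\<lambda>s. airy' (- s)) has_real_derivative (- s * airy (- s) / 3) * - 1) (at s)"
      by (rule DERIV_chain2[where g = uminus, OF airy'_deriv]) (auto intro!: derivative_eq_intros)
    from DERIV_minus[OF this] show ?thesis unfolding b_def b'_def by simp
  qed
  define N where "N s = s * (b s)\<^sup>2 + 3 * (b' s)\<^sup>2 + 3 / 2 * (b s * b' s) / s" for s
  have cross: "3 * \<bar>b s * b' s\<bar> \<le> s * (b s)\<^sup>2 + 3 * (b' s)\<^sup>2" if "s \<ge> 1" for s
  proof -
    have "0 \<le> 3 * (\<bar>b s\<bar> / 2 - \<bar>b' s\<bar>)\<^sup>2" by simp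
    then have "3 * \<bar>b s\<bar> * \<bar>b' s\<bar> \<le> 1 * (b s)\<^sup>2 + 3 * (b' s)\<^sup>2"
    proof -
      have "3 * (\<bar>b s\<bar> / 2 - \<bar>b' s\<bar>)\<^sup>2 = 3 / 4 * (b s)\<^sup>2 + 3 * (b' s)\<^sup>2 - 3 * \<bar>b s\<bar> * \<bar>b' s\<bar>"
        by (simp add: power2_diff power_divide algebra_simps)
      then show ?thesis
        using \<open>0 \<le> 3 * (\<bar>b s\<bar> / 2 - \<bar>b' s\<bar>)\<^sup>2\<close> zero_le_power2[of "b s"] by linarith
    qed
    moreover have "1 * (b s)\<^sup>2 \<le> s * (b s)\<^sup>2" using that by (intro mult_right_mono) auto
    ultimately show ?thesis by (simp add: abs_mult)
  qed
  have cross2: "\<bar>3 / 2 * (b s * b' s) / s\<bar> \<le> 3 / 2 * \<bar>b s * b' s\<bar>" if "s \<ge> 1" for s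
  proof -
    have "\<bar>3 / 2 * (b s * b' s) / s\<bar> = 3 / 2 * \<bar>b s * b' s\<bar> / s" using that by (simp add: abs_mult)
    also have "\<dots> \<le> 3 / 2 * \<bar>b s * b' s\<bar> / 1" using that by (intro divide_left_mono) auto
    finally show ?thesis by simp
  qed
  \<comment> \<open>The correction is at most half of the main energy s b^2 + 3 b'^2, so bounds for
    \<open>N\<close> are bounds for \<open>b\<close> and \<open>b'\<close>.\<close>
  have N_bounds: "s * (b s)\<^sup>2 + 3 * (b' s)\<^sup>2 \<le> 2 * N s \<and> 3 / 2 * \<bar>b s * b' s\<bar> \<le> N s"
    if "s \<ge> 1" for s
  proof -
    define X where "X = 3 / 2 * (b s * b' s) / s"
    define S where "S = s * (b s)\<^sup>2 + 3 * (b' s)\<^sup>2"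
    have "N s = S + X" by (simp only: N_def S_def X_def)
    moreover have "3 * \<bar>b s * b' s\<bar> \<le> S" "\<bar>X\<bar> \<le> 3 / 2 * \<bar>b s * b' s\<bar>"
      using cross[OF that] cross2[OF that] by (simp_all only: S_def X_def)
    ultimately show ?thesis unfolding S_def[symmetric] by linarith
  qed
  note N_lower = conjunct1[OF N_bounds] and N_cross = conjunct2[OF N_bounds]
  \<comment> \<open>The derivative of the main energy is b^2 alone; the correction replaces it by
    the average N / (2 s), up to an error with the integrable weight 1 / s^2.\<close>
  define N' where "N' s = N s / (2 * s) - 9 / 4 * (b s * b' s) / s\<^sup>2" for s
  have dN: "(N has_real_derivative N' s) (at s)" if "s \<ge> 1" for s
  proof -
    have "((\<lambda>s. s * (b s)\<^sup>2 + 3 * (b' s)\<^sup>2 + 3 / 2 * (b s * b' s) / s) has_real_derivative N' s) (at s)"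
      using that unfolding N'_def N_def
      by (auto intro!: derivative_eq_intros db db' simp: field_simps power2_eq_square)
    then show ?thesis unfolding N_def[abs_def] .
  qed
  \<comment> \<open>An integrating factor: division by sqrt s removes the growth N / (2 s), and exp
    (3 / (2 s)) absorbs the error of size at most 3 N / (2 s^2). It lies between 1 and exp (3 / 2)
    on s >= 1, so monotonicity of \<open>M\<close> bounds N / sqrt s.\<close>
  define M where "M s = N s * (exp (3 / (2 * s)) / sqrt s)" for s
  define M' where "M' s = N' s * (exp (3 / (2 * s)) / sqrt s)
      - N s * (exp (3 / (2 * s)) / sqrt s) * (1 / (2 * s) + 3 / (2 * s\<^sup>2))" for s
  have dM: "(M has_real_derivative M' s) (at s)" if "s \<ge> 1" for s
  proof -
    have "((\<lambda>s. exp (3 / (2 * s)) / sqrt s) has_real_derivative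
        - (exp (3 / (2 * s)) / sqrt s) * (1 / (2 * s) + 3 / (2 * s\<^sup>2))) (at s)"
      using that by (auto intro!: derivative_eq_intros simp: field_simps power2_eq_square)
    from DERIV_mult[OF dN[OF that] this] show ?thesis
      unfolding M_def[abs_def] M'_def by (simp add: algebra_simps)
  qed
  have M'_neg: "M' s \<le> 0" if s: "s \<ge> 1" for s
  proof -
    have "\<bar>9 / 4 * (b s * b' s) / s\<^sup>2\<bar> = (3 / 2 * \<bar>b s * b' s\<bar>) * (3 / (2 * s\<^sup>2))"
      by (simp add: abs_mult)
    also have "\<dots> \<le> N s * (3 / (2 * s\<^sup>2))" by (intro mult_right_mono N_cross s) simp
    finally have "N' s \<le> N s * (1 / (2 * s) + 3 / (2 * s\<^sup>2))"
      using abs_le_D2[of "9 / 4 * (b s * b' s) / s\<^sup>2"] unfolding N'_def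
      by (simp only: distrib_left times_divide_eq_right mult_1_right)
    from mult_right_mono[OF this, of "exp (3 / (2 * s)) / sqrt s"] show ?thesis
      using s unfolding M'_def by (simp add: mult_ac)
  qed
  have M_le: "M s \<le> M 1" if "s \<ge> 1" for s
    using that by (intro DERIV_nonpos_imp_nonincreasing[of 1 s M]) (use dM M'_neg in blast)+
  have N_le: "N s \<le> M 1 * sqrt s" if s: "s \<ge> 1" for s
  proof -
    have "0 \<le> N s" using N_cross[OF s] abs_ge_zero[of "b s * b' s"] by linarith
    then have "N s * 1 \<le> N s * exp (3 / (2 * s))" using s by (intro mult_left_mono) auto
    also have "\<dots> = M s * sqrt s" using s by (simp add: M_def)
    also have "\<dots> \<le> M 1 * sqrt s" using s by (intro mult_right_mono M_le) auto
    finally show ?thesis by simp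
  qed
  have "(airy (- s))\<^sup>2 \<le> (2 * \<bar>M 1\<bar> + 1) / sqrt s" "(airy' (- s))\<^sup>2 \<le> (2 * \<bar>M 1\<bar> + 1) * sqrt s"
    if s: "s \<ge> 1" for s
  proof -
    have B: "s * (b s)\<^sup>2 + 3 * (b' s)\<^sup>2 \<le> 2 * \<bar>M 1\<bar> * sqrt s"
    proof -
      have "M 1 * sqrt s \<le> \<bar>M 1\<bar> * sqrt s" using s by (intro mult_right_mono) auto
      then show ?thesis using N_lower[OF s] N_le[OF s] by linarith
    qed
    have C: "0 \<le> s * (b s)\<^sup>2" "0 \<le> (b' s)\<^sup>2" "0 \<le> sqrt s" "0 < sqrt s" using s by simp_all
    have "sqrt s * (sqrt s * (b s)\<^sup>2) \<le> sqrt s * (2 * \<bar>M 1\<bar> + 1)"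
    proof -
      have "sqrt s * (sqrt s * (b s)\<^sup>2) = s * (b s)\<^sup>2" using s by (simp add: mult.assoc[symmetric])
      then show ?thesis using B C unfolding distrib_left mult.commute[of "sqrt s" "2 * _"] by linarith
    qed
    then have "sqrt s * (b s)\<^sup>2 \<le> 2 * \<bar>M 1\<bar> + 1" using C by simp
    then show "(airy (- s))\<^sup>2 \<le> (2 * \<bar>M 1\<bar> + 1) / sqrt s"
      using C by (simp add: b_def pos_le_divide_eq mult.commute)
    have "(b' s)\<^sup>2 \<le> 2 * \<bar>M 1\<bar> * sqrt s + sqrt s" using B C by linarith
    then show "(airy' (- s))\<^sup>2 \<le> (2 * \<bar>M 1\<bar> + 1) * sqrt s"
      by (simp add: b'_def algebra_simps)
  qed
  then show ?thesis by (intro exI[of _ "2 * \<bar>M 1\<bar> + 1"]) auto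
qed

text \<open>The natural amplitude of the Airy function, kept at least 1 so that one can divide by it
  also near the turning point.\<close>

definition root4 :: "real \<Rightarrow> real" where
  "root4 z = sqrt (sqrt (1 + \<bar>z\<bar>))"

lemma root4_ge_1: "root4 z \<ge> 1"
  by (simp add: root4_def)

lemma root4_squared: "(root4 z)\<^sup>2 = sqrt (1 + \<bar>z\<bar>)"
  by (simp add: root4_def)

text \<open>For z >= -1 the exponential bound dominates every weight involved; for z < -1 the energy
  estimate applies. One constant is chosen for all four inequalities.\<close>

lemma airy_bounds:
  obtains K where "K > 0"
    "\<And>z. \<bar>airy z\<bar> \<le> K / root4 z" "\<And>z. \<bar>airy' z\<bar> \<le> K * root4 z"
    "\<And>z. z \<ge> 0 \<Longrightarrow> \<bar>airy z\<bar> \<le> K / (1 + z\<^sup>2)" "\<And>z. z \<ge> 0 \<Longrightarrow> \<bar>airy' z\<bar> \<le> K / (1 + z\<^sup>2)"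
proof -
  obtain K1 where K1: "K1 > 0" "\<And>x. \<bar>airy x\<bar> \<le> K1 * exp (- x)" "\<And>x. \<bar>airy' x\<bar> \<le> K1 * exp (- x)"
    using airy_exp_decay by blast
  obtain K2 where K2: "K2 > 0" "\<And>s. s \<ge> 1 \<Longrightarrow> (airy (- s))\<^sup>2 \<le> K2 / sqrt s"
      "\<And>s. s \<ge> 1 \<Longrightarrow> (airy' (- s))\<^sup>2 \<le> K2 * sqrt s"
    using airy_oscillatory_bound by blast
  define K where "K = 2 * exp 1 * K1 + 2 * sqrt K2"
  have "0 < 2 * exp 1 * K1" "0 < 2 * sqrt K2" using K1(1) K2(1) by simp_all
  then have K: "K > 0" "2 * exp 1 * K1 \<le> K" "2 * sqrt K2 \<le> K" unfolding K_def by linarith+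
  have exp_ge: "1 + z\<^sup>2 \<le> 2 * exp z" if "z \<ge> 0" for z :: real
    using exp_lower_Taylor_quadratic[OF that] that by simp
  have dec: "K1 * exp (- z) \<le> K / (1 + z\<^sup>2)" if "z \<ge> 0" for z
  proof -
    have "K1 * exp (- z) * (1 + z\<^sup>2) \<le> K1 * exp (- z) * (2 * exp z)"
      using K1(1) exp_ge[OF that] by (intro mult_left_mono) auto
    also have "\<dots> = 2 * 1 * K1" by (simp add: exp_minus)
    also have "\<dots> \<le> 2 * exp 1 * K1" using K1(1) by (intro mult_right_mono mult_left_mono) auto
    also have "\<dots> \<le> K" by (rule K)
    finally show ?thesis by (simp add: pos_le_divide_eq add_pos_nonneg)
  qed
  have r: "root4 z \<le> 2 * exp 1 * exp z" if "z \<ge> -1" for z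
  proof -
    have 1: "1 + \<bar>z\<bar> \<le> 2 * exp (z + 1)"
    proof (cases "z \<ge> 0")
      case True
      then show ?thesis using exp_ge_add_one_self[of "z + 1"] by simp
    next
      case False
      then have "1 + \<bar>z\<bar> \<le> 2" using that by simp
      moreover have "1 \<le> exp (z + 1)" using that by simp
      ultimately show ?thesis by linarith
    qed
    have "root4 z \<le> 1 + \<bar>z\<bar>"
    proof -
      have "sqrt p \<le> p" if "p \<ge> 1" for p
        using that mult_mono[of 1 p p p] by (intro real_le_lsqrt) (auto simp: power2_eq_square)
      from this[of "1 + \<bar>z\<bar>"] this[of "sqrt (1 + \<bar>z\<bar>)"] show ?thesis
        unfolding root4_def by (intro order_trans[of "sqrt (sqrt (1 + \<bar>z\<bar>))" "sqrt (1 + \<bar>z\<bar>)" "1 + \<bar>z\<bar>"]) simp_all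
    qed
    then show ?thesis using 1 by (simp add: exp_add mult_ac)
  qed
  have A1: "\<bar>airy z\<bar> \<le> K / root4 z" for z
  proof (cases "z \<ge> -1")
    case True
    have "\<bar>airy z\<bar> * root4 z \<le> (K1 * exp (- z)) * (2 * exp 1 * exp z)"
      using K1(2)[of z] r[OF True] root4_ge_1[of z] K1(1) by (intro mult_mono) auto
    also have "\<dots> = 2 * exp 1 * K1" by (simp add: exp_minus)
    also have "\<dots> \<le> K" by (rule K)
    finally show ?thesis using root4_ge_1[of z] by (simp add: pos_le_divide_eq)
  next
    case False
    define s where "s = - z"
    have s: "s \<ge> 1" "z = - s" using False by (auto simp: s_def)
    have "(\<bar>airy z\<bar> * root4 z)\<^sup>2 = (airy (- s))\<^sup>2 * sqrt (1 + s)"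
      using s by (simp add: power_mult_distrib root4_squared)
    also have "\<dots> \<le> (K2 / sqrt s) * (2 * sqrt s)"
    proof (intro mult_mono K2 s)
      have "sqrt (1 + s) \<le> sqrt (4 * s)" using s by simp
      then show "sqrt (1 + s) \<le> 2 * sqrt s" by (simp add: real_sqrt_mult)
    qed (use s K2 in auto)
    also have "\<dots> \<le> (2 * sqrt K2)\<^sup>2" using s K2(1) by (simp add: power_mult_distrib)
    finally have "\<bar>airy z\<bar> * root4 z \<le> 2 * sqrt K2"
      by (rule power2_le_imp_le) (use K2(1) in simp)
    then show ?thesis using K(3) root4_ge_1[of z] by (simp add: pos_le_divide_eq)
  qed
  have A2: "\<bar>airy' z\<bar> \<le> K * root4 z" for z
  proof (cases "z \<ge> -1")
    case True
    have "\<bar>airy' z\<bar> \<le> K1 * exp (- z)" by (rule K1)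
    also have "\<dots> \<le> K1 * exp 1" using True K1(1) by (intro mult_left_mono) auto
    also have "\<dots> \<le> K" using K(2) \<open>0 < 2 * exp 1 * K1\<close> by (simp add: mult_ac)
    also have "\<dots> \<le> K * root4 z" using K(1) root4_ge_1[of z] by simp
    finally show ?thesis .
  next
    case False
    define s where "s = - z"
    have s: "s \<ge> 1" "z = - s" using False by (auto simp: s_def)
    have "\<bar>airy' z\<bar>\<^sup>2 \<le> K2 * sqrt s" using K2(3)[OF s(1)] s by simp
    also have "\<dots> \<le> (2 * sqrt K2)\<^sup>2 * (root4 z)\<^sup>2"
    proof -
      have "sqrt s \<le> (root4 z)\<^sup>2" unfolding root4_squared using s by simp
      then show ?thesis using K2(1) s by (intro mult_mono) (auto simp: power_mult_distrib)
    qed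
    also have "\<dots> = (2 * sqrt K2 * root4 z)\<^sup>2" by (simp add: power_mult_distrib)
    finally have "\<bar>airy' z\<bar> \<le> 2 * sqrt K2 * root4 z"
      by (rule power2_le_imp_le) (use K2(1) root4_ge_1[of z] in simp)
    also have "\<dots> \<le> K * root4 z" using K(3) root4_ge_1[of z] by (intro mult_right_mono) auto
    finally show ?thesis .
  qed
  show ?thesis
  proof (rule that[OF K(1) A1 A2])
    fix z :: real
    assume z: "z \<ge> 0"
    show "\<bar>airy z\<bar> \<le> K / (1 + z\<^sup>2)" "\<bar>airy' z\<bar> \<le> K / (1 + z\<^sup>2)"
      by (rule order_trans[OF K1(2) dec[OF z]], rule order_trans[OF K1(3) dec[OF z]])
  qed
qed

section \<open>Integral inequalities on intervals, half-lines and the line\<close>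

lemma abs_integral_le:
  fixes h g :: "'a \<Rightarrow> real"
  assumes h: "h \<in> borel_measurable M" and g: "integrable M g" and le: "\<And>x. \<bar>h x\<bar> \<le> g x"
  shows "integrable M h" "\<bar>\<integral>x. h x \<partial>M\<bar> \<le> (\<integral>x. g x \<partial>M)"
proof -
  show i: "integrable M h"
    by (rule Bochner_Integration.integrable_bound[OF g h])
      (auto intro!: AE_I2 order_trans[OF le abs_ge_self])
  show "\<bar>\<integral>x. h x \<partial>M\<bar> \<le> (\<integral>x. g x \<partial>M)"
    by (rule order_trans[OF integral_abs_bound integral_mono[OF integrable_abs[OF i] g le]])
qed

lemma integral_Icc_split:
  fixes f :: "real \<Rightarrow> real"
  assumes "a \<le> b" "b \<le> c" and i: "\<And>u v. integrable lborel (\<lambda>y. indicator {u..v} y * f y)"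
  shows "(\<integral>y. indicator {a..c} y * f y \<partial>lborel) =
    (\<integral>y. indicator {a..b} y * f y \<partial>lborel) + (\<integral>y. indicator {b..c} y * f y \<partial>lborel)"
proof -
  have "(\<integral>y. indicator {a..c} y * f y \<partial>lborel) =
      (\<integral>y. indicator {a..b} y * f y + indicator {b..c} y * f y \<partial>lborel)"
  proof (rule integral_cong_AE)
    show "AE y in lborel. indicator {a..c} y * f y = indicator {a..b} y * f y + indicator {b..c} y * f y"
      using AE_lborel_singleton[of b] by eventually_elim (use assms in \<open>auto simp: indicator_def\<close>)
  qed (intro borel_measurable_integrable i Bochner_Integration.integrable_add)+
  also have "\<dots> = (\<integral>y. indicator {a..b} y * f y \<partial>lborel) + (\<integral>y. indicator {b..c} y * f y \<partial>lborel)"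
    by (rule Bochner_Integration.integral_add[OF i i])
  finally show ?thesis .
qed

text \<open>Integration by parts is done with finite end points; this passes to the half-line
  whenever the constant does not depend on the far end point.\<close>

lemma integral_atLeast_bound:
  fixes f :: "real \<Rightarrow> real"
  assumes f: "integrable lborel f" and bd: "\<And>n. n \<ge> b \<Longrightarrow> \<bar>\<integral>y. indicator {a..n} y * f y \<partial>lborel\<bar> \<le> C"
  shows "\<bar>\<integral>y. indicator {a..} y * f y \<partial>lborel\<bar> \<le> C"
proof -
  have [measurable]: "f \<in> borel_measurable borel" using f by simp
  have "(\<lambda>k. \<integral>y. indicator {a..b + real k} y * f y \<partial>lborel) \<longlonglongrightarrow> (\<integral>y. indicator {a..} y * f y \<partial>lborel)"
  proof (rule integral_dominated_convergence)
    show "integrable lborel (\<lambda>y. \<bar>f y\<bar>)" using f by (rule integrable_abs)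
    show "AE y in lborel. (\<lambda>k. indicator {a..b + real k} y * f y) \<longlonglongrightarrow> indicator {a..} y * f y"
    proof (rule AE_I2)
      fix y
      obtain k0 where "y - b < real k0" using reals_Archimedean2 by blast
      then have "eventually (\<lambda>k. indicator {a..b + real k} y * f y = indicator {a..} y * f y) sequentially"
        by (intro eventually_sequentiallyI[of k0]) (auto simp: indicator_def)
      then show "(\<lambda>k. indicator {a..b + real k} y * f y) \<longlonglongrightarrow> indicator {a..} y * f y"
        by (rule tendsto_eventually)
    qed
    show "AE y in lborel. norm (indicator {a..b + real k} y * f y) \<le> \<bar>f y\<bar>" for k
      by (rule AE_I2) (simp add: indicator_def)
  qed measurable
  then have "(\<lambda>k. \<bar>\<integral>y. indicator {a..b + real k} y * f y \<partial>lborel\<bar>) \<longlonglongrightarrow> \<bar>\<integral>y. indicator {a..} y * f y \<partial>lborel\<bar>"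
    by (rule tendsto_rabs)
  then show ?thesis by (rule LIMSEQ_le_const2) (use bd in auto)
qed

lemma integral_Icc_le_antiderivative:
  fixes h k H :: "real \<Rightarrow> real"
  assumes ab: "a \<le> b" and k: "continuous_on {a..b} k" and h: "continuous_on {a..b} h"
    and H: "\<And>y. a \<le> y \<Longrightarrow> y \<le> b \<Longrightarrow> (H has_real_derivative h y) (at y)"
    and le: "\<And>y. a \<le> y \<Longrightarrow> y \<le> b \<Longrightarrow> k y \<le> h y"
  shows "(\<integral>y. indicator {a..b} y * k y \<partial>lborel) \<le> H b - H a"
proof -
  have i: "integrable lborel (\<lambda>y. indicator {a..b} y * g y)" if "continuous_on {a..b} g" for g :: "real \<Rightarrow> real"
    using borel_integrable_atLeastAtMost'[OF that] by (simp add: set_integrable_def)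
  have "(\<integral>y. indicator {a..b} y * k y \<partial>lborel) \<le> (\<integral>y. indicator {a..b} y * h y \<partial>lborel)"
    by (rule integral_mono[OF i[OF k] i[OF h]]) (use le in \<open>simp add: indicator_def\<close>)
  also have "\<dots> = (\<integral>y. indicator {a..b} y *\<^sub>R h y \<partial>lborel)" by (simp only: real_scaleR_def)
  also have "\<dots> = H b - H a"
    using ab H h by (intro integral_FTC_Icc)
      (auto simp: has_real_derivative_iff_has_vector_derivative intro: has_vector_derivative_at_within)
  finally show ?thesis .
qed

lemma cauchy_schwarz_Icc:
  fixes k g :: "real \<Rightarrow> real"
  assumes k: "continuous_on {a..b} k" and [measurable]: "g \<in> borel_measurable borel"
    and g: "integrable lborel (\<lambda>y. (g y)\<^sup>2)" "(\<integral>y. (g y)\<^sup>2 \<partial>lborel) \<le> B"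
    and A: "(\<integral>y. indicator {a..b} y * (k y)\<^sup>2 \<partial>lborel) \<le> A"
  shows "\<bar>\<integral>y. indicator {a..b} y * (k y * g y) \<partial>lborel\<bar> \<le> sqrt (A * B)"
proof -
  have sq: "(indicator {a..b} y * k y)\<^sup>2 = indicator {a..b} y * (k y)\<^sup>2" for y
    by (simp add: power_mult_distrib indicator_square)
  have "(\<integral>y. (indicator {a..b} y * k y) * g y \<partial>lborel)\<^sup>2 \<le>
      (\<integral>y. (indicator {a..b} y * k y)\<^sup>2 \<partial>lborel) * (\<integral>y. (g y)\<^sup>2 \<partial>lborel)"
  proof (rule cauchy_schwarz_integral(2)[OF _ _ _ g(1)])
    show "(\<lambda>y. indicator {a..b} y * k y) \<in> borel_measurable lborel"
      using borel_measurable_continuous_on_indicator[OF _ k] by simp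
    show "integrable lborel (\<lambda>y. (indicator {a..b} y * k y)\<^sup>2)"
      using borel_integrable_atLeastAtMost'[OF continuous_on_power[OF k, of 2]]
      unfolding sq by (simp add: set_integrable_def)
  qed simp
  also have "\<dots> \<le> A * B"
    unfolding sq by (intro mult_mono A g(2) order_trans[OF _ A] integral_nonneg_AE)
      (auto simp: indicator_def)
  finally show ?thesis
    using real_le_rsqrt[of "\<bar>\<integral>y. (indicator {a..b} y * k y) * g y \<partial>lborel\<bar>" "A * B"]
    by (simp add: mult.assoc)
qed

text \<open>To avoid a case split at the kink y = x, the integrand is majorised by the derivative of
  the smooth function 2 s / (1 + s^2)^(1/4), s = y - x, which is itself at most 2 sqrt |s| in
  absolute value.\<close>

lemma integral_inverse_sqrt_le:
  assumes "a \<le> b" "\<bar>a - x\<bar> \<le> D" "\<bar>b - x\<bar> \<le> D"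
  shows "(\<integral>y. indicator {a..b} y * (1 / sqrt (1 + \<bar>x - y\<bar>)) \<partial>lborel) \<le> 4 * sqrt D"
proof -
  define R where "R s = sqrt (sqrt (1 + s\<^sup>2))" for s :: real
  have Rpos: "R s > 0" for s unfolding R_def by (simp add: add_pos_nonneg)
  define H where "H y = 2 * ((y - x) / R (y - x))" for y
  define h where "h y = 2 * ((1 + (y - x)\<^sup>2 / 2) / (R (y - x) * (1 + (y - x)\<^sup>2)))" for y
  have R4: "R s ^ 4 = 1 + s\<^sup>2" for s
  proof -
    have "R s ^ 4 = ((R s)\<^sup>2)\<^sup>2" by (simp add: power_mult[symmetric])
    also have "\<dots> = 1 + s\<^sup>2" unfolding R_def by simp
    finally show ?thesis .
  qed
  have dR: "(R has_real_derivative (s * R s / (2 * (1 + s\<^sup>2)))) (at s)" for s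
  proof -
    have "1 + s\<^sup>2 > 0" by (simp add: add_pos_nonneg)
    have "(R has_real_derivative (s / (sqrt (1 + s\<^sup>2) * (2 * R s)))) (at s)"
      unfolding R_def using \<open>1 + s\<^sup>2 > 0\<close>
      by (auto intro!: derivative_eq_intros simp: field_simps)
    moreover have "sqrt (1 + s\<^sup>2) = (R s)\<^sup>2" by (simp add: R_def)
    moreover have "s / ((R s)\<^sup>2 * (2 * R s)) = s * R s / (2 * (1 + s\<^sup>2))"
      unfolding R4[symmetric] using Rpos[of s] by (simp add: power_def field_simps eval_nat_numeral)
    ultimately show ?thesis by simp
  qed
  have dH: "(H has_real_derivative h y) (at y)" for y
  proof -
    have "((\<lambda>y. R (y - x)) has_real_derivative (y - x) * R (y - x) / (2 * (1 + (y - x)\<^sup>2)) * 1) (at y)"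
      by (rule DERIV_chain2[OF dR]) (auto intro!: derivative_eq_intros)
    then have "(H has_real_derivative 2 * ((1 * R (y - x) - (y - x) * ((y - x) * R (y - x) / (2 * (1 + (y - x)\<^sup>2)) * 1))
        / (R (y - x) * R (y - x)))) (at y)"
      unfolding H_def using Rpos[of "y - x"]
      by (intro DERIV_cmult DERIV_divide) (auto intro!: derivative_eq_intros)
    moreover have "(1 * R s - s * (s * R s / (2 * (1 + s\<^sup>2)) * 1)) / (R s * R s) = (1 + s\<^sup>2 / 2) / (R s * (1 + s\<^sup>2))" for s
    proof -
      have "1 + s\<^sup>2 > 0" by (simp add: add_pos_nonneg)
      have "1 * R s - s * (s * R s / (2 * (1 + s\<^sup>2)) * 1) = R s * ((1 + s\<^sup>2 / 2) / (1 + s\<^sup>2))"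
        using \<open>1 + s\<^sup>2 > 0\<close> by (simp add: field_simps power2_eq_square)
      then show ?thesis using Rpos[of s] by simp
    qed
    ultimately show ?thesis by (simp only: h_def)
  qed
  have "(\<integral>y. indicator {a..b} y * (1 / sqrt (1 + \<bar>x - y\<bar>)) \<partial>lborel) \<le> H b - H a"
  proof (rule integral_Icc_le_antiderivative[OF assms(1) _ _ dH])
    show "continuous_on {a..b} (\<lambda>y. 1 / sqrt (1 + \<bar>x - y\<bar>))"
      by (intro continuous_intros) (auto simp: add_nonneg_eq_0_iff)
    have "1 + z\<^sup>2 \<noteq> 0" for z :: real using zero_le_power2[of z] by linarith
    then show "continuous_on {a..b} h"
      unfolding h_def R_def by (intro continuous_intros) simp_all
    show "1 / sqrt (1 + \<bar>x - y\<bar>) \<le> h y" for y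
    proof -
      define s where "s = y - x"
      have s1: "1 + s\<^sup>2 > 0" by (simp add: add_pos_nonneg)
      have "R s \<le> sqrt (1 + \<bar>s\<bar>)"
      proof -
        have "1 + s\<^sup>2 \<le> (1 + \<bar>s\<bar>)\<^sup>2" by (simp add: power2_sum)
        then have "sqrt (1 + s\<^sup>2) \<le> 1 + \<bar>s\<bar>" by (intro real_le_lsqrt) auto
        then show ?thesis unfolding R_def by simp
      qed
      then have "1 / sqrt (1 + \<bar>s\<bar>) \<le> 1 / R s" using Rpos[of s] by (intro divide_left_mono) auto
      also have "\<dots> = 2 * (((1 + s\<^sup>2) / 2) / (R s * (1 + s\<^sup>2)))" using s1 by simp
      also have "\<dots> \<le> 2 * ((1 + s\<^sup>2 / 2) / (R s * (1 + s\<^sup>2)))"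
        using s1 Rpos[of s] by (intro mult_left_mono divide_right_mono mult_nonneg_nonneg) auto
      finally show ?thesis by (simp add: h_def s_def abs_minus_commute)
    qed
  qed
  also have "\<dots> \<le> 4 * sqrt D"
  proof -
    have "\<bar>H y\<bar> \<le> 2 * sqrt D" if "\<bar>y - x\<bar> \<le> D" for y
    proof -
      define s where "s = y - x"
      have "sqrt \<bar>s\<bar> \<le> R s"
        unfolding R_def by (intro real_sqrt_le_mono real_le_rsqrt) simp
      then have "sqrt \<bar>s\<bar> * sqrt \<bar>s\<bar> \<le> sqrt D * R s"
        using that by (intro mult_mono) (auto simp: s_def)
      then have "\<bar>s\<bar> / R s \<le> sqrt D" using Rpos[of s] by (simp add: pos_divide_le_eq)
      then show ?thesis using Rpos[of s] by (simp add: H_def s_def[symmetric] abs_mult)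
    qed
    then have "\<bar>H a\<bar> \<le> 2 * sqrt D" "\<bar>H b\<bar> \<le> 2 * sqrt D" using assms by blast+
    then show ?thesis by linarith
  qed
  finally show ?thesis .
qed

lemma integrable_inverse_quadratic:
  "integrable lborel (\<lambda>y::real. 1 / (1 + (x - y)\<^sup>2))"
  "(\<integral>y. 1 / (1 + (x - y)\<^sup>2) \<partial>lborel) = pi"
proof -
  have ic: "integrable lborel (\<lambda>y::real. inverse (1 + y\<^sup>2))"
    using integrable_inverse_1_plus_square by (simp add: set_integrable_def)
  show "integrable lborel (\<lambda>y. 1 / (1 + (x - y)\<^sup>2))"
    using lborel_integrable_real_affine[OF ic, of "-1" x] by (simp add: divide_inverse)
  have "(\<integral>y. inverse (1 + y\<^sup>2) \<partial>lborel) = pi"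
    using LBINT_inverse_1_plus_square
    by (simp add: interval_lebesgue_integral_def set_lebesgue_integral_def)
  then show "(\<integral>y. 1 / (1 + (x - y)\<^sup>2) \<partial>lborel) = pi"
    using lborel_integral_real_affine[of "-1" "\<lambda>y. inverse (1 + y\<^sup>2)" x] by (simp add: divide_inverse)
qed

section \<open>Estimates at unit time\<close>

text \<open>The constant \<open>T\<close> is the original time; the size of the data is normalised to 1.\<close>

locale scaled_data =
  fixes K T N :: real and V G :: "real \<Rightarrow> real"
  assumes K: "K > 0"
    and airy_le: "\<And>z. \<bar>airy z\<bar> \<le> K / root4 z"
    and airy'_le: "\<And>z. \<bar>airy' z\<bar> \<le> K * root4 z"
    and airy_decay: "\<And>z. z \<ge> 0 \<Longrightarrow> \<bar>airy z\<bar> \<le> K / (1 + z\<^sup>2)"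
    and airy'_decay: "\<And>z. z \<ge> 0 \<Longrightarrow> \<bar>airy' z\<bar> \<le> K / (1 + z\<^sup>2)"
    and T: "T > 0"
    and G_meas: "G \<in> borel_measurable borel"
    and prim: "primitive V G"
    and G_int: "integrable lborel (\<lambda>y. (G y)\<^sup>2)" and G_le: "(\<integral>y. (G y)\<^sup>2 \<partial>lborel) \<le> T"
    and V2_int: "integrable lborel (\<lambda>y. (y\<^sup>2 * V y)\<^sup>2)"
    and V2_le: "(\<integral>y. (y\<^sup>2 * V y)\<^sup>2 \<partial>lborel) \<le> 1 / T"
    and V1_int: "integrable lborel (\<lambda>y. (1 + \<bar>y\<bar>) * \<bar>V y\<bar>)"
    and V_le: "(\<integral>y. \<bar>V y\<bar> \<partial>lborel) \<le> N"
    and V_point: "\<And>y. \<bar>y\<bar> * \<bar>V y\<bar> \<le> 2"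
begin

lemma V_cont: "continuous_on A V"
  using primitive_continuous[OF prim G_meas G_int] continuous_on_subset by blast

lemma V_meas[measurable]: "V \<in> borel_measurable borel"
  by (intro borel_measurable_continuous_onI V_cont)

lemma V_int: "integrable lborel (\<lambda>y. \<bar>V y\<bar>)"
  by (rule abs_integral_le(1)[OF _ V1_int]) (auto simp: distrib_right)

lemma N_nonneg: "N \<ge> 0"
  by (rule order_trans[OF integral_nonneg_AE V_le]) simp

lemma V_div: "y > 0 \<Longrightarrow> \<bar>V y\<bar> \<le> 2 / y"
  using V_point[of y] by (simp add: pos_le_divide_eq mult.commute)

lemma airy_le_K: "\<bar>airy z\<bar> \<le> K"
proof -
  have "K / root4 z \<le> K / 1" using K root4_ge_1[of z] by (intro divide_left_mono) auto
  then show ?thesis using airy_le[of z] by simp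
qed

lemma airy_sq_le: "(airy z)\<^sup>2 \<le> K\<^sup>2 * (1 / sqrt (1 + \<bar>z\<bar>))"
proof -
  have "\<bar>airy z\<bar>\<^sup>2 \<le> (K / root4 z)\<^sup>2" by (intro power_mono airy_le) simp
  then show ?thesis by (simp add: power_divide root4_squared)
qed

lemma airy'_sq_le: "(airy' z)\<^sup>2 \<le> K\<^sup>2 * sqrt (1 + \<bar>z\<bar>)"
proof -
  have "\<bar>airy' z\<bar>\<^sup>2 \<le> (K * root4 z)\<^sup>2" by (intro power_mono airy'_le) simp
  then show ?thesis by (simp add: power_mult_distrib root4_squared)
qed

lemma root4_le: "root4 z \<le> 1 + \<bar>z\<bar>"
proof -
  have "sqrt p \<le> p" if "p \<ge> 1" for p
    using that mult_mono[of 1 p p p] by (intro real_le_lsqrt) (auto simp: power2_eq_square)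
  from this[of "1 + \<bar>z\<bar>"] this[of "sqrt (1 + \<bar>z\<bar>)"] show ?thesis
    unfolding root4_def by (intro order_trans[of "sqrt (sqrt (1 + \<bar>z\<bar>))" "sqrt (1 + \<bar>z\<bar>)" "1 + \<bar>z\<bar>"]) simp_all
qed

lemma airy_comp_meas[measurable]:
  "(\<lambda>y. airy (x - y)) \<in> borel_measurable borel" "(\<lambda>y. airy' (x - y)) \<in> borel_measurable borel"
  by measurable

lemma airy_V_int: "integrable lborel (\<lambda>y. airy (x - y) * V y)"
  by (rule abs_integral_le(1)[OF _ integrable_mult_right[OF V_int, of K]])
    (auto simp: abs_mult intro: mult_right_mono airy_le_K)

text \<open>The growth of \<open>airy'\<close> in y is absorbed by the weight 1 + |y|, locally
  uniformly in x; this justifies convergence and differentiation under the integral.\<close>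

lemma airy'_V_bound: "\<bar>airy' z * V y\<bar> \<le> K * (1 + \<bar>z + y\<bar>) * ((1 + \<bar>y\<bar>) * \<bar>V y\<bar>)"
proof -
  have "1 + \<bar>z\<bar> \<le> (1 + \<bar>z + y\<bar>) * (1 + \<bar>y\<bar>)"
  proof -
    have "0 \<le> \<bar>z + y\<bar> * \<bar>y\<bar>" by simp
    moreover have "(1 + \<bar>z + y\<bar>) * (1 + \<bar>y\<bar>) = 1 + \<bar>z + y\<bar> + \<bar>y\<bar> + \<bar>z + y\<bar> * \<bar>y\<bar>"
      by (simp add: algebra_simps)
    ultimately show ?thesis by linarith
  qed
  then have "\<bar>airy' z\<bar> \<le> K * ((1 + \<bar>z + y\<bar>) * (1 + \<bar>y\<bar>))"
    using K by (intro order_trans[OF airy'_le] mult_left_mono order_trans[OF root4_le]) auto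
  from mult_right_mono[OF this, of "\<bar>V y\<bar>"] show ?thesis by (simp add: abs_mult mult_ac)
qed

lemma airy'_V_int: "integrable lborel (\<lambda>y. airy' (x - y) * V y)"
  by (rule abs_integral_le(1)[OF _ integrable_mult_right[OF V1_int, of "K * (1 + \<bar>x\<bar>)"]])
    (use airy'_V_bound[of "x - y" y for y] in simp_all)

lemma ind_int:
  assumes "integrable lborel f"
  shows "integrable lborel (\<lambda>y. indicator {u..v::real} y * (f y :: real))"
  using integrable_mult_indicator[OF _ assms, of "{u..v}"] by simp

definition W :: "real \<Rightarrow> real" where "W x = (\<integral>y. airy (x - y) * V y \<partial>lborel)"
definition W' :: "real \<Rightarrow> real" where "W' x = (\<integral>y. airy' (x - y) * V y \<partial>lborel)"

lemma W_deriv: "(W has_real_derivative W' x) (at x)"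
  unfolding W_def[abs_def] W'_def
proof (rule has_real_derivative_integral[where d = 1 and w = "\<lambda>y. K * (2 + \<bar>x\<bar>) * ((1 + \<bar>y\<bar>) * \<bar>V y\<bar>)"])
  show "((\<lambda>t. airy (t - y) * V y) has_real_derivative airy' (t - y) * V y) (at t)" for t y
    by (auto intro!: derivative_eq_intros DERIV_chain2[OF airy_deriv])
  show "\<bar>airy' (t - y) * V y\<bar> \<le> K * (2 + \<bar>x\<bar>) * ((1 + \<bar>y\<bar>) * \<bar>V y\<bar>)" if "\<bar>t - x\<bar> < 1" for t y
  proof (rule order_trans[OF airy'_V_bound])
    have "1 + \<bar>t\<bar> \<le> 2 + \<bar>x\<bar>" using that by linarith
    then show "K * (1 + \<bar>t - y + y\<bar>) * ((1 + \<bar>y\<bar>) * \<bar>V y\<bar>) \<le> K * (2 + \<bar>x\<bar>) * ((1 + \<bar>y\<bar>) * \<bar>V y\<bar>)"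
      using K by (intro mult_right_mono mult_left_mono) auto
  qed
qed (use V1_int airy_V_int in \<open>auto intro!: integrable_mult_right\<close>)

text \<open>At distance \<open>R\<close> with \<open>T\<^sup>2 * R ^ 3 = 1\<close> the bound through \<open>y\<^sup>2 * V\<close> and the one obtained by integrating by
  parts onto \<open>G\<close> agree.\<close>

lemma airy'_tail_beyond_crossover:
  assumes R: "R \<ge> 1 / 2" and x: "\<bar>x\<bar> \<le> 2 * R" and cross: "T\<^sup>2 * R ^ 3 \<ge> 1" and n: "n \<ge> R"
  shows "\<bar>\<integral>y. indicator {R..n} y * (airy' (x - y) * V y) \<partial>lborel\<bar> \<le> 2 * K / sqrt R"
proof -
  have Rpos: "R > 0" using R by simp
  define k where "k y = airy' (x - y) / y\<^sup>2" for y
  have kc: "continuous_on {R..n} k"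
    unfolding k_def using Rpos
    by (intro continuous_intros continuous_on_compose2[OF airy_continuous(2)[of UNIV]]) auto
  have ksq: "(k y)\<^sup>2 \<le> K\<^sup>2 * (3 / (y ^ 3 * sqrt y))" if "R \<le> y" for y
  proof -
    have y: "y > 0" "y \<ge> 1 / 2" using that R by simp_all
    \<comment> \<open>The sum is in fact at most 5 y; 9 is a square and leaves the radical as the
      factor 3.\<close>
    have "1 + \<bar>x - y\<bar> \<le> 9 * y" using that x y by linarith
    then have "sqrt (1 + \<bar>x - y\<bar>) \<le> sqrt (3\<^sup>2 * y)" by (intro real_sqrt_le_mono) simp
    then have "sqrt (1 + \<bar>x - y\<bar>) \<le> 3 * sqrt y" by (simp only: real_sqrt_mult real_sqrt_abs abs_numeral)
    then have "(airy' (x - y))\<^sup>2 \<le> K\<^sup>2 * (3 * sqrt y)"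
      by (intro order_trans[OF airy'_sq_le] mult_left_mono) auto
    then have "(k y)\<^sup>2 \<le> K\<^sup>2 * (3 * sqrt y) / (y\<^sup>2)\<^sup>2"
      unfolding k_def power_divide by (rule divide_right_mono) simp
    also have "\<dots> = K\<^sup>2 * (3 / (y ^ 3 * sqrt y))"
    proof -
      have "sqrt y / (y\<^sup>2)\<^sup>2 = 1 / (y ^ 3 * sqrt y)"
      proof -
        have "sqrt y * (y ^ 3 * sqrt y) = y ^ 3 * (sqrt y * sqrt y)" by (simp only: mult_ac)
        also have "\<dots> = (y\<^sup>2)\<^sup>2" using y by (simp add: eval_nat_numeral)
        finally show ?thesis using y by (simp add: frac_eq_eq)
      qed
      then have "K\<^sup>2 * (3 * (sqrt y / (y\<^sup>2)\<^sup>2)) = K\<^sup>2 * (3 * (1 / (y ^ 3 * sqrt y)))" by (simp only:)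
      then show ?thesis by (simp only: times_divide_eq_right mult_1_right)
    qed
    finally show ?thesis .
  qed
  have int: "(\<integral>y. indicator {R..n} y * (k y)\<^sup>2 \<partial>lborel) \<le> 2 * K\<^sup>2 / (R\<^sup>2 * sqrt R)"
  proof -
    \<comment> \<open>The antiderivative of 3 K^2 y^(-7/2).\<close>
    define H where "H y = - (6 / 5) * K\<^sup>2 * (1 / (y\<^sup>2 * sqrt y))" for y
    have "(\<integral>y. indicator {R..n} y * (k y)\<^sup>2 \<partial>lborel) \<le> H n - H R"
    proof (rule integral_Icc_le_antiderivative[OF n _ _ _ ksq])
      show "continuous_on {R..n} (\<lambda>y. (k y)\<^sup>2)" by (intro continuous_intros kc)
      show "continuous_on {R..n} (\<lambda>y. K\<^sup>2 * (3 / (y ^ 3 * sqrt y)))"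
        using Rpos by (intro continuous_intros) auto
      show "(H has_real_derivative K\<^sup>2 * (3 / (y ^ 3 * sqrt y))) (at y)" if "R \<le> y" for y
      proof -
        have y: "y > 0" using that Rpos by simp
        have "((\<lambda>y. y\<^sup>2 * sqrt y) has_real_derivative 2 * y * sqrt y + y\<^sup>2 * (inverse (sqrt y) / 2)) (at y)"
          using y by (auto intro!: derivative_eq_intros simp: field_simps)
        moreover have "2 * y * sqrt y + y\<^sup>2 * (inverse (sqrt y) / 2) = 5 / 2 * (y * sqrt y)"
        proof -
          have "y\<^sup>2 * inverse (sqrt y) = y * (y / sqrt y)" by (simp add: power2_eq_square divide_inverse)
          also have "\<dots> = y * sqrt y" using y by (simp add: real_div_sqrt)
          finally show ?thesis by simp
        qed
        ultimately have d: "((\<lambda>y. y\<^sup>2 * sqrt y) has_real_derivative 5 / 2 * (y * sqrt y)) (at y)" by simp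
        have "((\<lambda>y. inverse (y\<^sup>2 * sqrt y)) has_real_derivative
            - (inverse (y\<^sup>2 * sqrt y) * (5 / 2 * (y * sqrt y)) * inverse (y\<^sup>2 * sqrt y))) (at y)"
          using y by (intro DERIV_inverse'[OF d]) auto
        from DERIV_cmult[OF this, of "- (6 / 5) * K\<^sup>2"]
        have "(H has_real_derivative - (6 / 5) * K\<^sup>2 *
            - (inverse (y\<^sup>2 * sqrt y) * (5 / 2 * (y * sqrt y)) * inverse (y\<^sup>2 * sqrt y))) (at y)"
          unfolding H_def by (simp only: inverse_eq_divide)
        moreover have "- (6 / 5) * c * - (p * (5 / 2 * q) * p) = c * (3 * (p * q * p))" for c p q :: real
          by simp
        moreover have "inverse (y\<^sup>2 * sqrt y) * (y * sqrt y) * inverse (y\<^sup>2 * sqrt y) = 1 / (y ^ 3 * sqrt y)"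
          using y by (simp add: field_simps eval_nat_numeral)
        ultimately show ?thesis by (simp only: times_divide_eq_right mult_1_right)
      qed
    qed
    also have "\<dots> \<le> 2 * K\<^sup>2 / (R\<^sup>2 * sqrt R)"
    proof -
      have "0 \<le> K\<^sup>2 * (1 / (n\<^sup>2 * sqrt n))" "0 \<le> K\<^sup>2 * (1 / (R\<^sup>2 * sqrt R))" using n Rpos by simp_all
      then show ?thesis unfolding H_def by simp
    qed
    finally show ?thesis .
  qed
  have "\<bar>\<integral>y. indicator {R..n} y * (k y * (y\<^sup>2 * V y)) \<partial>lborel\<bar> \<le> sqrt (2 * K\<^sup>2 / (R\<^sup>2 * sqrt R) * (1 / T))"
    by (rule cauchy_schwarz_Icc[OF kc _ V2_int V2_le int]) simp
  also have "(\<lambda>y. indicator {R..n} y * (k y * (y\<^sup>2 * V y))) = (\<lambda>y. indicator {R..n} y * (airy' (x - y) * V y))"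
    using Rpos by (auto simp: k_def indicator_def)
  also have "sqrt (2 * K\<^sup>2 / (R\<^sup>2 * sqrt R) * (1 / T)) \<le> 2 * K / sqrt R"
  proof (rule real_le_lsqrt)
    \<comment> \<open>This is the crossover condition in square-root form, T R^(3/2) >= 1; it
      converts the factor 1 / T into a power of R.\<close>
    have "1 \<le> T * R * sqrt R"
    proof -
      have "1\<^sup>2 \<le> (T * R * sqrt R)\<^sup>2"
        using cross Rpos by (simp add: power_mult_distrib eval_nat_numeral mult_ac)
      then show ?thesis using T Rpos by (intro power2_le_imp_le[of 1]) auto
    qed
    then have "2 * K\<^sup>2 * 1 \<le> 2 * K\<^sup>2 * (2 * (T * R * sqrt R))" by (intro mult_left_mono) auto
    then show "2 * K\<^sup>2 / (R\<^sup>2 * sqrt R) * (1 / T) \<le> (2 * K / sqrt R)\<^sup>2"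
      using T Rpos by (simp add: power_divide power_mult_distrib field_simps power2_eq_square)
  qed (use K Rpos T in auto)
  finally show ?thesis .
qed


text \<open>Up to the crossover the growing kernel \<open>airy'\<close> is integrated to the
  decaying one, at the price of the derivative \<open>G\<close> of \<open>V\<close>. The boundary
  terms are controlled by |y V(y)| <= 2.\<close>

lemma airy'_tail_by_parts:
  assumes m: "m \<ge> 1 / 2" and x: "\<bar>x\<bar> \<le> 2 * m" and mR: "m \<le> R" and cross: "T\<^sup>2 * R ^ 3 = 1"
  shows "\<bar>\<integral>y. indicator {m..R} y * (airy' (x - y) * V y) \<partial>lborel\<bar> \<le> 9 * K / sqrt m"
proof -
  have pos: "m > 0" "R > 0" using m mR by simp_all
  have parts: "(\<integral>y. indicator {m..R} y * (V y * airy' (x - y)) \<partial>lborel) =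
      V R * - airy (x - R) - V m * - airy (x - m) - (\<integral>y. indicator {m..R} y * (G y * - airy (x - y)) \<partial>lborel)"
  proof (rule primitive_integration_by_parts[OF prim G_meas G_int mR])
    show "((\<lambda>y. - airy (x - y)) has_real_derivative airy' (x - y)) (at y)" for y
    proof -
      have "((\<lambda>y. airy (x - y)) has_real_derivative airy' (x - y) * - 1) (at y)"
        by (rule DERIV_chain2[OF airy_deriv]) (auto intro!: derivative_eq_intros)
      from DERIV_minus[OF this] show ?thesis by simp
    qed
    show "continuous_on {m..R} (\<lambda>y. airy' (x - y))"
      by (intro continuous_intros continuous_on_compose2[OF airy_continuous(2)[of UNIV]]) auto
  qed
  \<comment> \<open>All distances |x - y| are at most 3 R, so the squared kernel integrates to a
    multiple of sqrt R; the relation T R^(3/2) = 1 then turns the product with T into a multiple of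
    1 / R.\<close>
  have "\<bar>\<integral>y. indicator {m..R} y * (- airy (x - y) * G y) \<partial>lborel\<bar> \<le> sqrt (K\<^sup>2 * (4 * sqrt (3 * R)) * T)"
  proof (rule cauchy_schwarz_Icc[OF _ G_meas G_int G_le])
    show c: "continuous_on {m..R} (\<lambda>y. - airy (x - y))"
      by (intro continuous_intros continuous_on_compose2[OF airy_continuous(1)[of UNIV]]) auto
    have "(\<integral>y. indicator {m..R} y * (- airy (x - y))\<^sup>2 \<partial>lborel) \<le>
        (\<integral>y. K\<^sup>2 * (indicator {m..R} y * (1 / sqrt (1 + \<bar>x - y\<bar>))) \<partial>lborel)"
    proof (rule integral_mono)
      show "integrable lborel (\<lambda>y. indicator {m..R} y * (- airy (x - y))\<^sup>2)"
        using borel_integrable_atLeastAtMost'[OF continuous_on_power[OF c, of 2]] by (simp add: set_integrable_def)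
      have "continuous_on {m..R} (\<lambda>y. 1 / sqrt (1 + \<bar>x - y\<bar>))"
        by (intro continuous_intros) (auto simp: add_nonneg_eq_0_iff)
      from borel_integrable_atLeastAtMost'[OF this]
      show "integrable lborel (\<lambda>y. K\<^sup>2 * (indicator {m..R} y * (1 / sqrt (1 + \<bar>x - y\<bar>))))"
        by (intro integrable_mult_right) (simp add: set_integrable_def)
      show "indicator {m..R} y * (- airy (x - y))\<^sup>2 \<le> K\<^sup>2 * (indicator {m..R} y * (1 / sqrt (1 + \<bar>x - y\<bar>)))" for y
        using airy_sq_le[of "x - y"] by (simp add: indicator_def)
    qed
    also have "\<dots> = K\<^sup>2 * (\<integral>y. indicator {m..R} y * (1 / sqrt (1 + \<bar>x - y\<bar>)) \<partial>lborel)"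
      by (rule integral_mult_right_zero)
    also have "\<dots> \<le> K\<^sup>2 * (4 * sqrt (3 * R))"
      by (intro mult_left_mono integral_inverse_sqrt_le) (use m x mR in \<open>simp_all add: abs_le_iff\<close>)
    finally show "(\<integral>y. indicator {m..R} y * (- airy (x - y))\<^sup>2 \<partial>lborel) \<le> K\<^sup>2 * (4 * sqrt (3 * R))" .
  qed
  also have "\<dots> \<le> 3 * K / sqrt R"
  proof (rule real_le_lsqrt)
    have "(T * R * sqrt R)\<^sup>2 = 1\<^sup>2"
      using cross pos by (simp add: power_mult_distrib eval_nat_numeral mult_ac)
    then have TR: "T * R * sqrt R = 1" using T pos by (subst (asm) power2_eq_iff_nonneg) auto
    have s3: "sqrt 3 \<le> 2" by (intro real_le_lsqrt) auto
    have "K\<^sup>2 * (4 * sqrt (3 * R)) * T = K\<^sup>2 * (4 * sqrt 3) * (T * R * sqrt R) / R"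
      using pos by (simp add: real_sqrt_mult)
    also have "\<dots> \<le> K\<^sup>2 * 9 / R"
      unfolding TR mult_1_right using s3 pos by (intro divide_right_mono mult_left_mono) auto
    also have "\<dots> = (3 * K / sqrt R)\<^sup>2" using pos by (simp add: power_divide power_mult_distrib)
    finally show "K\<^sup>2 * (4 * sqrt (3 * R)) * T \<le> (3 * K / sqrt R)\<^sup>2" .
  qed (use K pos T in auto)
  also have "\<dots> \<le> 3 * K / sqrt m" using pos mR K by (intro divide_left_mono) auto
  finally have 1: "\<bar>\<integral>y. indicator {m..R} y * (G y * - airy (x - y)) \<partial>lborel\<bar> \<le> 3 * K / sqrt m"
    by (simp only: mult.commute[of "- airy _"])
  have bdry: "\<bar>V y * - airy (x - y)\<bar> \<le> 3 * K / sqrt m" if "y \<ge> m" for y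
  proof -
    have y: "y > 0" using that pos by simp
    have "1 \<le> sqrt (2 * m)" using m by simp
    also have "\<dots> \<le> 3 / 2 * sqrt m"
    proof -
      have "sqrt 2 \<le> 3 / 2" by (intro real_le_lsqrt) (auto simp: power2_eq_square)
      then show ?thesis using pos by (simp add: real_sqrt_mult mult_right_mono)
    qed
    finally have "2 * sqrt m \<le> 3 * (sqrt m * sqrt m)"
      using mult_right_mono[of 1 "3 / 2 * sqrt m" "2 * sqrt m"] pos by simp
    then have "2 / m \<le> 3 / sqrt m" using pos by (simp add: field_simps)
    have "\<bar>V y * - airy (x - y)\<bar> \<le> 2 / y * K"
      unfolding abs_mult abs_minus_cancel using y K by (intro mult_mono V_div airy_le_K) auto
    also have "\<dots> \<le> 2 / m * K" using that pos K by (intro mult_right_mono divide_left_mono) auto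
    also have "\<dots> \<le> 3 / sqrt m * K" using \<open>2 / m \<le> 3 / sqrt m\<close> K by (intro mult_right_mono) auto
    finally show ?thesis by simp
  qed
  have "\<bar>\<integral>y. indicator {m..R} y * (V y * airy' (x - y)) \<partial>lborel\<bar> \<le> 3 * K / sqrt m + 3 * K / sqrt m + 3 * K / sqrt m"
    unfolding parts using bdry[OF mR] bdry[of m] 1 by linarith
  then show ?thesis by (simp add: mult.commute[of "V _"])
qed

text \<open>If \<open>m\<close> already lies beyond the crossover R = T^(-2/3), the weighted
  estimate applies to the whole tail. Otherwise [m, R] is treated by parts and the rest by the
  weighted estimate; both give a multiple of 1 / sqrt m, independent of \<open>T\<close>.\<close>

lemma airy'_tail_bound:
  assumes m: "m \<ge> 1 / 2" and x: "\<bar>x\<bar> \<le> 2 * m"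
  shows "\<bar>\<integral>y. indicator {m..} y * (airy' (x - y) * V y) \<partial>lborel\<bar> \<le> 11 * K / sqrt m"
proof -
  have mpos: "m > 0" using m by simp
  have Km: "K / sqrt m > 0" using K mpos by simp
  show ?thesis
  proof (cases "T\<^sup>2 * m ^ 3 \<ge> 1")
    case True
    have "\<bar>\<integral>y. indicator {m..n} y * (airy' (x - y) * V y) \<partial>lborel\<bar> \<le> 11 * K / sqrt m" if "n \<ge> m" for n
      using airy'_tail_beyond_crossover[OF m x True that] Km by simp
    then show ?thesis by (rule integral_atLeast_bound[OF airy'_V_int])
  next
    case False
    define R where "R = root 3 (1 / T\<^sup>2)"
    have R3: "T\<^sup>2 * R ^ 3 = 1" unfolding R_def using T by (simp add: real_root_pow_pos2)
    have "R > 0" unfolding R_def using T by simp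
    have mR: "m \<le> R"
    proof (rule ccontr)
      assume "\<not> m \<le> R"
      then have "R ^ 3 \<le> m ^ 3" using \<open>R > 0\<close> by (intro power_mono) auto
      then have "T\<^sup>2 * R ^ 3 \<le> T\<^sup>2 * m ^ 3" by (intro mult_left_mono) auto
      then show False using R3 False by simp
    qed
    have "\<bar>\<integral>y. indicator {m..n} y * (airy' (x - y) * V y) \<partial>lborel\<bar> \<le> 11 * K / sqrt m" if n: "n \<ge> R" for n
    proof -
      have "\<bar>\<integral>y. indicator {R..n} y * (airy' (x - y) * V y) \<partial>lborel\<bar> \<le> 2 * K / sqrt R"
        by (rule airy'_tail_beyond_crossover) (use m x mR R3 n in auto)
      also have "\<dots> \<le> 2 * K / sqrt m" using mR mpos K by (intro divide_left_mono) auto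
      finally show ?thesis
        using airy'_tail_by_parts[OF m x mR R3] integral_Icc_split[OF mR n ind_int[OF airy'_V_int[of x]]] by linarith
    qed
    then show ?thesis by (rule integral_atLeast_bound[OF airy'_V_int])
  qed
qed


lemma integral_split_at:
  fixes m :: real
  assumes f: "integrable lborel f"
  shows "(\<integral>y. f y \<partial>lborel) = (\<integral>y. indicator {..<m} y * f y \<partial>lborel) + (\<integral>y. indicator {m..} y * (f y :: real) \<partial>lborel)"
proof -
  have i: "integrable lborel (\<lambda>y. indicator A y * f y)" if "A \<in> sets borel" for A :: "real set"
    using integrable_mult_indicator[OF _ f, of A] that by simp
  have "(\<integral>y. f y \<partial>lborel) = (\<integral>y. indicator {..<m} y * f y + indicator {m..} y * f y \<partial>lborel)"
    by (rule Bochner_Integration.integral_cong) (auto simp: indicator_def)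
  also have "\<dots> = (\<integral>y. indicator {..<m} y * f y \<partial>lborel) + (\<integral>y. indicator {m..} y * f y \<partial>lborel)"
    by (intro Bochner_Integration.integral_add i) auto
  finally show ?thesis .
qed

lemma V_weighted_bound:
  assumes [measurable]: "f \<in> borel_measurable borel" and c: "c \<ge> 0" and le: "\<And>y. \<bar>f y\<bar> \<le> c * \<bar>V y\<bar>"
  shows "\<bar>\<integral>y. f y \<partial>lborel\<bar> \<le> c * N"
proof -
  have "\<bar>\<integral>y. f y \<partial>lborel\<bar> \<le> (\<integral>y. c * \<bar>V y\<bar> \<partial>lborel)"
    by (rule abs_integral_le(2)[OF _ integrable_mult_right[OF V_int] le]) simp
  also have "\<dots> = c * (\<integral>y. \<bar>V y\<bar> \<partial>lborel)" by (rule integral_mult_right_zero)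
  also have "\<dots> \<le> c * N" by (intro mult_left_mono V_le c)
  finally show ?thesis .
qed

lemma root4_le_2:
  assumes "1 + \<bar>a\<bar> \<le> 16 * (1 + \<bar>b\<bar>)"
  shows "root4 a \<le> 2 * root4 b"
proof -
  have "root4 a \<le> sqrt (sqrt (4\<^sup>2 * (1 + \<bar>b\<bar>)))"
    unfolding root4_def using assms by (intro real_sqrt_le_mono) simp
  also have "\<dots> = sqrt (2\<^sup>2 * sqrt (1 + \<bar>b\<bar>))"
    by (simp only: real_sqrt_mult real_sqrt_abs abs_numeral) simp
  also have "\<dots> = 2 * root4 b"
    by (simp only: real_sqrt_mult[of "2\<^sup>2"] real_sqrt_abs abs_numeral root4_def)
  finally show ?thesis .
qed

text \<open>The first moment of V in \<open>V1_int\<close> is finite but not bounded uniformly in T,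
  so it cannot pay for the growth of \<open>airy'\<close> at large y. Below m = 2 (1 + |x|) the
  kernel is comparable with root4 x and the L1 norm suffices; above m the tail estimate takes
  over.\<close>

lemma W'_bound: "\<bar>W' x\<bar> \<le> K * (2 * N + 11) * root4 x"
proof -
  define m where "m = 2 * (1 + \<bar>x\<bar>)"
  have "\<bar>\<integral>y. indicator {..<m} y * (airy' (x - y) * V y) \<partial>lborel\<bar> \<le> (2 * K * root4 x) * N"
  proof (rule V_weighted_bound)
    show "\<bar>indicator {..<m} y * (airy' (x - y) * V y)\<bar> \<le> 2 * K * root4 x * \<bar>V y\<bar>" for y
    proof (cases "y < m")
      case True
      have "\<bar>airy' (x - y)\<bar> \<le> 2 * K * root4 x"
      proof (cases "x - y \<ge> 0")
        case True
        then have "\<bar>airy' (x - y)\<bar> \<le> K / (1 + (x - y)\<^sup>2)" by (rule airy'_decay)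
        also have "\<dots> \<le> K / 1" using K by (intro divide_left_mono) (auto simp: add_pos_nonneg)
        also have "\<dots> \<le> 2 * K * root4 x" using K root4_ge_1[of x] mult_mono[of K "2 * K" 1 "root4 x"] by simp
        finally show ?thesis .
      next
        case False
        then have "root4 (x - y) \<le> 2 * root4 x"
          using True by (intro root4_le_2) (simp add: m_def)
        then show ?thesis
          using order_trans[OF airy'_le mult_left_mono[of "root4 (x - y)" "2 * root4 x" K]] K
          by (simp add: mult.assoc mult.left_commute[of K 2])
      qed
      then show ?thesis using True by (simp add: abs_mult mult_right_mono)
    qed (use K root4_ge_1[of x] in simp)
  qed (use K root4_ge_1[of x] in simp_all)
  moreover have "\<bar>\<integral>y. indicator {m..} y * (airy' (x - y) * V y) \<partial>lborel\<bar> \<le> 11 * K * root4 x"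
  proof -
    have "11 * K / sqrt m \<le> 11 * K / 1" using K by (intro divide_left_mono) (auto simp: m_def)
    also have "\<dots> \<le> 11 * K * root4 x" using K root4_ge_1[of x] by simp
    finally show ?thesis using airy'_tail_bound[of m x] by (simp add: m_def)
  qed
  moreover have "K * (2 * N + 11) * root4 x = 2 * K * root4 x * N + 11 * K * root4 x"
    by (simp add: algebra_simps)
  ultimately show ?thesis
    unfolding W'_def integral_split_at[OF airy'_V_int[of x], of m] by linarith
qed

lemma far_decay:
  fixes x y :: real
  assumes "x \<ge> 1" "y \<le> x / 2"
  shows "1 / (1 + (x - y)\<^sup>2) \<le> 1 / x"
proof -
  have "(x / 2)\<^sup>2 \<le> (x - y)\<^sup>2" using assms by (intro power_mono) auto
  moreover have "x \<le> 1 + (x / 2)\<^sup>2"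
    using zero_le_power2[of "x / 2 - 1"] by (simp add: power2_diff)
  ultimately have "x \<le> 1 + (x - y)\<^sup>2" by linarith
  then show ?thesis using assms by (intro divide_left_mono) auto
qed

text \<open>Sources left of x / 2 meet the decaying side of the kernel at distance at least x / 2.
  The rest is a tail starting at x / 2; the halving costs a factor sqrt 2, whence 16 instead of
  11.\<close>

lemma W'_elliptic_bound:
  assumes x: "x \<ge> 1"
  shows "\<bar>W' x\<bar> \<le> K * (N + 16) / sqrt x"
proof -
  have "\<bar>\<integral>y. indicator {..<x / 2} y * (airy' (x - y) * V y) \<partial>lborel\<bar> \<le> (K / sqrt x) * N"
  proof (rule V_weighted_bound)
    show "\<bar>indicator {..<x / 2} y * (airy' (x - y) * V y)\<bar> \<le> K / sqrt x * \<bar>V y\<bar>" for y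
    proof (cases "y < x / 2")
      case True
      have "\<bar>airy' (x - y)\<bar> \<le> K * (1 / (1 + (x - y)\<^sup>2))" using airy'_decay[of "x - y"] True x by simp
      also have "\<dots> \<le> K * (1 / x)" using K x True by (intro mult_left_mono far_decay) auto
      also have "\<dots> \<le> K * (1 / sqrt x)"
      proof -
        have "sqrt x \<le> x" using x mult_mono[of 1 x x x] by (intro real_le_lsqrt) (auto simp: power2_eq_square)
        then show ?thesis using x K by (intro mult_left_mono divide_left_mono) auto
      qed
      finally show ?thesis using True mult_right_mono[of "\<bar>airy' (x - y)\<bar>" "K / sqrt x" "\<bar>V y\<bar>"] by (simp add: abs_mult)
    qed (use K x in simp)
  qed (use K x in simp_all)
  moreover have "\<bar>\<integral>y. indicator {x / 2..} y * (airy' (x - y) * V y) \<partial>lborel\<bar> \<le> 16 * K / sqrt x"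
  proof -
    have "sqrt 2 \<le> 16 / 11" by (intro real_le_lsqrt) (auto simp: power2_eq_square)
    have "11 * K / sqrt (x / 2) = 11 * K * sqrt 2 / sqrt x" by (simp add: real_sqrt_divide)
    also have "\<dots> \<le> 11 * K * (16 / 11) / sqrt x"
      using \<open>sqrt 2 \<le> 16 / 11\<close> K x by (intro divide_right_mono mult_left_mono) auto
    finally show ?thesis using airy'_tail_bound[of "x / 2" x] x by simp
  qed
  moreover have "K * (N + 16) / sqrt x = K / sqrt x * N + 16 * K / sqrt x"
    by (simp add: algebra_simps add_divide_distrib)
  ultimately show ?thesis
    unfolding W'_def integral_split_at[OF airy'_V_int[of x], of "x / 2"] by linarith
qed

section \<open>Pointwise bounds for the convolution itself\<close>

lemma W_bound_const: "\<bar>W x\<bar> \<le> K * N"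
  unfolding W_def
  by (rule V_weighted_bound) (use K airy_le_K in \<open>auto simp: abs_mult intro: mult_right_mono\<close>)

text \<open>Cauchy-Schwarz against the indicator of the interval reduces the fourth root to the
  square root already integrated; the outcome is of order |x|^(3/4).\<close>

lemma integral_inverse_root4_le:
  assumes x: "\<bar>x\<bar> \<ge> 1"
  shows "(\<integral>y. indicator {x - \<bar>x\<bar> / 2..x + \<bar>x\<bar> / 2} y * (1 / root4 (x - y)) \<partial>lborel) \<le> 4 * \<bar>x\<bar> / root4 x"
proof -
  define a where "a = x - \<bar>x\<bar> / 2"
  define b where "b = x + \<bar>x\<bar> / 2"
  have ab: "a \<le> b" by (simp add: a_def b_def)
  have r4: "root4 z \<noteq> 0" for z using root4_ge_1[of z] by auto
  have c: "continuous_on {a..b} (\<lambda>y. 1 / root4 (x - y))"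
    using r4 by (intro continuous_intros) (auto simp: root4_def intro!: continuous_intros)
  have "\<bar>\<integral>y. indicator {a..b} y * (1 / root4 (x - y) * indicator {a..b} y) \<partial>lborel\<bar> \<le> sqrt ((4 * sqrt \<bar>x\<bar>) * \<bar>x\<bar>)"
  proof (rule cauchy_schwarz_Icc[OF c])
    show "integrable lborel (\<lambda>y. (indicator {a..b} y :: real)\<^sup>2)" "(\<integral>y. (indicator {a..b} y :: real)\<^sup>2 \<partial>lborel) \<le> \<bar>x\<bar>"
      using ab by (simp_all add: indicator_square a_def b_def)
    have "(\<integral>y. indicator {a..b} y * (1 / root4 (x - y))\<^sup>2 \<partial>lborel) =
        (\<integral>y. indicator {a..b} y * (1 / sqrt (1 + \<bar>x - y\<bar>)) \<partial>lborel)"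
      by (simp add: power_divide root4_squared)
    also have "\<dots> \<le> 4 * sqrt \<bar>x\<bar>"
      by (rule integral_inverse_sqrt_le[OF ab]) (simp_all add: a_def b_def)
    finally show "(\<integral>y. indicator {a..b} y * (1 / root4 (x - y))\<^sup>2 \<partial>lborel) \<le> 4 * sqrt \<bar>x\<bar>" .
  qed simp
  moreover have "(\<lambda>y. indicator {a..b} y * (1 / root4 (x - y) * indicator {a..b} y)) = (\<lambda>y. indicator {a..b} y * (1 / root4 (x - y)))"
    by (simp add: indicator_def fun_eq_iff)
  ultimately have "\<bar>\<integral>y. indicator {a..b} y * (1 / root4 (x - y)) \<partial>lborel\<bar> \<le> sqrt ((4 * sqrt \<bar>x\<bar>) * \<bar>x\<bar>)"
    by (simp only:)
  then have "(\<integral>y. indicator {a..b} y * (1 / root4 (x - y)) \<partial>lborel) \<le> sqrt ((4 * sqrt \<bar>x\<bar>) * \<bar>x\<bar>)"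
    by (rule abs_le_D1)
  also have "\<dots> \<le> 4 * \<bar>x\<bar> / root4 x"
  proof (rule real_le_lsqrt)
    have "sqrt (1 + \<bar>x\<bar>) \<le> sqrt (2\<^sup>2 * \<bar>x\<bar>)" using x by (intro real_sqrt_le_mono) simp
    then have s: "sqrt (1 + \<bar>x\<bar>) \<le> 2 * sqrt \<bar>x\<bar>" by (simp only: real_sqrt_mult real_sqrt_abs abs_numeral)
    have "(4 * sqrt \<bar>x\<bar> * \<bar>x\<bar>) * sqrt (1 + \<bar>x\<bar>) \<le> (4 * sqrt \<bar>x\<bar> * \<bar>x\<bar>) * (2 * sqrt \<bar>x\<bar>)"
      using s by (intro mult_left_mono) auto
    also have "\<dots> = 8 * (sqrt \<bar>x\<bar> * sqrt \<bar>x\<bar>) * \<bar>x\<bar>" by algebra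
    also have "\<dots> = 8 * \<bar>x\<bar> * \<bar>x\<bar>" by simp
    also have "\<dots> \<le> (4 * \<bar>x\<bar>)\<^sup>2" by (simp add: power2_eq_square)
    finally show "4 * sqrt \<bar>x\<bar> * \<bar>x\<bar> \<le> (4 * \<bar>x\<bar> / root4 x)\<^sup>2"
      by (simp add: power_divide root4_squared pos_le_divide_eq add_pos_nonneg)
  qed (use root4_ge_1[of x] in auto)
  finally show ?thesis by (simp add: a_def b_def)
qed

lemma W_bound: "\<bar>W x\<bar> \<le> K * (2 * N + 16) / root4 x"
proof (cases "\<bar>x\<bar> \<ge> 1")
  case False
  have "root4 x \<le> 2 * root4 0" using False by (intro root4_le_2) simp
  then have "root4 x \<le> 2" by (simp add: root4_def)
  then have "\<bar>W x\<bar> * root4 x \<le> (K * N) * 2"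
    using W_bound_const[of x] root4_ge_1[of x] K N_nonneg by (intro mult_mono) auto
  also have "\<dots> \<le> K * (2 * N + 16)" using K by (simp add: algebra_simps)
  finally show ?thesis using root4_ge_1[of x] by (simp add: pos_le_divide_eq)
next
  case True
  define A where "A = {x - \<bar>x\<bar> / 2..x + \<bar>x\<bar> / 2}"
  have r: "root4 x > 0" "\<And>z. root4 z > 0" using root4_ge_1 less_le_trans[OF zero_less_one] by blast+
  have Kr: "0 \<le> K / root4 z" for z using K less_imp_le[OF r(2)[of z]] by simp
  have le: "\<bar>airy (x - y) * V y\<bar> \<le> (2 * K / root4 x) * \<bar>V y\<bar> + (4 * K / \<bar>x\<bar>) * (indicator A y * (1 / root4 (x - y)))" for y
  proof (cases "y \<in> A")
    case True
    then have "\<bar>y\<bar> \<ge> \<bar>x\<bar> / 2" unfolding A_def by auto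
    then have "\<bar>x\<bar> / 2 * \<bar>V y\<bar> \<le> \<bar>y\<bar> * \<bar>V y\<bar>" by (intro mult_right_mono) auto
    then have V: "\<bar>V y\<bar> \<le> 4 / \<bar>x\<bar>" using V_point[of y] \<open>\<bar>x\<bar> \<ge> 1\<close> by (simp add: field_simps)
    have "\<bar>airy (x - y) * V y\<bar> \<le> K / root4 (x - y) * (4 / \<bar>x\<bar>)"
      unfolding abs_mult using Kr by (intro mult_mono airy_le V) auto
    moreover have "0 \<le> (2 * (K / root4 x)) * \<bar>V y\<bar>" using Kr[of x] by (intro mult_nonneg_nonneg) simp_all
    ultimately show ?thesis using True by (simp add: mult_ac)
  next
    case False
    then have "\<bar>x - y\<bar> \<ge> \<bar>x\<bar> / 2" unfolding A_def by auto
    then have "root4 x \<le> 2 * root4 (x - y)" by (intro root4_le_2) simp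
    then have "K / root4 (x - y) \<le> 2 * K / root4 x" using r[of ] r(2)[of "x - y"] K by (simp add: field_simps)
    then have "\<bar>airy (x - y)\<bar> \<le> 2 * K / root4 x" using airy_le[of "x - y"] by simp
    from mult_right_mono[OF this, of "\<bar>V y\<bar>"] show ?thesis using False by (simp add: abs_mult)
  qed
  have i1: "integrable lborel (\<lambda>y. (2 * K / root4 x) * \<bar>V y\<bar>)" by (intro integrable_mult_right V_int)
  have "continuous_on {x - \<bar>x\<bar> / 2..x + \<bar>x\<bar> / 2} (\<lambda>y. 1 / root4 (x - y))"
    using r(2) by (intro continuous_intros) (auto simp: root4_def intro!: continuous_intros)
  from borel_integrable_atLeastAtMost'[OF this]
  have i2: "integrable lborel (\<lambda>y. (4 * K / \<bar>x\<bar>) * (indicator A y * (1 / root4 (x - y))))"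
    unfolding A_def set_integrable_def real_scaleR_def by (rule integrable_mult_right)
  have "\<bar>W x\<bar> \<le> (\<integral>y. (2 * K / root4 x) * \<bar>V y\<bar> + (4 * K / \<bar>x\<bar>) * (indicator A y * (1 / root4 (x - y))) \<partial>lborel)"
    unfolding W_def
    by (rule abs_integral_le(2)[OF _ Bochner_Integration.integrable_add[OF i1 i2] le]) simp
  also have "\<dots> = (2 * K / root4 x) * (\<integral>y. \<bar>V y\<bar> \<partial>lborel)
      + (4 * K / \<bar>x\<bar>) * (\<integral>y. indicator A y * (1 / root4 (x - y)) \<partial>lborel)"
    unfolding Bochner_Integration.integral_add[OF i1 i2] by (simp only: integral_mult_right_zero)
  also have "\<dots> \<le> (2 * K / root4 x) * N + (4 * K / \<bar>x\<bar>) * (4 * \<bar>x\<bar> / root4 x)"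
    using K Kr[of x] True integral_inverse_root4_le[OF True] V_le
    by (intro add_mono mult_left_mono) (simp_all add: A_def)
  also have "\<dots> = K * (2 * N + 16) / root4 x" using True by (auto simp: algebra_simps add_divide_distrib)
  finally show ?thesis .
qed


text \<open>On the decaying side either the distance to x or the position y is at least x / 2. In
  the first case the kernel is at most K / x, in the second the data are at most 4 / x and the
  kernel has an integrable majorant.\<close>

lemma W_left_part:
  assumes x: "x \<ge> 1"
  shows "\<bar>\<integral>y. indicator {..<x} y * (airy (x - y) * V y) \<partial>lborel\<bar> \<le> K * (N + 16) / x"
proof -
  have le: "\<bar>indicator {..<x} y * (airy (x - y) * V y)\<bar> \<le> (K / x) * \<bar>V y\<bar> + (4 * K / x) * (1 / (1 + (x - y)\<^sup>2))" for y
  proof (cases "y < x")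
    case True
    have a: "\<bar>airy (x - y)\<bar> \<le> K * (1 / (1 + (x - y)\<^sup>2))" using airy_decay[of "x - y"] True by simp
    have nn: "0 \<le> (K / x) * \<bar>V y\<bar>" "0 \<le> (4 * K / x) * (1 / (1 + (x - y)\<^sup>2))"
      using K x by (auto intro!: mult_nonneg_nonneg divide_nonneg_nonneg add_nonneg_nonneg)
    have "\<bar>airy (x - y) * V y\<bar> \<le> (K / x) * \<bar>V y\<bar> + (4 * K / x) * (1 / (1 + (x - y)\<^sup>2))"
    proof (cases "y \<le> x / 2")
      case True
      have "\<bar>airy (x - y)\<bar> \<le> K * (1 / x)"
        using K x True by (intro order_trans[OF a] mult_left_mono far_decay) auto
      from mult_right_mono[OF this, of "\<bar>V y\<bar>"] show ?thesis using nn by (simp add: abs_mult)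
    next
      case False
      then have "\<bar>V y\<bar> \<le> 2 / y" using x by (intro V_div) simp
      also have "\<dots> \<le> 2 / (x / 2)" using False x by (intro divide_left_mono) auto
      finally have "\<bar>V y\<bar> \<le> 4 / x" by simp
      then have "\<bar>airy (x - y) * V y\<bar> \<le> (K * (1 / (1 + (x - y)\<^sup>2))) * (4 / x)"
        unfolding abs_mult using a K by (intro mult_mono) (auto simp: add_nonneg_nonneg)
      then show ?thesis using nn by (simp add: mult_ac)
    qed
    then show ?thesis using True by simp
  next
    case False
    then show ?thesis using K x by (simp add: add_nonneg_nonneg)
  qed
  have i1: "integrable lborel (\<lambda>y. (K / x) * \<bar>V y\<bar>)" by (intro integrable_mult_right V_int)
  have i2: "integrable lborel (\<lambda>y. (4 * K / x) * (1 / (1 + (x - y)\<^sup>2)))" by (intro integrable_mult_right integrable_inverse_quadratic)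
  have "\<bar>\<integral>y. indicator {..<x} y * (airy (x - y) * V y) \<partial>lborel\<bar> \<le>
      (\<integral>y. (K / x) * \<bar>V y\<bar> + (4 * K / x) * (1 / (1 + (x - y)\<^sup>2)) \<partial>lborel)"
    by (rule abs_integral_le(2)[OF _ Bochner_Integration.integrable_add[OF i1 i2] le]) simp
  also have "\<dots> = (K / x) * (\<integral>y. \<bar>V y\<bar> \<partial>lborel) + (4 * K / x) * pi"
    unfolding Bochner_Integration.integral_add[OF i1 i2] integral_mult_right_zero integrable_inverse_quadratic(2) ..
  also have "\<dots> \<le> (K / x) * N + (4 * K / x) * 4"
    using K x V_le pi_less_4 by (intro add_mono mult_left_mono) auto
  also have "\<dots> = K * (N + 16) / x" by (simp add: algebra_simps add_divide_distrib)
  finally show ?thesis .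
qed

text \<open>Here the two bounds agree at distance \<open>T\<^sup>2 * x ^ 4\<close> from \<open>x\<close>. In \<open>W_far_part\<close> the kernel is integrated via
  \<open>airy z = 3 * airy'' z / z\<close>.\<close>

lemma W_near_part:
  assumes x: "x \<ge> 1" and \<rho>: "\<rho> = max 1 (T\<^sup>2 * x ^ 4)"
  shows "\<bar>\<integral>y. indicator {x..x + \<rho>} y * (airy (x - y) * V y) \<partial>lborel\<bar> \<le> 2 * K / x"
proof (cases "T\<^sup>2 * x ^ 4 \<ge> 1")
  \<comment> \<open>If the crossover lies within distance 1 of x, the interval has length 1 and the
    pointwise bound 2 / x on the data is enough.\<close>
  case False
  then have \<rho>1: "\<rho> = 1" using \<rho> by simp
  have "\<bar>\<integral>y. indicator {x..x + 1} y * (airy (x - y) * V y) \<partial>lborel\<bar> \<le> (\<integral>y. (2 * K / x) * indicator {x..x + 1} y \<partial>lborel)"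
  proof (rule abs_integral_le(2))
    show "\<bar>indicator {x..x + 1} y * (airy (x - y) * V y)\<bar> \<le> (2 * K / x) * indicator {x..x + 1} y" for y
    proof (cases "y \<in> {x..x + 1}")
      case True
      then have "\<bar>V y\<bar> \<le> 2 / y" using x by (intro V_div) simp
      also have "\<dots> \<le> 2 / x" using True x by (intro divide_left_mono) auto
      finally have "\<bar>airy (x - y) * V y\<bar> \<le> K * (2 / x)"
        unfolding abs_mult using K by (intro mult_mono airy_le_K) auto
      then show ?thesis using True by (simp add: mult.commute)
    qed simp
  qed (auto simp: emeasure_lborel_Icc_eq)
  then show ?thesis using \<rho>1 by simp
next
  case True
  then have \<rho>e: "\<rho> = T\<^sup>2 * x ^ 4" using \<rho> by simp
  have \<rho>pos: "\<rho> > 0" using \<rho>e True by simp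
  define k where "k y = airy (x - y) / y\<^sup>2" for y
  have kc: "continuous_on {x..x + \<rho>} k"
    unfolding k_def using x
    by (intro continuous_intros continuous_on_compose2[OF airy_continuous(1)[of UNIV]]) auto
  have int: "(\<integral>y. indicator {x..x + \<rho>} y * (k y)\<^sup>2 \<partial>lborel) \<le> K\<^sup>2 / x ^ 4 * (4 * sqrt \<rho>)"
  proof -
    have c: "continuous_on {x..x + \<rho>} (\<lambda>y. 1 / sqrt (1 + \<bar>x - y\<bar>))"
      by (intro continuous_intros) (auto simp: add_nonneg_eq_0_iff)
    have "(\<integral>y. indicator {x..x + \<rho>} y * (k y)\<^sup>2 \<partial>lborel) \<le>
        (\<integral>y. K\<^sup>2 / x ^ 4 * (indicator {x..x + \<rho>} y * (1 / sqrt (1 + \<bar>x - y\<bar>))) \<partial>lborel)"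
    proof (rule integral_mono)
      show "integrable lborel (\<lambda>y. indicator {x..x + \<rho>} y * (k y)\<^sup>2)"
        using borel_integrable_atLeastAtMost'[OF continuous_on_power[OF kc, of 2]] by (simp add: set_integrable_def)
      from borel_integrable_atLeastAtMost'[OF c]
      show "integrable lborel (\<lambda>y. K\<^sup>2 / x ^ 4 * (indicator {x..x + \<rho>} y * (1 / sqrt (1 + \<bar>x - y\<bar>))))"
        by (intro integrable_mult_right) (simp add: set_integrable_def)
      show "indicator {x..x + \<rho>} y * (k y)\<^sup>2 \<le> K\<^sup>2 / x ^ 4 * (indicator {x..x + \<rho>} y * (1 / sqrt (1 + \<bar>x - y\<bar>)))" for y
      proof (cases "y \<in> {x..x + \<rho>}")
        case y: True
        have "x ^ 4 \<le> y ^ 4" using y x by (intro power_mono) auto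
        then have "(airy (x - y))\<^sup>2 / y ^ 4 \<le> (K\<^sup>2 * (1 / sqrt (1 + \<bar>x - y\<bar>))) / x ^ 4"
          using x by (intro frac_le airy_sq_le) auto
        moreover have "(k y)\<^sup>2 = (airy (x - y))\<^sup>2 / y ^ 4"
          by (simp add: k_def power_divide)
        ultimately show ?thesis using y by (simp add: mult.commute)
      qed simp
    qed
    also have "\<dots> = K\<^sup>2 / x ^ 4 * (\<integral>y. indicator {x..x + \<rho>} y * (1 / sqrt (1 + \<bar>x - y\<bar>)) \<partial>lborel)"
      by (rule integral_mult_right_zero)
    also have "\<dots> \<le> K\<^sup>2 / x ^ 4 * (4 * sqrt \<rho>)"
      using \<rho>pos x by (intro mult_left_mono integral_inverse_sqrt_le) auto
    finally show ?thesis .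
  qed
  have "\<bar>\<integral>y. indicator {x..x + \<rho>} y * (k y * (y\<^sup>2 * V y)) \<partial>lborel\<bar> \<le> sqrt (K\<^sup>2 / x ^ 4 * (4 * sqrt \<rho>) * (1 / T))"
    by (rule cauchy_schwarz_Icc[OF kc _ V2_int V2_le int]) simp
  also have "(\<lambda>y. indicator {x..x + \<rho>} y * (k y * (y\<^sup>2 * V y))) = (\<lambda>y. indicator {x..x + \<rho>} y * (airy (x - y) * V y))"
    using x by (auto simp: k_def indicator_def)
  also have "sqrt (K\<^sup>2 / x ^ 4 * (4 * sqrt \<rho>) * (1 / T)) = 2 * K / x"
  proof -
    have "\<rho> = (T * x\<^sup>2)\<^sup>2" unfolding \<rho>e by (simp add: power_mult_distrib)
    \<comment> \<open>The squared kernel contributes sqrt \<rho> = T x^2, which cancels the 1 / T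
      from the weighted norm.\<close>
    then have "sqrt \<rho> = T * x\<^sup>2" using T by (simp add: real_sqrt_abs2)
    then have "K\<^sup>2 / x ^ 4 * (4 * sqrt \<rho>) * (1 / T) = (2 * K / x)\<^sup>2"
      using T x by (simp add: power_divide power_mult_distrib field_simps eval_nat_numeral)
    then show ?thesis using K x by simp
  qed
  finally show ?thesis .
qed

lemma W_far_part:
  assumes x: "x \<ge> 1" and \<rho>: "\<rho> = max 1 (T\<^sup>2 * x ^ 4)" and n: "n \<ge> x + \<rho>"
  shows "\<bar>\<integral>y. indicator {x + \<rho>..n} y * (airy (x - y) * V y) \<partial>lborel\<bar> \<le> 57 * K / x"
proof -
  have \<rho>1: "\<rho> \<ge> 1" using \<rho> by simp
  define a where "a = x + \<rho>"
  have a: "a \<le> n" "a \<ge> x + 1" using n \<rho>1 by (simp_all add: a_def)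
  have V_x: "\<bar>V y\<bar> \<le> 2 / x" if "y \<ge> a" for y
  proof -
    have "\<bar>V y\<bar> \<le> 2 / y" using that a x by (intro V_div) simp
    also have "\<dots> \<le> 2 / x" using that a x by (intro divide_left_mono) auto
    finally show ?thesis .
  qed
  have r_le: "root4 (x - y) \<le> 2 * sqrt (y - x)" if "y \<ge> a" for y
  proof -
    have "root4 (x - y) \<le> sqrt (1 + \<bar>x - y\<bar>)"
    proof -
      have "sqrt p \<le> p" if "p \<ge> 1" for p
        using that mult_mono[of 1 p p p] by (intro real_le_lsqrt) (auto simp: power2_eq_square)
      then show ?thesis unfolding root4_def by (intro real_sqrt_le_mono) simp
    qed
    also have "\<dots> \<le> sqrt (2\<^sup>2 * (y - x))" using that a by (intro real_sqrt_le_mono) simp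
    also have "\<dots> = 2 * sqrt (y - x)" by (simp only: real_sqrt_mult real_sqrt_abs abs_numeral)
    finally show ?thesis .
  qed
  have A'_le: "\<bar>airy' (x - y)\<bar> \<le> 2 * K * sqrt (y - x)" if "y \<ge> a" for y
    using order_trans[OF airy'_le mult_left_mono[OF r_le[OF that]]] K by simp
  \<comment> \<open>By the Airy equation the y-derivative of \<open>f\<close> is the kernel minus
    \<open>g\<close>, a term with one more power of the distance in the denominator. The cut-off at
    distance 1 in \<rho> keeps both away from the zero of x - y.\<close>
  define f where "f y = - 3 * (airy' (x - y) / (x - y))" for y
  define g where "g y = 3 * (airy' (x - y) / (x - y)\<^sup>2)" for y
  have f_deriv: "(f has_real_derivative airy (x - y) - g y) (at y)" if "a \<le> y" "y \<le> n" for y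
  proof -
    have nz: "x - y \<noteq> 0" using that a by simp
    have d: "((\<lambda>y. airy' (x - y)) has_real_derivative ((x - y) * airy (x - y) / 3) * - 1) (at y)"
      by (rule DERIV_chain2[OF airy'_deriv]) (auto intro!: derivative_eq_intros)
    have "((\<lambda>y. airy' (x - y) / (x - y)) has_real_derivative
        (((x - y) * airy (x - y) / 3 * - 1) * (x - y) - airy' (x - y) * (- 1)) / ((x - y) * (x - y))) (at y)"
      using nz by (intro DERIV_divide d) (auto intro!: derivative_eq_intros)
    from DERIV_cmult[OF this, of "- 3"] show ?thesis
      unfolding f_def[abs_def] g_def
      by (rule DERIV_cong) (use nz in \<open>simp add: divide_simps power2_eq_square\<close>)
  qed
  have nz: "x - y \<noteq> 0" if "y \<in> {a..n}" for y using that a by simp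
  have fc: "continuous_on {a..n} f" "continuous_on {a..n} g"
    unfolding f_def g_def using nz
    by (intro continuous_intros continuous_on_compose2[OF airy_continuous(2)[of UNIV]]; auto)+
  have airy_c: "continuous_on {a..n} (\<lambda>y. airy (x - y))"
    by (intro continuous_intros continuous_on_compose2[OF airy_continuous(1)[of UNIV]]) auto
  have parts: "(\<integral>y. indicator {a..n} y * (V y * (airy (x - y) - g y)) \<partial>lborel) =
      V n * f n - V a * f a - (\<integral>y. indicator {a..n} y * (G y * f y) \<partial>lborel)"
    by (rule primitive_integration_by_parts[OF prim G_meas G_int a(1) f_deriv])
      (assumption, assumption, intro continuous_on_diff airy_c fc)
  have gi: "integrable lborel (\<lambda>y. indicator {a..n} y * (g y * V y))"
    using borel_integrable_atLeastAtMost'[OF continuous_on_mult[OF fc(2) V_cont]]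
    by (simp add: set_integrable_def)
  have split: "(\<integral>y. indicator {a..n} y * (airy (x - y) * V y) \<partial>lborel) =
      (\<integral>y. indicator {a..n} y * (V y * (airy (x - y) - g y)) \<partial>lborel) + (\<integral>y. indicator {a..n} y * (g y * V y) \<partial>lborel)"
  proof -
    have "(\<lambda>y. indicator {a..n} y * (V y * (airy (x - y) - g y))) =
        (\<lambda>y. indicator {a..n} y * (airy (x - y) * V y) - indicator {a..n} y * (g y * V y))"
      by (simp add: algebra_simps)
    then show ?thesis
      using ind_int[OF airy_V_int, of a n x] gi by (simp only: Bochner_Integration.integral_diff diff_add_cancel)
  qed
  have f_le: "\<bar>f y\<bar> \<le> 6 * K" if "y \<ge> a" for y
  proof -
    have yx: "y - x \<ge> 1" using that a by simp
    have "sqrt (y - x) \<le> y - x" using yx mult_mono[of 1 "y - x" "y - x" "y - x"]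
      by (intro real_le_lsqrt) (auto simp: power2_eq_square)
    then have "2 * K * sqrt (y - x) \<le> 2 * K * (y - x)" using K by (intro mult_left_mono) auto
    then have "\<bar>airy' (x - y)\<bar> \<le> 2 * K * (y - x)" using A'_le[OF that] by linarith
    then have "\<bar>airy' (x - y)\<bar> / (y - x) \<le> 2 * K" using yx by (simp add: pos_divide_le_eq)
    then show ?thesis using yx by (simp add: f_def abs_mult abs_minus_commute)
  qed
  have bdry: "\<bar>V y * f y\<bar> \<le> 12 * K / x" if "y \<ge> a" for y
  proof -
    have "\<bar>V y * f y\<bar> \<le> (2 / x) * (6 * K)"
      unfolding abs_mult using V_x[OF that] f_le[OF that] x by (intro mult_mono) auto
    then show ?thesis by (simp add: mult.commute)
  qed
  define H where "H y = - (2 / sqrt (y - x))" for y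
  have H_eq: "H = (\<lambda>y. - 2 * inverse (sqrt (y - x)))" by (simp add: H_def fun_eq_iff divide_inverse)
  define h where "h y = 1 / ((y - x) * sqrt (y - x))" for y
  have dH: "(H has_real_derivative h y) (at y)" if "a \<le> y" "y \<le> n" for y
  proof -
    have yx: "y - x > 0" using that a by simp
    have "((\<lambda>y. sqrt (y - x)) has_real_derivative inverse (sqrt (y - x)) / 2 * 1) (at y)"
      by (rule DERIV_chain2[where f = sqrt and g = "\<lambda>y. y - x", OF DERIV_real_sqrt[OF yx]]) (auto intro!: derivative_eq_intros)
    then have "((\<lambda>y. inverse (sqrt (y - x))) has_real_derivative
        - (inverse (sqrt (y - x)) * (inverse (sqrt (y - x)) / 2 * 1) * inverse (sqrt (y - x)))) (at y)"
      using yx by (intro DERIV_inverse') auto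
    from DERIV_cmult[OF this, of "- 2"] have
      "(H has_real_derivative - 2 * - (inverse (sqrt (y - x)) * (inverse (sqrt (y - x)) / 2 * 1) * inverse (sqrt (y - x)))) (at y)"
      unfolding H_eq .
    moreover have "- 2 * - (inverse s * (inverse s / 2 * 1) * inverse s) = 1 / ((s * s) * s)" for s :: real
      by (simp add: field_simps)
    from this[of "sqrt (y - x)"] have
      "- 2 * - (inverse (sqrt (y - x)) * (inverse (sqrt (y - x)) / 2 * 1) * inverse (sqrt (y - x))) = h y"
      using yx by (simp only: h_def real_sqrt_mult_self abs_of_pos)
    ultimately show ?thesis by (simp only:)
  qed
  have hc: "continuous_on {a..n} h"
    unfolding h_def using a by (intro continuous_intros) auto
  have H_diff: "H n - H a \<le> 2 / sqrt \<rho>"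
    using a(1) \<rho>1 unfolding H_def a_def by simp
  \<comment> \<open>\<open>airy'\<close> grows like the fourth root, so the square of
    \<open>f\<close> is of order (y - x)^(-3/2), which is integrable at infinity; the tail from
    \<rho> on gives 2 / sqrt \<rho>.\<close>
  have int_f: "(\<integral>y. indicator {a..n} y * (f y)\<^sup>2 \<partial>lborel) \<le> 36 * K\<^sup>2 * (2 / sqrt \<rho>)"
  proof -
    have "(\<integral>y. indicator {a..n} y * (f y)\<^sup>2 \<partial>lborel) \<le> 36 * K\<^sup>2 * H n - 36 * K\<^sup>2 * H a"
    proof (rule integral_Icc_le_antiderivative[where h = "\<lambda>y. 36 * K\<^sup>2 * h y"])
      show "((\<lambda>y. 36 * K\<^sup>2 * H y) has_real_derivative 36 * K\<^sup>2 * h y) (at y)" if "a \<le> y" "y \<le> n" for y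
        by (rule DERIV_cmult[OF dH[OF that]])
      show "(f y)\<^sup>2 \<le> 36 * K\<^sup>2 * h y" if "a \<le> y" for y
      proof -
        have yx: "y - x \<ge> 1" using that a by simp
        have "root4 (x - y) ^ 2 \<le> 2 * sqrt (y - x)"
        proof -
          have "sqrt (1 + \<bar>x - y\<bar>) \<le> sqrt (2\<^sup>2 * (y - x))" using yx by (intro real_sqrt_le_mono) simp
          then show ?thesis by (simp only: root4_squared real_sqrt_mult real_sqrt_abs abs_numeral)
        qed
        then have sq: "(airy' (x - y))\<^sup>2 \<le> K\<^sup>2 * (2 * sqrt (y - x))"
          by (intro order_trans[OF airy'_sq_le] mult_left_mono) (simp_all add: root4_squared)
        have "9 * (airy' (x - y))\<^sup>2 / (y - x)\<^sup>2 \<le> 9 * (K\<^sup>2 * (4 * sqrt (y - x))) / (y - x)\<^sup>2"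
        proof (rule divide_right_mono)
          have "0 \<le> K\<^sup>2 * sqrt (y - x)" using yx by simp
          then show "9 * (airy' (x - y))\<^sup>2 \<le> 9 * (K\<^sup>2 * (4 * sqrt (y - x)))"
            using sq mult.left_commute[of "K\<^sup>2" 2 "sqrt (y - x)"] mult.left_commute[of "K\<^sup>2" 4 "sqrt (y - x)"]
            by linarith
        qed simp
        moreover have "sqrt (y - x) / (y - x)\<^sup>2 = h y"
        proof -
          have "sqrt (y - x) * ((y - x) * sqrt (y - x)) = (y - x) * (sqrt (y - x) * sqrt (y - x))" by (simp only: mult_ac)
          also have "\<dots> = (y - x)\<^sup>2" using yx by (simp add: power2_eq_square)
          finally show ?thesis using yx by (simp add: h_def frac_eq_eq)
        qed
        moreover have "(f y)\<^sup>2 = 9 * (airy' (x - y))\<^sup>2 / (y - x)\<^sup>2"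
          by (simp add: f_def power_mult_distrib power_divide power2_commute[of x y])
        moreover have "9 * (K\<^sup>2 * (4 * sqrt (y - x))) / (y - x)\<^sup>2 = 36 * K\<^sup>2 * (sqrt (y - x) / (y - x)\<^sup>2)"
          by simp
        ultimately show ?thesis by (simp only:)
      qed
      show "continuous_on {a..n} (\<lambda>y. (f y)\<^sup>2)" "continuous_on {a..n} (\<lambda>y. 36 * K\<^sup>2 * h y)"
        by (intro continuous_on_power continuous_on_mult continuous_on_const fc hc)+
    qed (rule a)
    also have "\<dots> = 36 * K\<^sup>2 * (H n - H a)" by (simp only: right_diff_distrib)
    also have "\<dots> \<le> 36 * K\<^sup>2 * (2 / sqrt \<rho>)" by (intro mult_left_mono H_diff) simp
    finally show ?thesis .
  qed
  have Gf: "\<bar>\<integral>y. indicator {a..n} y * (f y * G y) \<partial>lborel\<bar> \<le> 9 * K / x"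
  proof -
    have "\<bar>\<integral>y. indicator {a..n} y * (f y * G y) \<partial>lborel\<bar> \<le> sqrt (36 * K\<^sup>2 * (2 / sqrt \<rho>) * T)"
      by (rule cauchy_schwarz_Icc[OF fc(1) G_meas G_int G_le int_f])
    also have "\<dots> \<le> 9 * K / x"
    proof (rule real_le_lsqrt)
      \<comment> \<open>The choice of \<rho> balances the factor T from the norm of
        \<open>G\<close>; 72 is then rounded up to the square 81.\<close>
      have "T * x\<^sup>2 \<le> sqrt \<rho>"
        by (rule real_le_rsqrt) (simp add: \<rho> power_mult_distrib)
      then have "72 * K\<^sup>2 * (T * x\<^sup>2) \<le> 81 * K\<^sup>2 * sqrt \<rho>"
        using T by (intro mult_mono) auto
      then show "36 * K\<^sup>2 * (2 / sqrt \<rho>) * T \<le> (9 * K / x)\<^sup>2"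
        using x \<rho>1 by (simp add: power_divide power_mult_distrib field_simps)
    qed (use K x T \<rho>1 in auto)
    finally show ?thesis .
  qed
  have gV: "\<bar>\<integral>y. indicator {a..n} y * (g y * V y) \<partial>lborel\<bar> \<le> 24 * K / x"
  proof -
    have le: "\<bar>indicator {a..n} y * (g y * V y)\<bar> \<le> indicator {a..n} y * (12 * K / x * h y)" for y
    proof (cases "y \<in> {a..n}")
      case True
      then have ya: "y \<ge> a" by simp
      have yx: "y - x > 0" using ya a by simp
      have "\<bar>g y\<bar> = 3 * \<bar>airy' (x - y)\<bar> / (y - x)\<^sup>2"
        by (simp add: g_def abs_mult power2_commute[of x y])
      also have "\<dots> \<le> 3 * (2 * K * sqrt (y - x)) / (y - x)\<^sup>2"
        by (intro divide_right_mono mult_left_mono A'_le ya) auto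
      also have "\<dots> = 6 * K * h y"
      proof -
        have "sqrt (y - x) * ((y - x) * sqrt (y - x)) = (y - x) * (sqrt (y - x) * sqrt (y - x))" by (simp only: mult_ac)
        also have "\<dots> = (y - x)\<^sup>2" using yx by (simp add: power2_eq_square)
        finally have "sqrt (y - x) / (y - x)\<^sup>2 = h y" using yx by (simp add: h_def frac_eq_eq)
        moreover have "3 * (2 * K * sqrt (y - x)) / (y - x)\<^sup>2 = 6 * K * (sqrt (y - x) / (y - x)\<^sup>2)"
          by simp
        ultimately show ?thesis by (simp only:)
      qed
      finally have "\<bar>g y\<bar> * \<bar>V y\<bar> \<le> (6 * K * h y) * (2 / x)"
        by (rule mult_mono[OF _ V_x[OF ya]]) (use K yx in \<open>simp_all add: h_def\<close>)
      also have "\<dots> = 12 * K / x * h y" by simp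
      finally show ?thesis using True by (simp only: indicator_simps mult_1_left abs_mult)
    next
      case False
      then have "indicator {a..n} y = (0 :: real)" by simp
      then show ?thesis by (simp only: mult_zero_left abs_zero order_refl)
    qed
    have hci: "continuous_on {a..n} (\<lambda>y. 12 * K / x * h y)" by (intro continuous_intros hc)
    have "\<bar>\<integral>y. indicator {a..n} y * (g y * V y) \<partial>lborel\<bar> \<le> (\<integral>y. indicator {a..n} y * (12 * K / x * h y) \<partial>lborel)"
      by (rule abs_integral_le(2)[OF borel_measurable_integrable[OF gi] _ le])
        (use borel_integrable_atLeastAtMost'[OF hci] in \<open>simp only: set_integrable_def real_scaleR_def\<close>)
    also have "\<dots> \<le> 12 * K / x * H n - 12 * K / x * H a"
      by (rule integral_Icc_le_antiderivative[OF a(1) hci hci DERIV_cmult[OF dH]]) (assumption | rule order_refl)+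
    also have "\<dots> = 12 * K / x * (H n - H a)" by (simp only: right_diff_distrib)
    also have "\<dots> \<le> 12 * K / x * 2"
    proof -
      have "2 / sqrt \<rho> \<le> 2 / 1" using \<rho>1 by (intro divide_left_mono) auto
      then have "H n - H a \<le> 2" using H_diff by linarith
      moreover have "0 \<le> 12 * K / x" using K x by simp
      ultimately show ?thesis by (rule mult_left_mono)
    qed
    also have "\<dots> = 24 * K / x" by simp
    finally show ?thesis .
  qed
  have "(\<integral>y. indicator {a..n} y * (G y * f y) \<partial>lborel) = (\<integral>y. indicator {a..n} y * (f y * G y) \<partial>lborel)"
    by (simp only: mult.commute[of "G _"])
  then have "\<bar>\<integral>y. indicator {a..n} y * (airy (x - y) * V y) \<partial>lborel\<bar> \<le>
      12 * K / x + 12 * K / x + 9 * K / x + 24 * K / x"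
    unfolding split parts using bdry[OF a(1)] bdry[OF order_refl] Gf gV by linarith
  also have "\<dots> = 57 * K / x" by simp
  finally show ?thesis by (simp only: a_def)
qed

lemma W_elliptic_bound:
  assumes x: "x \<ge> 1"
  shows "\<bar>W x\<bar> \<le> K * (N + 75) / x"
proof -
  define \<rho> where "\<rho> = max 1 (T\<^sup>2 * x ^ 4)"
  have \<rho>1: "\<rho> \<ge> 1" by (simp add: \<rho>_def)
  have "\<bar>\<integral>y. indicator {x..n} y * (airy (x - y) * V y) \<partial>lborel\<bar> \<le> 59 * K / x" if n: "n \<ge> x + \<rho>" for n
  proof -
    have "x \<le> x + \<rho>" using \<rho>1 by simp
    from integral_Icc_split[OF this n ind_int[OF airy_V_int[of x]]] show ?thesis
      using W_near_part[OF x \<rho>_def] W_far_part[OF x \<rho>_def n] by linarith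
  qed
  then have "\<bar>\<integral>y. indicator {x..} y * (airy (x - y) * V y) \<partial>lborel\<bar> \<le> 59 * K / x"
    by (rule integral_atLeast_bound[OF airy_V_int])
  moreover have "K * (N + 75) / x = K * (N + 16) / x + 59 * K / x"
    by (simp add: algebra_simps add_divide_distrib)
  ultimately show ?thesis
    unfolding W_def integral_split_at[OF airy_V_int[of x], of x] using W_left_part[OF x] by linarith
qed

end

section \<open>The space of square integrable functions\<close>

lemma borel_measurable_lebesgueI:
  "f \<in> borel_measurable borel \<Longrightarrow> f \<in> borel_measurable lebesgue" for f :: "real \<Rightarrow> real"
  by (rule measurable_completion) simp

lemma continuous_lebesgue_measurable:
  "continuous_on UNIV f \<Longrightarrow> f \<in> borel_measurable lebesgue" for f :: "real \<Rightarrow> real"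
  by (intro borel_measurable_lebesgueI borel_measurable_continuous_onI)

lemma square_integrable_diff:
  assumes "square_integrable f" "square_integrable g"
  shows "square_integrable (\<lambda>x. f x - g x)"
  unfolding square_integrable_def
proof
  show m: "(\<lambda>x. f x - g x) \<in> borel_measurable lebesgue"
    using assms by (auto simp: square_integrable_def)
  show "integrable lebesgue (\<lambda>x. (f x - g x)\<^sup>2)"
  proof (rule abs_integral_le(1))
    show "integrable lebesgue (\<lambda>x. 2 * (f x)\<^sup>2 + 2 * (g x)\<^sup>2)"
      using assms by (simp add: square_integrable_def)
    show "\<bar>(f x - g x)\<^sup>2\<bar> \<le> 2 * (f x)\<^sup>2 + 2 * (g x)\<^sup>2" for x
    proof -
      have "(f x - g x)\<^sup>2 + (f x + g x)\<^sup>2 = 2 * (f x)\<^sup>2 + 2 * (g x)\<^sup>2"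
        by (simp add: power2_sum power2_diff)
      then show ?thesis using zero_le_power2[of "f x + g x"] zero_le_power2[of "f x - g x"] by linarith
    qed
  qed (use m in measurable)
qed

lemma square_integrable_cmult:
  "square_integrable f \<Longrightarrow> square_integrable (\<lambda>x. c * f x)"
  by (auto simp: square_integrable_def power_mult_distrib)

lemma L2_norm_nonneg: "L2_norm f \<ge> 0"
  by (simp add: L2_norm_def)

lemma L2_norm_squared: "(L2_norm f)\<^sup>2 = (\<integral>x. (f x)\<^sup>2 \<partial>lebesgue)"
  by (simp add: L2_norm_def)

lemma L2_pairing:
  assumes "square_integrable f" "square_integrable g"
  shows "integrable lebesgue (\<lambda>x. f x * g x)"
    and "\<bar>\<integral>x. f x * g x \<partial>lebesgue\<bar> \<le> L2_norm f * L2_norm g"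
proof -
  note cs = cauchy_schwarz_integral[of f lebesgue g]
  show "integrable lebesgue (\<lambda>x. f x * g x)"
    using assms by (intro cs) (auto simp: square_integrable_def)
  have "(\<integral>x. f x * g x \<partial>lebesgue)\<^sup>2 \<le> (L2_norm f)\<^sup>2 * (L2_norm g)\<^sup>2"
    unfolding L2_norm_squared using assms by (intro cs) (auto simp: square_integrable_def)
  then have "\<bar>\<integral>x. f x * g x \<partial>lebesgue\<bar>\<^sup>2 \<le> (L2_norm f * L2_norm g)\<^sup>2"
    by (simp add: power_mult_distrib)
  then show "\<bar>\<integral>x. f x * g x \<partial>lebesgue\<bar> \<le> L2_norm f * L2_norm g"
    by (rule power2_le_imp_le) (simp add: L2_norm_nonneg)
qed

lemma L2_norm_triangle:
  assumes "square_integrable f" "square_integrable g"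
  shows "L2_norm f \<le> L2_norm (\<lambda>x. f x - g x) + L2_norm g"
proof (rule power2_le_imp_le)
  let ?d = "\<lambda>x. f x - g x"
  note d = square_integrable_diff[OF assms]
  have "(L2_norm f)\<^sup>2 = (\<integral>x. (?d x)\<^sup>2 + (g x)\<^sup>2 + 2 * (?d x * g x) \<partial>lebesgue)"
    unfolding L2_norm_squared
    by (rule Bochner_Integration.integral_cong) (simp_all add: power2_eq_square algebra_simps)
  also have "\<dots> = (L2_norm ?d)\<^sup>2 + (L2_norm g)\<^sup>2 + 2 * (\<integral>x. ?d x * g x \<partial>lebesgue)"
    unfolding L2_norm_squared using d assms(2) L2_pairing(1)[OF d assms(2)]
    by (simp add: square_integrable_def)
  also have "\<dots> \<le> (L2_norm ?d)\<^sup>2 + (L2_norm g)\<^sup>2 + 2 * (L2_norm ?d * L2_norm g)"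
    using L2_pairing(2)[OF d assms(2)] by simp
  also have "\<dots> = (L2_norm ?d + L2_norm g)\<^sup>2" by (simp add: power2_sum)
  finally show "(L2_norm f)\<^sup>2 \<le> (L2_norm ?d + L2_norm g)\<^sup>2" .
qed (simp add: L2_norm_nonneg)

text \<open>Joint continuity of the pairing, from fg - f0 g0 = (f - f0)(g - g0) + (f - f0) g0 + f0
  (g - g0). Square integrability is required only eventually, because solutions live on t >=
  0.\<close>

lemma L2_pairing_tendsto:
  assumes f: "eventually (\<lambda>r. square_integrable (f r)) F" "square_integrable f0"
    and g: "eventually (\<lambda>r. square_integrable (g r)) F" "square_integrable g0"
    and fl: "((\<lambda>r. L2_norm (\<lambda>x. f r x - f0 x)) \<longlongrightarrow> 0) F"
    and gl: "((\<lambda>r. L2_norm (\<lambda>x. g r x - g0 x)) \<longlongrightarrow> 0) F"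
  shows "((\<lambda>r. \<integral>x. f r x * g r x \<partial>lebesgue) \<longlongrightarrow> (\<integral>x. f0 x * g0 x \<partial>lebesgue)) F"
proof -
  let ?a = "\<lambda>r. L2_norm (\<lambda>x. f r x - f0 x)" and ?b = "\<lambda>r. L2_norm (\<lambda>x. g r x - g0 x)"
  have "((\<lambda>r. ?a r * ?b r + ?a r * L2_norm g0 + L2_norm f0 * ?b r) \<longlongrightarrow>
      0 * 0 + 0 * L2_norm g0 + L2_norm f0 * 0) F"
    by (intro tendsto_intros fl gl)
  then have lim: "((\<lambda>r. ?a r * ?b r + ?a r * L2_norm g0 + L2_norm f0 * ?b r) \<longlongrightarrow> 0) F" by simp
  have "((\<lambda>r. (\<integral>x. f r x * g r x \<partial>lebesgue) - (\<integral>x. f0 x * g0 x \<partial>lebesgue)) \<longlongrightarrow> 0) F"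
  proof (rule Lim_null_comparison[OF _ lim])
    show "eventually (\<lambda>r. norm ((\<integral>x. f r x * g r x \<partial>lebesgue) - (\<integral>x. f0 x * g0 x \<partial>lebesgue)) \<le>
        ?a r * ?b r + ?a r * L2_norm g0 + L2_norm f0 * ?b r) F"
      using f(1) g(1)
    proof eventually_elim
      case (elim r)
      note df = square_integrable_diff[OF elim(1) f(2)] and dg = square_integrable_diff[OF elim(2) g(2)]
      note p1 = L2_pairing[OF df dg] and p2 = L2_pairing[OF df g(2)] and p3 = L2_pairing[OF f(2) dg]
      note p0 = L2_pairing(1)[OF elim(1) elim(2)] L2_pairing(1)[OF f(2) g(2)]
      have "(\<integral>x. f r x * g r x \<partial>lebesgue) - (\<integral>x. f0 x * g0 x \<partial>lebesgue) =
          (\<integral>x. f r x * g r x - f0 x * g0 x \<partial>lebesgue)"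
        by (rule Bochner_Integration.integral_diff[OF p0, symmetric])
      also have "\<dots> = (\<integral>x. (f r x - f0 x) * (g r x - g0 x) + (f r x - f0 x) * g0 x + f0 x * (g r x - g0 x) \<partial>lebesgue)"
        by (rule Bochner_Integration.integral_cong) (simp_all add: algebra_simps)
      also have "\<dots> = (\<integral>x. (f r x - f0 x) * (g r x - g0 x) \<partial>lebesgue) + (\<integral>x. (f r x - f0 x) * g0 x \<partial>lebesgue)
          + (\<integral>x. f0 x * (g r x - g0 x) \<partial>lebesgue)"
        by (simp only: Bochner_Integration.integral_add Bochner_Integration.integrable_add p1(1) p2(1) p3(1))
      finally show ?case using p1(2) p2(2) p3(2) unfolding real_norm_def by linarith
    qed
  qed
  then show ?thesis by (rule LIM_zero_cancel)
qed

lemma square_integrable_decaying: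
  assumes f: "continuous_on UNIV f" and C: "C \<ge> 0" and le: "\<And>y. \<bar>f y\<bar> \<le> C * (1 / (1 + (x - y)\<^sup>2))"
  shows "square_integrable f" and "L2_norm f \<le> 2 * C"
proof -
  have [measurable]: "f \<in> borel_measurable borel" using f by (rule borel_measurable_continuous_onI)
  have le2: "\<bar>(f y)\<^sup>2\<bar> \<le> C\<^sup>2 * (1 / (1 + (x - y)\<^sup>2))" for y
  proof -
    have d: "1 + (x - y)\<^sup>2 \<ge> 1" by simp
    have "\<bar>f y\<bar>\<^sup>2 \<le> (C * (1 / (1 + (x - y)\<^sup>2)))\<^sup>2" by (intro power_mono le) simp
    also have "\<dots> = C\<^sup>2 * (1 / (1 + (x - y)\<^sup>2)) * (1 / (1 + (x - y)\<^sup>2))"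
      by (simp add: power2_eq_square)
    also have "\<dots> \<le> C\<^sup>2 * (1 / (1 + (x - y)\<^sup>2)) * 1"
    proof (rule mult_left_mono)
      show "1 / (1 + (x - y)\<^sup>2) \<le> 1" by (subst divide_le_eq_1_pos) (use d in linarith)+
    qed (use d in simp)
    finally show ?thesis by simp
  qed
  have i: "integrable lborel (\<lambda>y. C\<^sup>2 * (1 / (1 + (x - y)\<^sup>2)))"
    by (intro integrable_mult_right integrable_inverse_quadratic)
  have m: "(\<lambda>y. (f y)\<^sup>2) \<in> borel_measurable lborel" by measurable
  note * = abs_integral_le[OF m i le2]
  show "square_integrable f"
    unfolding square_integrable_def using *(1) m
    by (auto simp: integrable_completion intro: borel_measurable_lebesgueI)
  have "(L2_norm f)\<^sup>2 = (\<integral>y. (f y)\<^sup>2 \<partial>lborel)"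
    unfolding L2_norm_squared by (rule integral_completion[OF m])
  also have "\<dots> \<le> (\<integral>y. C\<^sup>2 * (1 / (1 + (x - y)\<^sup>2)) \<partial>lborel)" using *(2) by simp
  also have "\<dots> = C\<^sup>2 * pi"
    by (simp only: integral_mult_right_zero integrable_inverse_quadratic(2))
  also have "\<dots> \<le> C\<^sup>2 * 4" using pi_less_4 by (intro mult_left_mono) auto
  also have "\<dots> = (2 * C)\<^sup>2" by (simp add: power_mult_distrib)
  finally show "L2_norm f \<le> 2 * C" by (rule power2_le_imp_le) (use C in simp)
qed

section \<open>Cut-off functions and the Leibniz rule\<close>

lemma smooth_cutoff:
  obtains cut :: "real \<Rightarrow> real" and D where "smooth cut" "cut 0 = 1" "\<And>y. \<bar>y\<bar> \<ge> 1 \<Longrightarrow> cut y = 0"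
    "D > 0" "\<And>k y. k \<le> 3 \<Longrightarrow> \<bar>(deriv ^^ k) cut y\<bar> \<le> D"
proof -
  define B where "B y = bump (1 * (y - - 1)) * bump (1 * (1 - y))" for y
  have B: "smooth B" unfolding B_def by (rule smooth_bump_interval)
  have B0: "B 0 > 0" by (simp add: B_def bump_simps)
  define cut where "cut y = inverse (B 0) * B y" for y
  have sm: "smooth cut"
    using smooth_deriv_sequence(2)[of "\<lambda>i x. inverse (B 0) * (deriv ^^ i) B x",
      OF DERIV_cmult[OF smooth_has_derivative[OF B]]] unfolding cut_def by (simp only: funpow_0)
  have out: "cut y = 0" if "\<bar>y\<bar> \<ge> 1" for y
  proof -
    have "y \<le> - 1 \<or> y \<ge> 1" using that by linarith
    then show ?thesis by (auto simp: cut_def B_def bump_simps)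
  qed
  have outk: "(deriv ^^ k) cut y = 0" if "\<bar>y\<bar> > 1" for k y
    using that
  proof (induction k arbitrary: y)
    case 0
    then show ?case using out by simp
  next
    case (Suc k)
    have "eventually (\<lambda>z. z \<in> {z. \<bar>z\<bar> > 1}) (nhds y)"
      using Suc.prems by (intro eventually_nhds_in_open open_Collect_less continuous_intros) simp
    then have "eventually (\<lambda>z. (deriv ^^ k) cut z = 0) (nhds y)"
      by eventually_elim (use Suc.IH in auto)
    then have "deriv ((deriv ^^ k) cut) y = deriv (\<lambda>_. 0) y" by (intro deriv_cong_ev) auto
    then show ?case by simp
  qed
  have "\<exists>D. \<forall>y. \<bar>(deriv ^^ k) cut y\<bar> \<le> D" for k
  proof -
    have "continuous_on {-1..1} ((deriv ^^ k) cut)"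
      using smooth_has_derivative[OF sm, of k]
      by (intro continuous_at_imp_continuous_on ballI DERIV_isCont)
    then have "compact ((deriv ^^ k) cut ` {-1..1})" by (intro compact_continuous_image) auto
    then obtain D where D: "\<And>y. y \<in> {-1..1} \<Longrightarrow> \<bar>(deriv ^^ k) cut y\<bar> \<le> D"
      using compact_imp_bounded bounded_iff by (metis imageI real_norm_def)
    have "\<bar>(deriv ^^ k) cut y\<bar> \<le> D" for y
    proof (cases "\<bar>y\<bar> > 1")
      case True
      have "0 \<le> \<bar>(deriv ^^ k) cut 0\<bar>" by simp
      also have "\<dots> \<le> D" by (rule D) simp
      finally show ?thesis using outk[OF True] by simp
    next
      case False
      then show ?thesis by (intro D) auto
    qed
    then show ?thesis by blast
  qed
  then obtain E where E: "\<And>k y. \<bar>(deriv ^^ k) cut y\<bar> \<le> E k" by metis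
  define D where "D = \<bar>E 0\<bar> + \<bar>E 1\<bar> + \<bar>E 2\<bar> + \<bar>E 3\<bar> + 1"
  have "\<bar>(deriv ^^ k) cut y\<bar> \<le> D" if "k \<le> 3" for k y
  proof -
    have "k = 0 \<or> k = 1 \<or> k = 2 \<or> k = 3" using that by linarith
    moreover have "E 0 \<le> D" "E 1 \<le> D" "E 2 \<le> D" "E 3 \<le> D" unfolding D_def by linarith+
    ultimately show ?thesis using order_trans[OF E[of k y]] by metis
  qed
  moreover have "cut 0 = 1" "D > 0" using B0 unfolding cut_def D_def by (simp, linarith)
  ultimately show ?thesis using that sm out by blast
qed

lemma third_derivative_mult:
  fixes X Y :: "nat \<Rightarrow> real \<Rightarrow> real"
  assumes X: "\<And>k y. (X k has_real_derivative X (Suc k) y) (at y)"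
    and Y: "\<And>k y. (Y k has_real_derivative Y (Suc k) y) (at y)"
  shows "(deriv ^^ 3) (\<lambda>y. X 0 y * Y 0 y) =
    (\<lambda>y. X 3 y * Y 0 y + 3 * (X 2 y * Y 1 y) + 3 * (X 1 y * Y 2 y) + X 0 y * Y 3 y)"
proof -
  have XY: "((\<lambda>y. X i y * Y j y) has_real_derivative X (Suc i) y * Y j y + X i y * Y (Suc j) y) (at y)" for i j y
    using DERIV_mult[OF X Y] by (simp add: mult.commute add.commute)
  have 1: "deriv (\<lambda>y. X 0 y * Y 0 y) = (\<lambda>y. X 1 y * Y 0 y + X 0 y * Y 1 y)"
    using XY[of 0 0] by (intro ext DERIV_imp_deriv) simp
  have 2: "deriv (\<lambda>y. X 1 y * Y 0 y + X 0 y * Y 1 y) = (\<lambda>y. X 2 y * Y 0 y + 2 * (X 1 y * Y 1 y) + X 0 y * Y 2 y)"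
    using DERIV_add[OF XY[of 1 0] XY[of 0 1]]
    by (intro ext DERIV_imp_deriv) (simp add: numeral_2_eq_2 algebra_simps)
  have 3: "deriv (\<lambda>y. X 2 y * Y 0 y + 2 * (X 1 y * Y 1 y) + X 0 y * Y 2 y) =
      (\<lambda>y. X 3 y * Y 0 y + 3 * (X 2 y * Y 1 y) + 3 * (X 1 y * Y 2 y) + X 0 y * Y 3 y)"
    using DERIV_add[OF DERIV_add[OF XY[of 2 0] DERIV_cmult[OF XY[of 1 1], of 2]] XY[of 0 2]]
    by (intro ext DERIV_imp_deriv) (simp add: numeral_2_eq_2 numeral_3_eq_3 algebra_simps)
  have "(deriv ^^ 3) f = deriv (deriv (deriv f))" for f :: "real \<Rightarrow> real"
    by (simp add: numeral_3_eq_3)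
  then show ?thesis by (simp only: 1 2 3)
qed

section \<open>The solution as an Airy convolution\<close>

text \<open>The mean value inequality used twice. The explicit linear rate matters: applied at every
  spatial point with a decaying bound \<open>B\<close>, it gives convergence of difference quotients
  in L2 and not merely pointwise.\<close>

lemma difference_quotient_bound:
  fixes f f' f'' :: "real \<Rightarrow> real"
  assumes rs: "s \<in> {0..T}" "r \<in> {0..T}" "r \<noteq> s"
    and f: "\<And>z. (f has_real_derivative f' z) (at z)"
    and f': "\<And>z. (f' has_real_derivative f'' z) (at z)"
    and B: "\<And>z. z \<in> {0..T} \<Longrightarrow> \<bar>f'' z\<bar> \<le> B"
  shows "\<bar>(f r - f s) / (r - s) - f' s\<bar> \<le> \<bar>r - s\<bar> * B"
proof -
  have seg: "z \<in> {0..T}" "\<bar>z - s\<bar> \<le> \<bar>r - s\<bar>" if "z \<in> closed_segment s r" for z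
    using that rs by (auto simp: closed_segment_eq_real_ivl split: if_splits)
  have f'_diff: "norm (f' z - f' s) \<le> B * \<bar>r - s\<bar>" if z: "z \<in> closed_segment s r" for z
  proof -
    have "norm (f' z - f' s) \<le> B * norm (z - s)"
      by (rule field_differentiable_bound[where S = "closed_segment s r" and f' = f''])
        (use z seg f' B in \<open>auto intro: has_field_derivative_at_within\<close>)
    also have "\<dots> \<le> B * \<bar>r - s\<bar>"
      using seg(2)[OF z] B[OF rs(1)] abs_ge_zero[of "f'' s"] by (intro mult_left_mono) auto
    finally show ?thesis .
  qed
  have "norm ((f r - r * f' s) - (f s - s * f' s)) \<le> (B * \<bar>r - s\<bar>) * norm (r - s)"
  proof (rule field_differentiable_bound[where S = "closed_segment s r" and f' = "\<lambda>z. f' z - f' s"])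
    show "((\<lambda>z. f z - z * f' s) has_field_derivative f' z - f' s) (at z within closed_segment s r)" for z
      by (rule has_field_derivative_at_within) (auto intro!: derivative_eq_intros f)
  qed (use f'_diff in auto)
  then have "\<bar>(f r - f s) - f' s * (r - s)\<bar> \<le> (B * \<bar>r - s\<bar>) * \<bar>r - s\<bar>"
    by (simp add: algebra_simps)
  moreover have "(f r - f s) / (r - s) - f' s = ((f r - f s) - f' s * (r - s)) / (r - s)"
    using rs(3) by (simp add: diff_divide_distrib)
  ultimately show ?thesis
    using rs(3) by (simp add: pos_divide_le_eq mult.commute)
qed

lemma L2_norm_diff_commute: "L2_norm (\<lambda>x. f x - g x) = L2_norm (\<lambda>x. g x - f x)"
  unfolding L2_norm_def by (simp only: power2_commute[of "f _"])

lemma L2_norm_bounded_on_interval: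
  fixes u :: "real \<Rightarrow> real \<Rightarrow> real"
  assumes sq: "\<And>t. t \<ge> 0 \<Longrightarrow> square_integrable (u t)"
    and cont: "\<And>t. t \<ge> 0 \<Longrightarrow> ((\<lambda>s. L2_norm (\<lambda>x. u s x - u t x)) \<longlongrightarrow> 0) (at t within {0..})"
  shows "\<exists>U\<ge>0. \<forall>t\<in>{0..T}. L2_norm (u t) \<le> U"
proof -
  have "continuous_on {0..T} (\<lambda>t. L2_norm (u t))"
    unfolding continuous_on_def
  proof
    fix t assume t: "t \<in> {0..T}"
    have "((\<lambda>s. L2_norm (u s) - L2_norm (u t)) \<longlongrightarrow> 0) (at t within {0..T})"
    proof (rule Lim_null_comparison)
      show "((\<lambda>s. L2_norm (\<lambda>x. u s x - u t x)) \<longlongrightarrow> 0) (at t within {0..T})"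
        by (rule tendsto_within_subset[OF cont]) (use t in auto)
      have "norm (L2_norm (u s) - L2_norm (u t)) \<le> L2_norm (\<lambda>x. u s x - u t x)" if s: "s \<in> {0..T}" for s
      proof -
        have "L2_norm (u s) \<le> L2_norm (\<lambda>x. u s x - u t x) + L2_norm (u t)"
          by (rule L2_norm_triangle) (use s t sq in auto)
        moreover have "L2_norm (u t) \<le> L2_norm (\<lambda>x. u t x - u s x) + L2_norm (u s)"
          by (rule L2_norm_triangle) (use s t sq in auto)
        ultimately show ?thesis
          unfolding L2_norm_diff_commute[of "u t" "u s"] real_norm_def by linarith
      qed
      then show "eventually (\<lambda>s. norm (L2_norm (u s) - L2_norm (u t)) \<le> L2_norm (\<lambda>x. u s x - u t x)) (at t within {0..T})"
        by (simp add: eventually_at_filter)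
    qed
    then show "((\<lambda>t. L2_norm (u t)) \<longlongrightarrow> L2_norm (u t)) (at t within {0..T})"
      by (rule LIM_zero_cancel)
  qed
  then have "compact ((\<lambda>t. L2_norm (u t)) ` {0..T})" by (intro compact_continuous_image) auto
  then have "bounded ((\<lambda>t. L2_norm (u t)) ` {0..T})" by (rule compact_imp_bounded)
  then obtain U where U: "\<forall>z\<in>(\<lambda>t. L2_norm (u t)) ` {0..T}. norm z \<le> U" unfolding bounded_iff by blast
  have "L2_norm (u t) \<le> \<bar>U\<bar>" if "t \<in> {0..T}" for t
  proof -
    have "norm (L2_norm (u t)) \<le> U" using U that by blast
    then show ?thesis using abs_ge_self[of U] L2_norm_nonneg[of "u t"] by simp
  qed
  then show ?thesis by (intro exI[of _ "\<bar>U\<bar>"]) auto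
qed

text \<open>The pairing of the solution with the cut-off adjoint solution changes in time only by commutator
  terms, which contain a derivative of the cut-off and hence a factor \<open>1 / R\<close>.\<close>

lemma KdV_duality_cutoff:
  fixes u :: "real \<Rightarrow> real \<Rightarrow> real" and cut :: "real \<Rightarrow> real" and C :: "nat \<Rightarrow> real" and U D :: real
  assumes sol: "linear_KdV_solution u0 u" and T: "T > 0" and a: "a > 0" and R: "R \<ge> 1"
    and C: "\<And>k. C k > 0" "\<And>k t z. \<bar>t\<bar> \<le> T \<Longrightarrow> \<bar>airy_reg k a t z\<bar> \<le> C k / (1 + z\<^sup>2)"
    and U: "U \<ge> 0" "\<And>t. t \<in> {0..T} \<Longrightarrow> L2_norm (u t) \<le> U"
    and cut: "smooth cut" "\<And>y. \<bar>y\<bar> \<ge> 1 \<Longrightarrow> cut y = 0" "D > 0" "\<And>k y. k \<le> 3 \<Longrightarrow> \<bar>(deriv ^^ k) cut y\<bar> \<le> D"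
  shows "\<bar>(\<integral>y. u T y * (cut (y / R) * airy_reg 0 a 0 (x - y)) \<partial>lebesgue)
    - (\<integral>y. u 0 y * (cut (y / R) * airy_reg 0 a T (x - y)) \<partial>lebesgue)\<bar>
    \<le> T * (U * (2 * (D / R * (C 0 + 3 * C 1 + 3 * C 2))))"
proof -
  have sq: "square_integrable (u t)" if "t \<ge> 0" for t
    using sol that by (simp add: linear_KdV_solution_def)
  have L2c: "((\<lambda>s. L2_norm (\<lambda>x. u s x - u t x)) \<longlongrightarrow> 0) (at t within {0..T})" if "t \<in> {0..T}" for t
    by (rule tendsto_within_subset[of _ _ _ "{0..}"]) (use sol that in \<open>auto simp: linear_KdV_solution_def\<close>)
  \<comment> \<open>The adjoint solution run backwards from time T, with its y-derivatives; the sign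
    comes from the reflection x - y.\<close>
  define Y where "Y k s y = (- 1) ^ k * airy_reg k a (T - s) (x - y)" for k s y
  define X where "X k y = (deriv ^^ k) cut (y / R) / R ^ k" for k y
  have Y_deriv: "(Y k s has_real_derivative Y (Suc k) s y) (at y)" for k s y
  proof -
    have "((\<lambda>y. airy_reg k a (T - s) (x - y)) has_real_derivative airy_reg (Suc k) a (T - s) (x - y) * - 1) (at y)"
      by (rule DERIV_chain2[OF airy_reg_deriv_x[OF a]]) (auto intro!: derivative_eq_intros)
    from DERIV_cmult[OF this, of "(- 1) ^ k"] show ?thesis
      unfolding Y_def[abs_def] by simp
  qed
  have Y_time: "((\<lambda>s. Y k s y) has_real_derivative - Y (k + 3) s y) (at s)" for k s y
  proof -
    have "((\<lambda>s. airy_reg k a (T - s) (x - y)) has_real_derivative - airy_reg (k + 3) a (T - s) (x - y) * - 1) (at s)"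
      by (rule DERIV_chain2[OF airy_reg_deriv_t[OF a]]) (auto intro!: derivative_eq_intros)
    from DERIV_cmult[OF this, of "(- 1) ^ k"] show ?thesis
      unfolding Y_def by (simp add: power_add)
  qed
  have Y_bound: "\<bar>Y k s y\<bar> \<le> C k * (1 / (1 + (x - y)\<^sup>2))" if "s \<in> {0..T}" for k s y
    using C(2)[of "T - s" k "x - y"] that by (simp add: Y_def abs_mult)
  have Y_cont: "continuous_on UNIV (Y k s)" for k s
    by (intro continuous_at_imp_continuous_on ballI DERIV_isCont[OF Y_deriv])
  have X_deriv: "(X k has_real_derivative X (Suc k) y) (at y)" for k y
  proof -
    have "((\<lambda>y. (deriv ^^ k) cut (y / R)) has_real_derivative (deriv ^^ Suc k) cut (y / R) * (1 / R)) (at y)"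
      by (rule DERIV_chain2[OF smooth_has_derivative[OF cut(1)]]) (use R in \<open>auto intro!: derivative_eq_intros\<close>)
    from DERIV_cdivide[OF this, of "R ^ k"] show ?thesis
      unfolding X_def[abs_def] by (simp add: mult.commute)
  qed
  have X_cont: "continuous_on UNIV (X k)" for k
    by (intro continuous_at_imp_continuous_on ballI DERIV_isCont[OF X_deriv])
  have X0: "\<bar>X 0 y\<bar> \<le> D" for y
    using cut(4)[of 0 "y / R"] by (simp add: X_def)
  have X_small: "\<bar>X k y\<bar> \<le> D / R" if "k \<in> {1, 2, 3}" for k y
  proof -
    have c: "\<bar>(deriv ^^ k) cut (y / R)\<bar> \<le> D" using that by (intro cut(4)) auto
    have "\<bar>X k y\<bar> = \<bar>(deriv ^^ k) cut (y / R)\<bar> / R ^ k" using R by (simp add: X_def)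
    also have "\<dots> \<le> D / R ^ 1"
      using R that cut(3) by (intro frac_le power_increasing c) auto
    finally show ?thesis by simp
  qed
  define phi where "phi s y = X 0 y * Y 0 s y" for s y
  \<comment> \<open>The time derivative of \<open>phi\<close>. Its product with \<open>u\<close>
    cancels the term of the third space derivative that carries no derivative of the cut-off,
    leaving the commutator \<open>E\<close>.\<close>
  define \<theta> where "\<theta> s y = - (X 0 y * Y 3 s y)" for s y
  define E where "E s y = X 3 y * Y 0 s y + 3 * (X 2 y * Y 1 s y) + 3 * (X 1 y * Y 2 s y)" for s y
  have test: "test_function (phi s)" for s
  proof (rule test_functionI)
    have "smooth (X 0)" "smooth (Y 0 s)"
      using smooth_deriv_sequence(2)[of X] smooth_deriv_sequence(2)[of "\<lambda>k. Y k s"] X_deriv Y_deriv by blast+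
    then show "smooth (phi s)" unfolding phi_def[abs_def] by (rule smooth_mult)
    show "phi s y = 0" if "y \<notin> {- R..R}" for y
    proof -
      have "\<bar>y / R\<bar> \<ge> 1" using that R by (auto simp: field_simps)
      then show ?thesis using cut(2) by (simp add: phi_def X_def)
    qed
  qed
  have d3: "(deriv ^^ 3) (phi s) = (\<lambda>y. E s y + X 0 y * Y 3 s y)" for s
    using third_derivative_mult[of X "\<lambda>k. Y k s", OF X_deriv Y_deriv] unfolding phi_def[abs_def] E_def by simp
  have decay_mult: "\<bar>p * q\<bar> \<le> P * Q * (1 / (1 + (x - y)\<^sup>2))"
    if "\<bar>p\<bar> \<le> P" "\<bar>q\<bar> \<le> Q * (1 / (1 + (x - y)\<^sup>2))" for p q P Q y :: real
    using mult_mono[OF that] that(1) abs_ge_zero[of p] by (simp add: abs_mult mult.assoc)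
  have XY_sq: "square_integrable (\<lambda>y. X 0 y * Y k s y)" if "s \<in> {0..T}" for k s
    by (rule square_integrable_decaying(1)[of _ "D * C k" x])
      (use cut(3) C(1)[of k] decay_mult[OF X0 Y_bound[OF that]] in
        \<open>auto intro!: continuous_intros X_cont Y_cont\<close>)
  have phi_sq: "square_integrable (phi s)" if "s \<in> {0..T}" for s
    using XY_sq[OF that, of 0] by (simp add: phi_def[abs_def])
  have \<theta>_sq: "square_integrable (\<theta> s)" if "s \<in> {0..T}" for s
    using square_integrable_cmult[OF XY_sq[OF that, of 3], of "- 1"] by (simp add: \<theta>_def[abs_def])
  have E_cont: "continuous_on UNIV (E s)" for s
    unfolding E_def[abs_def] by (intro continuous_intros X_cont Y_cont)
  have E_bound: "\<bar>E s y\<bar> \<le> (D / R * (C 0 + 3 * C 1 + 3 * C 2)) * (1 / (1 + (x - y)\<^sup>2))" if "s \<in> {0..T}" for s y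
  proof -
    have "\<bar>X 3 y * Y 0 s y\<bar> \<le> D / R * C 0 * (1 / (1 + (x - y)\<^sup>2))"
      "\<bar>X 2 y * Y 1 s y\<bar> \<le> D / R * C 1 * (1 / (1 + (x - y)\<^sup>2))"
      "\<bar>X 1 y * Y 2 s y\<bar> \<le> D / R * C 2 * (1 / (1 + (x - y)\<^sup>2))"
      by (intro decay_mult X_small Y_bound that; simp)+
    moreover have "(D / R * (C 0 + 3 * C 1 + 3 * C 2)) * (1 / (1 + (x - y)\<^sup>2)) =
        D / R * C 0 * (1 / (1 + (x - y)\<^sup>2)) + 3 * (D / R * C 1 * (1 / (1 + (x - y)\<^sup>2))) + 3 * (D / R * C 2 * (1 / (1 + (x - y)\<^sup>2)))"
      by (simp add: algebra_simps)
    ultimately show ?thesis unfolding E_def by (simp only: abs_le_iff) linarith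
  qed
  have DC_nonneg: "0 \<le> D / R * (C 0 + 3 * C 1 + 3 * C 2)"
    using cut(3) R C(1)[of 0] C(1)[of 1] C(1)[of 2] by simp
  note E_sq = square_integrable_decaying[OF E_cont DC_nonneg E_bound]
  define I where "I r = (\<integral>y. u r y * phi r y \<partial>lebesgue)" for r
  have deriv_I: "(I has_real_derivative (\<integral>y. u s y * E s y \<partial>lebesgue)) (at s)" if s: "s \<in> {0<..<T}" for s
  proof -
    have sT: "s \<in> {0..T}" "s > 0" using s by auto
    have ev: "eventually (\<lambda>r. r \<in> {0..T} \<and> r \<noteq> s) (at s)"
    proof -
      have "eventually (\<lambda>r. r \<in> {0<..<T}) (at s)" using s by (intro eventually_at_in_open') auto
      moreover have "eventually (\<lambda>r. r \<noteq> s) (at s)" by (rule eventually_neq_at_within)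
      ultimately show ?thesis by eventually_elim auto
    qed
    have at_s: "at s within {0..T} = at s" using s by (intro at_within_interior) simp
    \<comment> \<open>The weak equation admits only test functions independent of time. The quotient
      of \<open>I\<close> is therefore split into that of \<open>J\<close>, with
      \<open>phi s\<close> frozen, and the pairing of \<open>u r\<close> with the quotient
      \<open>q\<close> of the test functions.\<close>
    define J where "J r = (\<integral>y. u r y * phi s y \<partial>lebesgue)" for r
    define q where "q r y = (phi r y - phi s y) / (r - s)" for r y
    have q_sq: "square_integrable (q r)" if "r \<in> {0..T}" for r
      using square_integrable_cmult[OF square_integrable_diff[OF phi_sq[OF that] phi_sq[OF sT(1)]], of "1 / (r - s)"]
      by (simp add: q_def[abs_def])
    have "(J has_real_derivative (\<integral>y. u s y * (deriv ^^ 3) (phi s) y \<partial>lebesgue)) (at s)"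
      using sol test[of s] sT(2) unfolding linear_KdV_solution_def J_def[abs_def] by blast
    then have lim1: "((\<lambda>r. (J r - J s) / (r - s)) \<longlongrightarrow> (\<integral>y. u s y * (deriv ^^ 3) (phi s) y \<partial>lebesgue)) (at s)"
      by (simp add: has_field_derivative_iff)
    \<comment> \<open>Two time derivatives of \<open>Y 0\<close> amount to six space derivatives,
      hence the constant \<open>C 6\<close>.\<close>
    have q_lim: "((\<lambda>r. L2_norm (\<lambda>y. q r y - \<theta> s y)) \<longlongrightarrow> 0) (at s)"
    proof (rule Lim_null_comparison)
      have "((\<lambda>r. 2 * (D * (\<bar>r - s\<bar> * C 6))) \<longlongrightarrow> 2 * (D * (\<bar>s - s\<bar> * C 6))) (at s)"
        by (intro tendsto_intros)
      then show "((\<lambda>r. 2 * (D * (\<bar>r - s\<bar> * C 6))) \<longlongrightarrow> 0) (at s)" by simp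
      show "eventually (\<lambda>r. norm (L2_norm (\<lambda>y. q r y - \<theta> s y)) \<le> 2 * (D * (\<bar>r - s\<bar> * C 6))) (at s)"
        using ev
      proof eventually_elim
        case (elim r)
        have "L2_norm (\<lambda>y. q r y - \<theta> s y) \<le> 2 * (D * (\<bar>r - s\<bar> * C 6))"
        proof (rule square_integrable_decaying(2)[of _ _ x])
          show "continuous_on UNIV (\<lambda>y. q r y - \<theta> s y)"
            unfolding q_def \<theta>_def phi_def using elim by (intro continuous_intros X_cont Y_cont) auto
          show "0 \<le> D * (\<bar>r - s\<bar> * C 6)" using cut(3) C(1)[of 6] by simp
          fix y
          have B: "\<bar>Y 6 z y\<bar> \<le> C 6 * (1 / (1 + (x - y)\<^sup>2))" if "z \<in> {0..T}" for z
            using Y_bound[OF that] .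
          have Y3: "((\<lambda>z. - Y 3 z y) has_real_derivative Y 6 z y) (at z)" for z
            using DERIV_minus[OF Y_time[of 3 y z]] by simp
          have Y0: "((\<lambda>z. Y 0 z y) has_real_derivative - Y 3 z y) (at z)" for z
            using Y_time[of 0 y z] by simp
          have "\<bar>(Y 0 r y - Y 0 s y) / (r - s) - - Y 3 s y\<bar> \<le> \<bar>r - s\<bar> * (C 6 * (1 / (1 + (x - y)\<^sup>2)))"
            by (rule difference_quotient_bound[OF sT(1) _ _ Y0 Y3 B]) (use elim in auto)
          then have "\<bar>X 0 y * ((Y 0 r y - Y 0 s y) / (r - s) - - Y 3 s y)\<bar> \<le> D * (\<bar>r - s\<bar> * C 6) * (1 / (1 + (x - y)\<^sup>2))"
            by (intro decay_mult X0) (simp add: mult.assoc)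
          moreover have "q r y - \<theta> s y = X 0 y * ((Y 0 r y - Y 0 s y) / (r - s) - - Y 3 s y)"
            by (simp add: q_def \<theta>_def phi_def right_diff_distrib diff_divide_distrib distrib_left)
          ultimately show "\<bar>q r y - \<theta> s y\<bar> \<le> D * (\<bar>r - s\<bar> * C 6) * (1 / (1 + (x - y)\<^sup>2))" by (simp only:)
        qed
        then show ?case using L2_norm_nonneg by simp
      qed
    qed
    have lim2: "((\<lambda>r. \<integral>y. u r y * q r y \<partial>lebesgue) \<longlongrightarrow> (\<integral>y. u s y * \<theta> s y \<partial>lebesgue)) (at s)"
    proof (rule L2_pairing_tendsto[OF _ _ _ _ _ q_lim])
      show "eventually (\<lambda>r. square_integrable (u r)) (at s)" using ev by eventually_elim (use sq in auto)
      show "eventually (\<lambda>r. square_integrable (q r)) (at s)" using ev by eventually_elim (use q_sq in auto)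
      show "((\<lambda>r. L2_norm (\<lambda>y. u r y - u s y)) \<longlongrightarrow> 0) (at s)" using L2c[OF sT(1)] unfolding at_s .
    qed (use sq sT \<theta>_sq in auto)
    have "((\<lambda>r. (J r - J s) / (r - s) + (\<integral>y. u r y * q r y \<partial>lebesgue)) \<longlongrightarrow>
        (\<integral>y. u s y * (deriv ^^ 3) (phi s) y \<partial>lebesgue) + (\<integral>y. u s y * \<theta> s y \<partial>lebesgue)) (at s)"
      by (rule tendsto_add[OF lim1 lim2])
    moreover have "(\<integral>y. u s y * (deriv ^^ 3) (phi s) y \<partial>lebesgue) + (\<integral>y. u s y * \<theta> s y \<partial>lebesgue) =
        (\<integral>y. u s y * E s y \<partial>lebesgue)"
    proof -
      note us = sq[of s]
      have i1: "integrable lebesgue (\<lambda>y. u s y * E s y)" "integrable lebesgue (\<lambda>y. u s y * \<theta> s y)"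
        by (intro L2_pairing(1) us E_sq(1) \<theta>_sq sT; use sT in simp)+
      have "(\<lambda>y. u s y * (deriv ^^ 3) (phi s) y) = (\<lambda>y. u s y * E s y - u s y * \<theta> s y)"
        unfolding d3 by (simp add: \<theta>_def fun_eq_iff algebra_simps)
      then show ?thesis using i1 by (simp only: Bochner_Integration.integral_diff diff_add_cancel)
    qed
    moreover have "eventually (\<lambda>r. (J r - J s) / (r - s) + (\<integral>y. u r y * q r y \<partial>lebesgue) = (I r - I s) / (r - s)) (at s)"
      using ev
    proof eventually_elim
      case (elim r)
      have ur: "square_integrable (u r)" using elim sq by simp
      have "(\<integral>y. u r y * q r y \<partial>lebesgue) = (\<integral>y. (u r y * phi r y - u r y * phi s y) / (r - s) \<partial>lebesgue)"
        by (rule Bochner_Integration.integral_cong) (simp_all add: q_def right_diff_distrib)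
      also have "\<dots> = ((\<integral>y. u r y * phi r y \<partial>lebesgue) - (\<integral>y. u r y * phi s y \<partial>lebesgue)) / (r - s)"
        using L2_pairing(1)[OF ur phi_sq[of r]] L2_pairing(1)[OF ur phi_sq[OF sT(1)]] elim by simp
      also have "\<dots> = (I r - J r) / (r - s)" by (simp add: I_def J_def)
      finally show ?case by (simp add: I_def[of s] J_def[of s] add_divide_distrib[symmetric])
    qed
    ultimately have "((\<lambda>r. (I r - I s) / (r - s)) \<longlongrightarrow> (\<integral>y. u s y * E s y \<partial>lebesgue)) (at s)"
      using Lim_transform_eventually by fastforce
    then show ?thesis by (simp add: has_field_derivative_iff)
  qed
  \<comment> \<open>The equation is available only for positive times; continuity on the closed
    interval, from the L2 continuity of \<open>u\<close>, is what brings in the initial value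
    through the mean value theorem.\<close>
  have cont_I: "continuous_on {0..T} I"
    unfolding continuous_on_def
  proof
    fix s assume s: "s \<in> {0..T}"
    have ev: "eventually (\<lambda>r. r \<in> {0..T}) (at s within {0..T})" by (simp add: eventually_at_filter)
    show "(I \<longlongrightarrow> I s) (at s within {0..T})"
      unfolding I_def[abs_def]
    proof (rule L2_pairing_tendsto[OF _ _ _ _ L2c[OF s]])
      show "eventually (\<lambda>r. square_integrable (u r)) (at s within {0..T})"
        using ev by eventually_elim (use sq in auto)
      show "eventually (\<lambda>r. square_integrable (phi r)) (at s within {0..T})"
        using ev by eventually_elim (use phi_sq in auto)
      show "((\<lambda>r. L2_norm (\<lambda>y. phi r y - phi s y)) \<longlongrightarrow> 0) (at s within {0..T})"
      proof (rule Lim_null_comparison)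
        have "((\<lambda>r. 2 * (D * (\<bar>r - s\<bar> * C 3))) \<longlongrightarrow> 2 * (D * (\<bar>s - s\<bar> * C 3))) (at s within {0..T})"
          by (intro tendsto_intros)
        then show "((\<lambda>r. 2 * (D * (\<bar>r - s\<bar> * C 3))) \<longlongrightarrow> 0) (at s within {0..T})" by simp
        show "eventually (\<lambda>r. norm (L2_norm (\<lambda>y. phi r y - phi s y)) \<le> 2 * (D * (\<bar>r - s\<bar> * C 3))) (at s within {0..T})"
          using ev
        proof eventually_elim
          case (elim r)
          have "L2_norm (\<lambda>y. phi r y - phi s y) \<le> 2 * (D * (\<bar>r - s\<bar> * C 3))"
          proof (rule square_integrable_decaying(2)[of _ _ x])
            show "continuous_on UNIV (\<lambda>y. phi r y - phi s y)"
              unfolding phi_def by (intro continuous_intros X_cont Y_cont)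
            show "0 \<le> D * (\<bar>r - s\<bar> * C 3)" using cut(3) C(1)[of 3] by simp
            fix y
            have "norm (Y 0 r y - Y 0 s y) \<le> C 3 * (1 / (1 + (x - y)\<^sup>2)) * norm (r - s)"
            proof (rule field_differentiable_bound[where S = "{0..T}" and f' = "\<lambda>z. - Y 3 z y"])
              show "((\<lambda>z. Y 0 z y) has_field_derivative - Y 3 z y) (at z within {0..T})" for z
                using Y_time[of 0 y z] by (auto intro: has_field_derivative_at_within)
              show "norm (- Y 3 z y) \<le> C 3 * (1 / (1 + (x - y)\<^sup>2))" if "z \<in> {0..T}" for z
                using Y_bound[OF that, of 3 y] by simp
            qed (use elim s in auto)
            then have "\<bar>X 0 y * (Y 0 r y - Y 0 s y)\<bar> \<le> D * (\<bar>r - s\<bar> * C 3) * (1 / (1 + (x - y)\<^sup>2))"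
              by (intro decay_mult X0) (simp add: mult_ac)
            then show "\<bar>phi r y - phi s y\<bar> \<le> D * (\<bar>r - s\<bar> * C 3) * (1 / (1 + (x - y)\<^sup>2))"
              by (simp add: phi_def right_diff_distrib)
          qed
          then show ?case using L2_norm_nonneg by simp
        qed
      qed
    qed (use sq s phi_sq in auto)
  qed
  obtain z where z: "z \<in> {0<..<T}" "I T - I 0 = (T - 0) * (\<integral>y. u z y * E z y \<partial>lebesgue)"
  proof -
    have "\<exists>l z. 0 < z \<and> z < T \<and> (I has_real_derivative l) (at z) \<and> I T - I 0 = (T - 0) * l"
      using T cont_I deriv_I by (intro MVT) (auto simp: real_differentiable_def)
    then obtain l z where lz: "0 < z" "z < T" "(I has_real_derivative l) (at z)" "I T - I 0 = (T - 0) * l" by blast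
    then have "l = (\<integral>y. u z y * E z y \<partial>lebesgue)" using deriv_I[of z] DERIV_unique by auto
    then show ?thesis using that[of z] lz by auto
  qed
  have zT: "z \<in> {0..T}" using z by auto
  have "\<bar>\<integral>y. u z y * E z y \<partial>lebesgue\<bar> \<le> L2_norm (u z) * L2_norm (E z)"
    by (rule L2_pairing(2)[OF sq E_sq(1)]) (use zT in auto)
  also have "\<dots> \<le> U * (2 * (D / R * (C 0 + 3 * C 1 + 3 * C 2)))"
    by (intro mult_mono U E_sq(2) zT L2_norm_nonneg)
  finally have "\<bar>I T - I 0\<bar> \<le> T * (U * (2 * (D / R * (C 0 + 3 * C 1 + 3 * C 2))))"
    unfolding z(2) using T mult_left_mono[of _ _ T] by (simp only: abs_mult diff_zero abs_of_pos)
  then show ?thesis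
    by (simp add: I_def phi_def X_def Y_def)
qed

lemma airy_reg_continuous: "a > 0 \<Longrightarrow> continuous_on UNIV (\<lambda>y. airy_reg k a t (x - y))"
  by (rule continuous_on_compose2[of UNIV "airy_reg k a t"])
    (auto intro!: continuous_at_imp_continuous_on DERIV_isCont[OF airy_reg_deriv_x] continuous_intros)

lemma airy_reg_square_integrable:
  assumes "a > 0"
  shows "square_integrable (\<lambda>y. airy_reg k a t (x - y))"
proof -
  obtain C where "C > 0" "\<And>s z. \<bar>s\<bar> \<le> \<bar>t\<bar> \<Longrightarrow> \<bar>airy_reg k a s z\<bar> \<le> C / (1 + z\<^sup>2)"
    using airy_reg_decay[OF assms abs_ge_zero[of t], of k] by blast
  then show ?thesis
    by (intro square_integrable_decaying(1)[of "\<lambda>y. airy_reg k a t (x - y)" C x] airy_reg_continuous assms) auto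
qed

text \<open>The cut-off is removed by letting R = n + 1 grow: the error is of order 1 / R, and both
  pairings converge by domination.\<close>

lemma KdV_duality:
  fixes u :: "real \<Rightarrow> real \<Rightarrow> real"
  assumes sol: "linear_KdV_solution u0 u" and T: "T > 0" and a: "a > 0"
  shows "(\<integral>y. u T y * airy_reg 0 a 0 (x - y) \<partial>lebesgue) = (\<integral>y. u 0 y * airy_reg 0 a T (x - y) \<partial>lebesgue)"
proof -
  have sq: "square_integrable (u t)" if "t \<ge> 0" for t
    using sol that by (simp add: linear_KdV_solution_def)
  have "\<exists>C. \<forall>k. C k > 0 \<and> (\<forall>t z. \<bar>t\<bar> \<le> T \<longrightarrow> \<bar>airy_reg k a t z\<bar> \<le> C k / (1 + z\<^sup>2))"
    using airy_reg_decay[OF a less_imp_le[OF T]] by (intro choice allI)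
  then obtain C where C: "\<And>k. C k > 0" "\<And>k t z. \<bar>t\<bar> \<le> T \<Longrightarrow> \<bar>airy_reg k a t z\<bar> \<le> C k / (1 + z\<^sup>2)"
    by blast
  have "\<exists>U\<ge>0. \<forall>t\<in>{0..T}. L2_norm (u t) \<le> U"
    by (rule L2_norm_bounded_on_interval) (use sol in \<open>auto simp: linear_KdV_solution_def\<close>)
  then obtain U where U: "U \<ge> 0" "\<And>t. t \<in> {0..T} \<Longrightarrow> L2_norm (u t) \<le> U" by blast
  obtain cut :: "real \<Rightarrow> real" and D where cut: "smooth cut" "cut 0 = 1" "\<And>y. \<bar>y\<bar> \<ge> 1 \<Longrightarrow> cut y = 0" "D > 0"
      "\<And>k y. k \<le> 3 \<Longrightarrow> \<bar>(deriv ^^ k) cut y\<bar> \<le> D"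
    using smooth_cutoff by blast
  have cut_cont: "continuous_on UNIV cut" by (rule smooth_continuous[OF cut(1)])
  have lim: "(\<lambda>n. \<integral>y. v y * (cut (y / real (Suc n)) * w y) \<partial>lebesgue) \<longlonglongrightarrow> (\<integral>y. v y * w y \<partial>lebesgue)"
    if v: "square_integrable v" and w: "square_integrable w" for v w
  proof (rule integral_dominated_convergence)
    have [measurable]: "v \<in> borel_measurable lebesgue" "w \<in> borel_measurable lebesgue"
      using v w by (auto simp: square_integrable_def)
    show "(\<lambda>y. v y * w y) \<in> borel_measurable lebesgue" by measurable
    have "(\<lambda>y. cut (y / real (Suc n))) \<in> borel_measurable lebesgue" for n
      by (intro continuous_lebesgue_measurable continuous_on_compose2[OF cut_cont] continuous_intros) auto
    then show "(\<lambda>y. v y * (cut (y / real (Suc n)) * w y)) \<in> borel_measurable lebesgue" for n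
      by (intro borel_measurable_times) auto
    show "integrable lebesgue (\<lambda>y. D * \<bar>v y * w y\<bar>)"
      by (intro integrable_mult_right integrable_abs L2_pairing(1) v w)
    show "AE y in lebesgue. (\<lambda>n. v y * (cut (y / real (Suc n)) * w y)) \<longlonglongrightarrow> v y * w y"
    proof (rule AE_I2)
      fix y
      have "(\<lambda>n. y / real (Suc n)) \<longlonglongrightarrow> 0"
        using LIMSEQ_Suc[OF lim_const_over_n[of y]] by simp
      then have "(\<lambda>n. cut (y / real (Suc n))) \<longlonglongrightarrow> cut 0"
        by (rule continuous_on_tendsto_compose[OF cut_cont]) auto
      then have "(\<lambda>n. v y * (cut (y / real (Suc n)) * w y)) \<longlonglongrightarrow> v y * (cut 0 * w y)"
        by (intro tendsto_intros)
      then show "(\<lambda>n. v y * (cut (y / real (Suc n)) * w y)) \<longlonglongrightarrow> v y * w y" using cut(2) by simp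
    qed
    show "AE y in lebesgue. norm (v y * (cut (y / real (Suc n)) * w y)) \<le> D * \<bar>v y * w y\<bar>" for n
    proof (rule AE_I2)
      fix y
      have "\<bar>cut (y / real (Suc n))\<bar> * \<bar>v y * w y\<bar> \<le> D * \<bar>v y * w y\<bar>"
        using cut(5)[of 0] by (intro mult_right_mono) auto
      then show "norm (v y * (cut (y / real (Suc n)) * w y)) \<le> D * \<bar>v y * w y\<bar>"
        by (simp add: abs_mult mult_ac)
    qed
  qed
  let ?A = "\<lambda>n. (\<integral>y. u T y * (cut (y / real (Suc n)) * airy_reg 0 a 0 (x - y)) \<partial>lebesgue)"
  let ?B = "\<lambda>n. (\<integral>y. u 0 y * (cut (y / real (Suc n)) * airy_reg 0 a T (x - y)) \<partial>lebesgue)"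
  have A: "?A \<longlonglongrightarrow> (\<integral>y. u T y * airy_reg 0 a 0 (x - y) \<partial>lebesgue)"
    by (rule lim) (use sq T airy_reg_square_integrable[OF a] in auto)
  have B: "?B \<longlonglongrightarrow> (\<integral>y. u 0 y * airy_reg 0 a T (x - y) \<partial>lebesgue)"
    by (rule lim) (use sq airy_reg_square_integrable[OF a] in auto)
  have "(\<lambda>n. ?A n - ?B n) \<longlonglongrightarrow> 0"
  proof (rule Lim_null_comparison[OF always_eventually])
    define M where "M = T * (U * (2 * (D * (C 0 + 3 * C 1 + 3 * C 2))))"
    show "(\<lambda>n. M / real (Suc n)) \<longlonglongrightarrow> 0"
      using LIMSEQ_Suc[OF lim_const_over_n[of M]] by simp
    show "\<forall>n. norm (?A n - ?B n) \<le> M / real (Suc n)"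
    proof
      fix n
      have "\<bar>?A n - ?B n\<bar> \<le> T * (U * (2 * (D / real (Suc n) * (C 0 + 3 * C 1 + 3 * C 2))))"
        by (rule KdV_duality_cutoff[OF sol T a _ C U cut(1,3,4,5)]) simp_all
      also have "\<dots> = M / real (Suc n)" by (simp only: M_def times_divide_eq_right times_divide_eq_left)
      finally show "norm (?A n - ?B n) \<le> M / real (Suc n)" by simp
    qed
  qed
  from LIMSEQ_unique[OF this tendsto_diff[OF A B]] show ?thesis by simp
qed

text \<open>At time 0 the regularised kernel is a Gaussian of mass 1 and variance 2 a. Since
  \<open>v\<close> is merely continuous and square integrable, possibly unbounded, the contribution
  away from x needs an explicit majorant instead of a supremum bound.\<close>

lemma airy_reg_0_approximate_identity:
  assumes v: "square_integrable v" "continuous_on UNIV v" and a: "\<And>n. a n > 0" "a \<longlonglongrightarrow> 0"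
  shows "(\<lambda>n. \<integral>y. v y * airy_reg 0 (a n) 0 (x - y) \<partial>lebesgue) \<longlonglongrightarrow> v x"
proof -
  define g where "g n y = airy_reg 0 (a n) 0 (x - y)" for n y
  have g_eq: "g n y = exp (- (1 / (4 * a n)) * (x - y)\<^sup>2) / (2 * sqrt (pi * a n))" for n y
    unfolding g_def airy_reg_time_0[OF a(1)] by simp
  have g_nn: "g n y \<ge> 0" for n y unfolding g_eq using a(1)[of n] by simp
  have q: "1 / (4 * a n) > 0" for n using a(1) by simp
  have "integrable lborel (\<lambda>z. exp (- (1 / (4 * a n)) * z\<^sup>2))" for n
    using integrable_gaussian_moment[OF q[of n], of 0] by simp
  from lborel_integrable_real_affine[OF this, of "-1" _ x]
  have ei: "integrable lborel (\<lambda>y. exp (- (1 / (4 * a n)) * (x - y)\<^sup>2))" for n by simp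
  have g_int: "integrable lborel (g n)" for n
    unfolding g_eq[abs_def] by (rule integrable_divide_zero) (rule ei)
  have g_1: "(\<integral>y. g n y \<partial>lborel) = 1" for n
  proof -
    have "(\<integral>y. exp (- (1 / (4 * a n)) * (x - y)\<^sup>2) \<partial>lborel) = sqrt (pi / (1 / (4 * a n)))"
      using lborel_integral_real_affine[of "-1" "\<lambda>z. exp (- (1 / (4 * a n)) * z\<^sup>2)" x]
      unfolding integral_gaussian[OF q] by simp
    also have "pi / (1 / (4 * a n)) = 2\<^sup>2 * (pi * a n)" by simp
    also have "sqrt \<dots> = 2 * sqrt (pi * a n)" by (simp only: real_sqrt_mult real_sqrt_abs abs_numeral)
    finally show ?thesis unfolding g_eq using a(1)[of n] by simp
  qed
  \<comment> \<open>The inequality exp (-w) <= 1 / w trades the Gaussian tail for a quadratic one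
    with a vanishing factor sqrt (a n).\<close>
  have g_far: "g n y \<le> 2 * sqrt (a n) / (x - y)\<^sup>2" if "y \<noteq> x" for n y
  proof -
    define z where "z = (x - y)\<^sup>2"
    have z: "z > 0" using that by (simp add: z_def)
    define w where "w = z / (4 * a n)"
    have w: "w > 0" using z a(1)[of n] by (simp add: w_def)
    have "w \<le> exp w" using exp_ge_add_one_self[of w] by linarith
    then have "exp (- w) \<le> 1 / w" using w by (simp add: exp_minus field_simps)
    then have "g n y \<le> (1 / w) / (2 * sqrt (pi * a n))"
      unfolding g_eq z_def[symmetric] using a(1)[of n] by (intro divide_right_mono) (simp_all add: w_def)
    also have "\<dots> \<le> (1 / w) / (2 * sqrt (a n))"
    proof -
      have "sqrt (a n) \<le> sqrt (pi * a n)"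
        using a(1)[of n] pi_gt3 by (intro real_sqrt_le_mono) simp
      then show ?thesis using w a(1)[of n] by (intro divide_left_mono) auto
    qed
    also have "\<dots> = 2 * sqrt (a n) / z"
    proof -
      define r where "r = sqrt (a n)"
      have r: "r > 0" "a n = r * r" using a(1)[of n] by (simp_all add: r_def)
      have "1 / w = 4 * (r * r) / z" by (simp add: w_def r(2))
      then have "1 / w / (2 * r) = (4 * (r * r) / z) / (2 * r)" by (simp only:)
      also have "\<dots> = 2 * r / z" using r(1) by simp
      finally show ?thesis by (simp only: r_def)
    qed
    finally show ?thesis by (simp only: z_def)
  qed
  have v_meas: "v \<in> borel_measurable borel" using v(2) by (rule borel_measurable_continuous_onI)
  have v_sq: "integrable lborel (\<lambda>y. (v y)\<^sup>2)"
    using v(1) v_meas by (simp add: square_integrable_def integrable_completion)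
  have to_lborel: "(\<integral>y. v y * g n y \<partial>lebesgue) = (\<integral>y. v y * g n y \<partial>lborel)" for n
    using v_meas borel_measurable_integrable[OF g_int[of n]] by (intro integral_completion) simp
  have vg_int: "integrable lborel (\<lambda>y. v y * g n y)" for n
    using L2_pairing(1)[OF v(1) airy_reg_square_integrable[OF a(1)[of n], of 0 0 x]]
      v_meas borel_measurable_integrable[OF g_int[of n]] unfolding g_def[symmetric]
    by (subst (asm) integrable_completion) simp_all
  have "(\<lambda>n. (\<integral>y. v y * g n y \<partial>lborel)) \<longlonglongrightarrow> v x"
  proof (rule LIMSEQ_I)
    fix \<epsilon> :: real
    assume \<epsilon>: "\<epsilon> > 0"
    have "isCont v x" using v(2) by (simp add: continuous_on_eq_continuous_at)
    then obtain \<delta> where \<delta>: "\<delta> > 0" "\<And>y. \<bar>y - x\<bar> < \<delta> \<Longrightarrow> \<bar>v y - v x\<bar> < \<epsilon> / 2"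
      using half_gt_zero[OF \<epsilon>] unfolding continuous_at_eps_delta dist_real_def by metis
    define L where "L = 2 * (1 + 1 / \<delta>\<^sup>2)"
    have L: "L > 0" using \<delta> by (simp add: L_def add_pos_nonneg)
    \<comment> \<open>Integrable majorant of the far part divided by sqrt (a n), using |v| <= 1 +
      v^2; \<open>L\<close> compares 2 / (x - y)^2 with 1 / (1 + (x - y)^2) outside the
      \<delta>-neighbourhood.\<close>
    define h where "h y = L * ((1 + \<bar>v x\<bar>) * (1 / (1 + (x - y)\<^sup>2)) + (v y)\<^sup>2)" for y
    have h_int: "integrable lborel h"
      unfolding h_def by (intro integrable_mult_right Bochner_Integration.integrable_add integrable_inverse_quadratic v_sq)
    have h_nn: "h y \<ge> 0" for y unfolding h_def using L by simp
    have pw: "\<bar>(v y - v x) * g n y\<bar> \<le> \<epsilon> / 2 * g n y + sqrt (a n) * h y" for n y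
    proof (cases "\<bar>y - x\<bar> < \<delta>")
      case True
      have "\<bar>v y - v x\<bar> * g n y \<le> \<epsilon> / 2 * g n y"
        using \<delta>(2)[OF True] g_nn by (intro mult_right_mono) auto
      moreover have "0 \<le> sqrt (a n) * h y" using h_nn a(1)[of n] by simp
      ultimately show ?thesis using g_nn[of n y] by (simp add: abs_mult)
    next
      case False
      define z where "z = (x - y)\<^sup>2"
      have "\<delta>\<^sup>2 \<le> \<bar>y - x\<bar>\<^sup>2" using False \<delta> by (intro power_mono) auto
      then have z\<delta>: "\<delta>\<^sup>2 \<le> z" by (simp add: z_def power2_commute)
      then have z: "z > 0" using \<delta> by (simp add: less_le_trans[of 0 "\<delta>\<^sup>2"])
      have yx: "y \<noteq> x" using False \<delta> by auto
      have inv1: "2 / z \<le> L * (1 / (1 + z))"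
      proof -
        have "z * (1 / \<delta>\<^sup>2) \<ge> 1" using z\<delta> \<delta> by (simp add: pos_le_divide_eq)
        then have "1 + z \<le> (1 + 1 / \<delta>\<^sup>2) * z" by (simp add: algebra_simps)
        then have "2 * (1 + z) \<le> L * z" unfolding L_def mult.assoc by (rule mult_left_mono) simp
        then show ?thesis using z by (simp add: pos_divide_le_eq pos_le_divide_eq)
      qed
      have inv2: "2 / z \<le> L"
      proof -
        have "L * (1 / (1 + z)) \<le> L * 1" using L z by (intro mult_left_mono) auto
        then show ?thesis using inv1 by linarith
      qed
      have "\<bar>v y\<bar> \<le> 1 + (v y)\<^sup>2"
        using zero_le_power2[of "\<bar>v y\<bar> - 1 / 2"] by (simp add: power2_diff power_divide)
      then have vb: "\<bar>v y - v x\<bar> \<le> (1 + \<bar>v x\<bar>) + (v y)\<^sup>2" by linarith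
      have "\<bar>(v y - v x) * g n y\<bar> \<le> ((1 + \<bar>v x\<bar>) + (v y)\<^sup>2) * (2 * sqrt (a n) / z)"
        unfolding abs_mult using vb g_far[OF yx, of n] g_nn[of n y]
        by (intro mult_mono) (auto simp: z_def)
      also have "\<dots> = sqrt (a n) * ((1 + \<bar>v x\<bar>) * (2 / z) + (v y)\<^sup>2 * (2 / z))"
        by (simp add: algebra_simps add_divide_distrib)
      also have "\<dots> \<le> sqrt (a n) * ((1 + \<bar>v x\<bar>) * (L * (1 / (1 + z))) + (v y)\<^sup>2 * L)"
        using a(1)[of n] inv1 inv2 by (intro mult_left_mono add_mono) auto
      also have "\<dots> = sqrt (a n) * h y" by (simp add: h_def z_def algebra_simps)
      finally show ?thesis using \<epsilon> g_nn[of n y] by (simp add: add_increasing)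
    qed
    have est: "\<bar>(\<integral>y. v y * g n y \<partial>lborel) - v x\<bar> \<le> \<epsilon> / 2 + sqrt (a n) * (\<integral>y. h y \<partial>lborel)" for n
    proof -
      have "(\<integral>y. v y * g n y \<partial>lborel) - v x = (\<integral>y. v y * g n y \<partial>lborel) - v x * (\<integral>y. g n y \<partial>lborel)"
        by (simp add: g_1)
      also have "\<dots> = (\<integral>y. v y * g n y - v x * g n y \<partial>lborel)"
        using vg_int g_int by simp
      also have "\<dots> = (\<integral>y. (v y - v x) * g n y \<partial>lborel)" by (simp add: left_diff_distrib)
      finally have eq: "(\<integral>y. v y * g n y \<partial>lborel) - v x = (\<integral>y. (v y - v x) * g n y \<partial>lborel)" .
      have i: "integrable lborel (\<lambda>y. \<epsilon> / 2 * g n y)" "integrable lborel (\<lambda>y. sqrt (a n) * h y)"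
        by (intro integrable_mult_right g_int h_int)+
      have "\<bar>\<integral>y. (v y - v x) * g n y \<partial>lborel\<bar> \<le> (\<integral>y. \<epsilon> / 2 * g n y + sqrt (a n) * h y \<partial>lborel)"
        by (rule abs_integral_le(2)[OF _ Bochner_Integration.integrable_add[OF i] pw])
          (use v_meas borel_measurable_integrable[OF g_int[of n]] in measurable)
      also have "\<dots> = \<epsilon> / 2 * (\<integral>y. g n y \<partial>lborel) + sqrt (a n) * (\<integral>y. h y \<partial>lborel)"
        unfolding Bochner_Integration.integral_add[OF i] by (simp only: integral_mult_right_zero)
      finally show ?thesis unfolding eq g_1 by simp
    qed
    have "(\<lambda>n. sqrt (a n) * (\<integral>y. h y \<partial>lborel)) \<longlonglongrightarrow> sqrt 0 * (\<integral>y. h y \<partial>lborel)"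
      by (intro tendsto_intros a(2))
    then have "eventually (\<lambda>n. sqrt (a n) * (\<integral>y. h y \<partial>lborel) < \<epsilon> / 2) sequentially"
      using \<epsilon> by (intro order_tendstoD(2)) auto
    then obtain N where "\<And>n. n \<ge> N \<Longrightarrow> sqrt (a n) * (\<integral>y. h y \<partial>lborel) < \<epsilon> / 2"
      unfolding eventually_sequentially by blast
    then have "norm ((\<integral>y. v y * g n y \<partial>lborel) - v x) < \<epsilon>" if "n \<ge> N" for n
      using est[of n] that unfolding real_norm_def by fastforce
    then show "\<exists>N. \<forall>n\<ge>N. norm ((\<integral>y. v y * g n y \<partial>lborel) - v x) < \<epsilon>" by blast
  qed
  then show ?thesis unfolding to_lborel[symmetric] by (simp only: g_def)
qed

text \<open>Provides the majorant for removing the regularisation. For w >= 0 and \<alpha> <= 1 the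
  factor exp (\<alpha> w) is compensated by the exponential decay of rate 1; for w < 0 it is at most
  1 and boundedness of \<open>airy\<close> suffices.\<close>

lemma airy_shift_bounded:
  "\<exists>M. \<forall>\<alpha> w. 0 < \<alpha> \<and> \<alpha> \<le> 1 \<longrightarrow> \<bar>exp (\<alpha> * w + 2 * \<alpha> ^ 3) * airy (w + 3 * \<alpha>\<^sup>2)\<bar> \<le> M"
proof -
  obtain K1 where K1: "K1 > 0" "\<And>x. \<bar>airy x\<bar> \<le> K1 * exp (- x)" using airy_exp_decay by blast
  obtain K where K: "K > 0" "\<And>z. \<bar>airy z\<bar> \<le> K / root4 z" using airy_bounds by metis
  have airy_K: "\<bar>airy z\<bar> \<le> K" for z
  proof -
    have "K / root4 z \<le> K / 1" using K(1) root4_ge_1[of z] by (intro divide_left_mono) auto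
    then show ?thesis using K(2)[of z] by simp
  qed
  have "\<bar>exp (\<alpha> * w + 2 * \<alpha> ^ 3) * airy (w + 3 * \<alpha>\<^sup>2)\<bar> \<le> exp 2 * K1 + exp 2 * K" if \<alpha>: "0 < \<alpha>" "\<alpha> \<le> 1" for \<alpha> w
  proof -
    have a3: "\<alpha> ^ 3 \<le> 1" using \<alpha> by (simp add: power_le_one)
    show ?thesis
    proof (cases "w \<ge> 0")
      case True
      have "\<alpha> * w \<le> 1 * w" using True \<alpha> by (intro mult_right_mono) auto
      then have "exp (\<alpha> * w + 2 * \<alpha> ^ 3) \<le> exp (w + 2)" using a3 by simp
      moreover have "\<bar>airy (w + 3 * \<alpha>\<^sup>2)\<bar> \<le> K1 * exp (- w)"
        by (rule order_trans[OF K1(2)]) (use K1(1) in simp)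
      ultimately have "\<bar>exp (\<alpha> * w + 2 * \<alpha> ^ 3) * airy (w + 3 * \<alpha>\<^sup>2)\<bar> \<le> exp (w + 2) * (K1 * exp (- w))"
        unfolding abs_mult by (intro mult_mono) auto
      also have "\<dots> = exp 2 * K1" by (simp add: exp_add exp_minus)
      finally show ?thesis using K(1) by (simp add: add_increasing2)
    next
      case False
      then have "\<alpha> * w \<le> 0" using \<alpha> by (simp add: mult_nonneg_nonpos)
      then have "exp (\<alpha> * w + 2 * \<alpha> ^ 3) \<le> exp 2" using a3 by simp
      then have "\<bar>exp (\<alpha> * w + 2 * \<alpha> ^ 3) * airy (w + 3 * \<alpha>\<^sup>2)\<bar> \<le> exp 2 * K"
        unfolding abs_mult using airy_K by (intro mult_mono) auto
      then show ?thesis using K1(1) by (simp add: add_increasing)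
    qed
  qed
  then show ?thesis by blast
qed

text \<open>Duality moves the Gaussian onto the kernel. As the Gaussian shrinks, the left side
  recovers the value at x, and on the right the contour descends to the real axis, where the kernel
  becomes \<open>airy\<close>; integrability of \<open>u0\<close> permits passing to the limit. In
  particular the solution is determined by its data.\<close>

lemma KdV_representation:
  fixes u :: "real \<Rightarrow> real \<Rightarrow> real"
  assumes sol: "linear_KdV_solution u0 u" and s: "s > 0" and u0: "integrable lebesgue u0"
  shows "u (s ^ 3) x = (\<integral>y. u0 y * airy ((x - y) / s) \<partial>lebesgue) / s"
proof -
  have T: "s ^ 3 > 0" using s by simp
  define \<alpha> where "\<alpha> n = 1 / real (Suc n)" for n
  have \<alpha>: "\<alpha> n > 0" "\<alpha> n \<le> 1" "\<alpha> \<longlonglongrightarrow> 0" for n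
    using LIMSEQ_Suc[OF lim_const_over_n[of 1]] by (simp_all add: \<alpha>_def[abs_def])
  \<comment> \<open>After scaling to time 1 the width becomes 3 * \<alpha> n, the damping produced
    by a contour at height \<alpha> n.\<close>
  define a where "a n = 3 * \<alpha> n * s\<^sup>2" for n
  have a: "a n > 0" for n using s \<alpha> by (simp add: a_def)
  have "(\<lambda>n. 3 * \<alpha> n * s\<^sup>2) \<longlonglongrightarrow> 3 * 0 * s\<^sup>2" by (intro tendsto_intros \<alpha>)
  then have a_lim: "a \<longlonglongrightarrow> 0" by (simp add: a_def[abs_def])
  have "square_integrable (u (s ^ 3))" "continuous_on UNIV (u (s ^ 3))"
    using sol T by (simp_all add: linear_KdV_solution_def)
  from airy_reg_0_approximate_identity[OF this a a_lim]
  have lim1: "(\<lambda>n. \<integral>y. u (s ^ 3) y * airy_reg 0 (a n) 0 (x - y) \<partial>lebesgue) \<longlonglongrightarrow> u (s ^ 3) x" .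
  have u0_meas: "u0 \<in> borel_measurable lebesgue" using u0 by simp
  have ae: "AE y in lebesgue. u 0 y = u0 y" using sol by (simp add: linear_KdV_solution_def)
  have u_meas: "u 0 \<in> borel_measurable lebesgue"
    using sol by (simp add: linear_KdV_solution_def square_integrable_def)
  have reg: "airy_reg 0 (a n) (s ^ 3) z = exp (\<alpha> n * (z / s) + 2 * \<alpha> n ^ 3) * airy (z / s + 3 * (\<alpha> n)\<^sup>2) / s" for n z
  proof -
    have "a n / s\<^sup>2 = 3 * \<alpha> n" using s by (simp add: a_def)
    then show ?thesis using airy_reg_scale[OF s, of "a n" z] airy_contour_shift[OF \<alpha>(1), of n "z / s"] by simp
  qed
  have eq: "(\<integral>y. u (s ^ 3) y * airy_reg 0 (a n) 0 (x - y) \<partial>lebesgue) = (\<integral>y. u0 y * airy_reg 0 (a n) (s ^ 3) (x - y) \<partial>lebesgue)" for n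
  proof -
    have m: "(\<lambda>y. airy_reg 0 (a n) (s ^ 3) (x - y)) \<in> borel_measurable lebesgue"
      by (intro continuous_lebesgue_measurable airy_reg_continuous a)
    have "(\<integral>y. u 0 y * airy_reg 0 (a n) (s ^ 3) (x - y) \<partial>lebesgue) = (\<integral>y. u0 y * airy_reg 0 (a n) (s ^ 3) (x - y) \<partial>lebesgue)"
    proof (rule integral_cong_AE)
      show "AE y in lebesgue. u 0 y * airy_reg 0 (a n) (s ^ 3) (x - y) = u0 y * airy_reg 0 (a n) (s ^ 3) (x - y)"
        using ae by eventually_elim simp
    qed (intro borel_measurable_times m u_meas u0_meas)+
    then show ?thesis using KdV_duality[OF sol T a[of n], of x] by simp
  qed
  obtain M where M: "\<And>\<alpha> w. 0 < \<alpha> \<Longrightarrow> \<alpha> \<le> 1 \<Longrightarrow> \<bar>exp (\<alpha> * w + 2 * \<alpha> ^ 3) * airy (w + 3 * \<alpha>\<^sup>2)\<bar> \<le> M"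
    using airy_shift_bounded by blast
  have "(\<lambda>n. \<integral>y. u0 y * airy_reg 0 (a n) (s ^ 3) (x - y) \<partial>lebesgue) \<longlonglongrightarrow> (\<integral>y. u0 y * (airy ((x - y) / s) / s) \<partial>lebesgue)"
  proof (rule integral_dominated_convergence)
    show "integrable lebesgue (\<lambda>y. M / s * \<bar>u0 y\<bar>)" by (intro integrable_mult_right integrable_abs u0)
    have "(\<lambda>y. airy ((x - y) / s) / s) \<in> borel_measurable lebesgue"
      using s by (intro continuous_lebesgue_measurable continuous_intros continuous_on_compose2[OF airy_continuous(1)[of UNIV]]) auto
    then show "(\<lambda>y. u0 y * (airy ((x - y) / s) / s)) \<in> borel_measurable lebesgue"
      by (intro borel_measurable_times u0_meas)
    show "(\<lambda>y. u0 y * airy_reg 0 (a n) (s ^ 3) (x - y)) \<in> borel_measurable lebesgue" for n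
      by (intro borel_measurable_times u0_meas continuous_lebesgue_measurable airy_reg_continuous a)
    show "AE y in lebesgue. (\<lambda>n. u0 y * airy_reg 0 (a n) (s ^ 3) (x - y)) \<longlonglongrightarrow> u0 y * (airy ((x - y) / s) / s)"
    proof (rule AE_I2)
      fix y
      define w where "w = (x - y) / s"
      have "(\<lambda>n. w + 3 * (\<alpha> n)\<^sup>2) \<longlonglongrightarrow> w + 3 * 0\<^sup>2" by (intro tendsto_intros \<alpha>)
      then have "(\<lambda>n. airy (w + 3 * (\<alpha> n)\<^sup>2)) \<longlonglongrightarrow> airy (w + 3 * 0\<^sup>2)"
        by (rule continuous_on_tendsto_compose[OF airy_continuous(1)[of UNIV]]) auto
      then have "(\<lambda>n. u0 y * (exp (\<alpha> n * w + 2 * \<alpha> n ^ 3) * airy (w + 3 * (\<alpha> n)\<^sup>2) / s)) \<longlonglongrightarrow>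
          u0 y * (exp (0 * w + 2 * 0 ^ 3) * airy (w + 3 * 0\<^sup>2) / s)"
        using s by (intro tendsto_intros \<alpha>) auto
      then show "(\<lambda>n. u0 y * airy_reg 0 (a n) (s ^ 3) (x - y)) \<longlonglongrightarrow> u0 y * (airy ((x - y) / s) / s)"
        unfolding reg by (simp add: w_def)
    qed
    show "AE y in lebesgue. norm (u0 y * airy_reg 0 (a n) (s ^ 3) (x - y)) \<le> M / s * \<bar>u0 y\<bar>" for n
    proof (rule AE_I2)
      fix y
      have "\<bar>u0 y\<bar> * (\<bar>exp (\<alpha> n * ((x - y) / s) + 2 * \<alpha> n ^ 3) * airy ((x - y) / s + 3 * (\<alpha> n)\<^sup>2)\<bar> / s) \<le> \<bar>u0 y\<bar> * (M / s)"
        using s M[OF \<alpha>(1)[of n] \<alpha>(2)[of n], of "(x - y) / s"]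
        by (intro mult_left_mono divide_right_mono) simp_all
      then show "norm (u0 y * airy_reg 0 (a n) (s ^ 3) (x - y)) \<le> M / s * \<bar>u0 y\<bar>"
        unfolding reg real_norm_def using s by (simp add: abs_mult mult_ac)
    qed
  qed
  from LIMSEQ_unique[OF lim1 this[folded eq]] show ?thesis by simp
qed

section \<open>Reduction to unit time by scaling\<close>

text \<open>\<open>V\<close> is the continuous representative of the initial value and
  \<open>G\<close> a Borel version of its weak derivative, so that everything afterwards takes place
  on \<open>lborel\<close>.\<close>

locale KdV_data =
  fixes V G :: "real \<Rightarrow> real" and \<epsilon> :: real
  assumes eps: "\<epsilon> > 0"
    and G_meas: "G \<in> borel_measurable borel"
    and prim: "primitive V G"
    and G_int: "integrable lborel (\<lambda>y. (G y)\<^sup>2)" and G_le: "(\<integral>y. (G y)\<^sup>2 \<partial>lborel) \<le> \<epsilon>\<^sup>2"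
    and V_int: "integrable lborel (\<lambda>y. (V y)\<^sup>2)" and V_le: "(\<integral>y. (V y)\<^sup>2 \<partial>lborel) \<le> \<epsilon>\<^sup>2"
    and V2_int: "integrable lborel (\<lambda>y. (y\<^sup>2 * V y)\<^sup>2)" and V2_le: "(\<integral>y. (y\<^sup>2 * V y)\<^sup>2 \<partial>lborel) \<le> \<epsilon>\<^sup>2"
begin

lemma V_cont: "continuous_on A V"
  using primitive_continuous[OF prim G_meas G_int] continuous_on_subset by blast

lemma V_meas[measurable]: "V \<in> borel_measurable borel"
  by (intro borel_measurable_continuous_onI V_cont)

text \<open>The elementary inequality 2 p q <= p^2 + q^2 with weight 1 + y^2, balanced by \<epsilon>
  so that both parts are linear in \<epsilon>: the norms contribute 4 \<epsilon> and the integral of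
  1 / (1 + y^2) at most 2 \<epsilon>. The total 6 is the L1 bound in the scaled data.\<close>

lemma weighted_V:
  shows weighted_V_int: "integrable lborel (\<lambda>y. (1 + \<bar>y\<bar>) * \<bar>V y\<bar>)"
    and weighted_V_le: "(\<integral>y. (1 + \<bar>y\<bar>) * \<bar>V y\<bar> \<partial>lborel) \<le> 6 * \<epsilon>"
proof -
  let ?h = "\<lambda>y. (2 / \<epsilon>) * ((V y)\<^sup>2 + (y\<^sup>2 * V y)\<^sup>2) + (\<epsilon> / 2) * (1 / (1 + (0 - y)\<^sup>2))"
  have le: "\<bar>(1 + \<bar>y\<bar>) * \<bar>V y\<bar>\<bar> \<le> ?h y" for y
  proof -
    define w where "w = 1 + y\<^sup>2"
    have w: "w > 0" by (simp add: w_def add_pos_nonneg)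
    define p where "p = (1 + \<bar>y\<bar>) * \<bar>V y\<bar>"
    have "(1 + \<bar>y\<bar>)\<^sup>2 \<le> 2 * w"
      using zero_le_power2[of "1 - \<bar>y\<bar>"] by (simp add: w_def power2_sum power2_diff)
    moreover have "w\<^sup>2 \<le> 2 * (1 + y ^ 4)"
      using zero_le_power2[of "1 - y\<^sup>2"] by (simp add: w_def power2_sum power2_diff)
    ultimately have "(1 + \<bar>y\<bar>)\<^sup>2 * w \<le> 4 * (1 + y ^ 4)"
    proof -
      have "(1 + \<bar>y\<bar>)\<^sup>2 * w \<le> (2 * w) * w"
        using \<open>(1 + \<bar>y\<bar>)\<^sup>2 \<le> 2 * w\<close> w by (intro mult_right_mono) simp_all
      also have "\<dots> = 2 * w\<^sup>2" by (simp add: power2_eq_square)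
      finally show ?thesis using \<open>w\<^sup>2 \<le> 2 * (1 + y ^ 4)\<close> by linarith
    qed
    then have "(1 + \<bar>y\<bar>)\<^sup>2 * w * (V y)\<^sup>2 \<le> 4 * (1 + y ^ 4) * (V y)\<^sup>2"
      by (rule mult_right_mono) simp
    then have p2: "p\<^sup>2 * w \<le> 4 * ((V y)\<^sup>2 + (y\<^sup>2 * V y)\<^sup>2)"
    proof -
      have "p\<^sup>2 * w = (1 + \<bar>y\<bar>)\<^sup>2 * w * (V y)\<^sup>2"
        by (simp only: p_def power_mult_distrib power2_abs mult_ac)
      moreover have "4 * (1 + y ^ 4) * (V y)\<^sup>2 = 4 * ((V y)\<^sup>2 + (y\<^sup>2 * V y)\<^sup>2)"
        by (simp add: power_mult_distrib algebra_simps)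
      ultimately show ?thesis using \<open>_ \<le> 4 * (1 + y ^ 4) * (V y)\<^sup>2\<close> by (simp only:)
    qed
    have "2 * (p * w) * \<epsilon> \<le> (p * w)\<^sup>2 + \<epsilon>\<^sup>2"
      using zero_le_power2[of "p * w - \<epsilon>"] by (simp add: power2_diff)
    then have "2 * \<epsilon> * p * w \<le> (p\<^sup>2 * w) * w + \<epsilon>\<^sup>2" by (simp add: power2_eq_square mult_ac)
    also have "\<dots> \<le> 4 * ((V y)\<^sup>2 + (y\<^sup>2 * V y)\<^sup>2) * w + \<epsilon>\<^sup>2"
      using mult_right_mono[OF p2, of w] w by simp
    finally have *: "2 * \<epsilon> * p * w \<le> 4 * ((V y)\<^sup>2 + (y\<^sup>2 * V y)\<^sup>2) * w + \<epsilon>\<^sup>2" .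
    define q where "q = (V y)\<^sup>2 + (y\<^sup>2 * V y)\<^sup>2"
    have "p = (2 * \<epsilon> * p * w) / (2 * \<epsilon> * w)" using eps w by simp
    also have "\<dots> \<le> (4 * q * w + \<epsilon>\<^sup>2) / (2 * \<epsilon> * w)"
      using * eps w unfolding q_def by (intro divide_right_mono) auto
    also have "\<dots> = (2 / \<epsilon>) * q + (\<epsilon> / 2) * (1 / w)"
      using eps w by (simp add: field_simps power2_eq_square)
    finally show ?thesis by (simp add: p_def q_def w_def)
  qed
  have i1: "integrable lborel (\<lambda>y. (2 / \<epsilon>) * ((V y)\<^sup>2 + (y\<^sup>2 * V y)\<^sup>2))"
    by (intro integrable_mult_right Bochner_Integration.integrable_add V_int V2_int)
  have i2: "integrable lborel (\<lambda>y::real. (\<epsilon> / 2) * (1 / (1 + (0 - y)\<^sup>2)))"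
    by (intro integrable_mult_right integrable_inverse_quadratic)
  have m: "(\<lambda>y. (1 + \<bar>y\<bar>) * \<bar>V y\<bar>) \<in> borel_measurable lborel" by measurable
  note b = abs_integral_le[OF m Bochner_Integration.integrable_add[OF i1 i2] le]
  show "integrable lborel (\<lambda>y. (1 + \<bar>y\<bar>) * \<bar>V y\<bar>)" by (rule b(1))
  have "(\<integral>y. ?h y \<partial>lborel) = (2 / \<epsilon>) * ((\<integral>y. (V y)\<^sup>2 \<partial>lborel) + (\<integral>y. (y\<^sup>2 * V y)\<^sup>2 \<partial>lborel)) + (\<epsilon> / 2) * pi"
    by (simp only: Bochner_Integration.integral_add[OF i1 i2] integral_mult_right_zero
        Bochner_Integration.integral_add[OF V_int V2_int] integrable_inverse_quadratic(2))
  also have "\<dots> \<le> (2 / \<epsilon>) * (\<epsilon>\<^sup>2 + \<epsilon>\<^sup>2) + (\<epsilon> / 2) * 4"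
    using eps V_le V2_le pi_less_4 by (intro add_mono mult_left_mono) auto
  also have "\<dots> = 6 * \<epsilon>" using eps by (simp add: power2_eq_square)
  finally show "(\<integral>y. (1 + \<bar>y\<bar>) * \<bar>V y\<bar> \<partial>lborel) \<le> 6 * \<epsilon>" using b(2) by linarith
qed

lemma abs_V:
  shows abs_V_int: "integrable lborel (\<lambda>y. \<bar>V y\<bar>)" and abs_V_le: "(\<integral>y. \<bar>V y\<bar> \<partial>lborel) \<le> 6 * \<epsilon>"
proof -
  have m: "(\<lambda>y. \<bar>V y\<bar>) \<in> borel_measurable lborel" by measurable
  have le: "\<bar>\<bar>V y\<bar>\<bar> \<le> (1 + \<bar>y\<bar>) * \<bar>V y\<bar>" for y by (simp add: distrib_right)
  note b = abs_integral_le[OF m weighted_V_int le]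
  show "integrable lborel (\<lambda>y. \<bar>V y\<bar>)" by (rule b(1))
  show "(\<integral>y. \<bar>V y\<bar> \<partial>lborel) \<le> 6 * \<epsilon>" using b(2) weighted_V_le by linarith
qed

text \<open>By the Hoelder bound \<open>primitive_holder\<close>, \<open>V\<close> stays at least \<open>\<bar>V z\<bar> / 2\<close> on an interval of length
  \<open>(\<bar>V z\<bar> / (2 * \<epsilon>))\<^sup>2\<close> on the side of \<open>z\<close> away from the origin.\<close>

lemma V_pointwise: "\<bar>z\<bar> * \<bar>V z\<bar> \<le> 2 * \<epsilon>"
proof (cases "V z = 0")
  case False
  define m where "m = \<bar>V z\<bar>"
  have m: "m > 0" using False by (simp add: m_def)
  define r where "r = (m / (2 * \<epsilon>))\<^sup>2"
  have r: "r > 0" using m eps by (simp add: r_def)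
  define A where "A = (if z \<ge> 0 then {z..z + r} else {z - r..z})"
  have A_meas: "A \<in> sets lborel" "emeasure lborel A < \<infinity>" "measure lborel A = r"
    using r by (simp_all add: A_def emeasure_lborel_Icc_eq)
  have lower: "indicator A y * (z ^ 4 * (m\<^sup>2 / 4)) \<le> (y\<^sup>2 * V y)\<^sup>2" for y
  proof (cases "y \<in> A")
    case True
    have yz: "\<bar>y - z\<bar> \<le> r" "\<bar>z\<bar> \<le> \<bar>y\<bar>" using True r by (auto simp: A_def split: if_splits)
    have "\<bar>V y - V z\<bar>\<^sup>2 \<le> r * \<epsilon>\<^sup>2"
    proof -
      have "\<bar>V y - V z\<bar>\<^sup>2 \<le> \<bar>y - z\<bar> * (\<integral>x. (G x)\<^sup>2 \<partial>lborel)"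
        using primitive_holder[OF prim G_meas G_int, of y z] by simp
      also have "\<dots> \<le> r * \<epsilon>\<^sup>2" using yz(1) r G_le by (intro mult_mono) auto
      finally show ?thesis .
    qed
    also have "\<dots> = (m / 2)\<^sup>2" using eps by (simp add: r_def power_divide power_mult_distrib)
    finally have "\<bar>V y - V z\<bar> \<le> m / 2" by (rule power2_le_imp_le) (use m in simp)
    then have "m / 2 \<le> \<bar>V y\<bar>" unfolding m_def by linarith
    then have "(m / 2)\<^sup>2 \<le> \<bar>V y\<bar>\<^sup>2" using m by (intro power_mono) auto
    moreover have "\<bar>z\<bar> ^ 4 \<le> \<bar>y\<bar> ^ 4" using yz(2) by (intro power_mono) auto
    ultimately have "\<bar>z\<bar> ^ 4 * (m / 2)\<^sup>2 \<le> \<bar>y\<bar> ^ 4 * \<bar>V y\<bar>\<^sup>2" by (intro mult_mono) auto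
    then show ?thesis using True by (simp add: power_mult_distrib power_divide)
  qed simp
  have "r * (z ^ 4 * (m\<^sup>2 / 4)) = (\<integral>y. indicator A y * (z ^ 4 * (m\<^sup>2 / 4)) \<partial>lborel)"
    using A_meas by simp
  also have "\<dots> \<le> (\<integral>y. (y\<^sup>2 * V y)\<^sup>2 \<partial>lborel)"
  proof (rule integral_mono[OF _ V2_int lower])
    show "integrable lborel (\<lambda>y. indicator A y * (z ^ 4 * (m\<^sup>2 / 4)))"
      using A_meas by (intro integrable_mult_left integrable_real_indicator) auto
  qed
  also have "\<dots> \<le> \<epsilon>\<^sup>2" by (rule V2_le)
  finally have "r * (z ^ 4 * (m\<^sup>2 / 4)) \<le> \<epsilon>\<^sup>2" .
  \<comment> \<open>Inserting r = (m / (2 * \<epsilon>))^2 makes the left side the fourth power of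
    |z| m divided by 16 \<epsilon>^2.\<close>
  then have "(\<bar>z\<bar> * m) ^ 4 \<le> (2 * \<epsilon>) ^ 4"
    using eps by (simp add: r_def power_divide power_mult_distrib field_simps eval_nat_numeral)
  then have "(\<bar>z\<bar> * m) ^ Suc 3 \<le> (2 * \<epsilon>) ^ Suc 3" by simp
  then show ?thesis
    unfolding m_def[symmetric] by (rule power_le_imp_le_base) (use eps in simp)
qed (use eps in simp)

text \<open>Normalisation for time s^3. The prefactor s leaves the L1 norm and the supremum of |y
  V(y)| invariant, while the squared L2 norms of the derivative and of y^2 V are multiplied by s^3
  and s^(-3); this is where the parameter T = s^3 comes from.\<close>

definition scaled_V :: "real \<Rightarrow> real \<Rightarrow> real" where "scaled_V s y = s / \<epsilon> * V (s * y)"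
definition scaled_G :: "real \<Rightarrow> real \<Rightarrow> real" where "scaled_G s y = s\<^sup>2 / \<epsilon> * G (s * y)"

lemma integral_dilate:
  fixes f :: "real \<Rightarrow> real"
  assumes "s > 0"
  shows "(\<integral>y. f (s * y) \<partial>lborel) = (\<integral>y. f y \<partial>lborel) / s"
  using lborel_integral_real_affine[of s f 0] assms by simp

lemma integrable_dilate:
  fixes f :: "real \<Rightarrow> real"
  assumes "s > 0" "integrable lborel f"
  shows "integrable lborel (\<lambda>y. f (s * y))"
  using lborel_integrable_real_affine[OF assms(2), of s 0] assms(1) by simp

lemma scaled_data:
  assumes s: "s > 0" and K: "K > 0"
    "\<And>z. \<bar>airy z\<bar> \<le> K / root4 z" "\<And>z. \<bar>airy' z\<bar> \<le> K * root4 z"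
    "\<And>z. z \<ge> 0 \<Longrightarrow> \<bar>airy z\<bar> \<le> K / (1 + z\<^sup>2)" "\<And>z. z \<ge> 0 \<Longrightarrow> \<bar>airy' z\<bar> \<le> K / (1 + z\<^sup>2)"
  shows "scaled_data K (s ^ 3) 6 (scaled_V s) (scaled_G s)"
proof
  show "scaled_G s \<in> borel_measurable borel"
    unfolding scaled_G_def using G_meas by measurable
  show "primitive (scaled_V s) (scaled_G s)"
    unfolding primitive_def
  proof (intro allI impI)
    fix x y :: real
    assume xy: "x \<le> y"
    have "scaled_V s y - scaled_V s x = s / \<epsilon> * (V (s * y) - V (s * x))"
      by (simp add: scaled_V_def right_diff_distrib)
    also have "V (s * y) - V (s * x) = (\<integral>z. indicator {s * x<..s * y} z * G z \<partial>lborel)"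
      using s xy by (intro primitiveD[OF prim]) simp
    also have "\<dots> = s * (\<integral>z. indicator {s * x<..s * y} (s * z) * G (s * z) \<partial>lborel)"
      using integral_dilate[OF s, of "\<lambda>z. indicator {s * x<..s * y} z * G z"] s by simp
    also have "(\<lambda>z. indicator {s * x<..s * y} (s * z) * G (s * z)) = (\<lambda>z. indicator {x<..y} z * G (s * z))"
      using s by (auto simp: indicator_def fun_eq_iff)
    also have "s / \<epsilon> * (s * (\<integral>z. indicator {x<..y} z * G (s * z) \<partial>lborel)) =
        (s\<^sup>2 / \<epsilon>) * (\<integral>z. indicator {x<..y} z * G (s * z) \<partial>lborel)"
      by (simp add: power2_eq_square)
    also have "\<dots> = (\<integral>z. (s\<^sup>2 / \<epsilon>) * (indicator {x<..y} z * G (s * z)) \<partial>lborel)"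
      by (rule integral_mult_right_zero[symmetric])
    also have "\<dots> = (\<integral>z. indicator {x<..y} z * scaled_G s z \<partial>lborel)"
      by (simp only: scaled_G_def mult.left_commute)
    finally show "scaled_V s y - scaled_V s x = \<dots>" .
  qed
  have G2: "(scaled_G s y)\<^sup>2 = (s ^ 4 / \<epsilon>\<^sup>2) * (G (s * y))\<^sup>2" for y
    by (simp add: scaled_G_def power_mult_distrib power_divide)
  show "integrable lborel (\<lambda>y. (scaled_G s y)\<^sup>2)"
    unfolding G2 by (intro integrable_mult_right integrable_dilate[OF s, of "\<lambda>y. (G y)\<^sup>2"] G_int)
  have "(\<integral>y. (scaled_G s y)\<^sup>2 \<partial>lborel) = (s ^ 4 / \<epsilon>\<^sup>2) * ((\<integral>y. (G y)\<^sup>2 \<partial>lborel) / s)"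
    unfolding G2 by (simp only: integral_mult_right_zero integral_dilate[OF s, of "\<lambda>y. (G y)\<^sup>2"])
  also have "\<dots> \<le> (s ^ 4 / \<epsilon>\<^sup>2) * (\<epsilon>\<^sup>2 / s)"
    using s by (intro mult_left_mono divide_right_mono G_le) auto
  also have "\<dots> = s ^ 3" using s eps by (simp add: eval_nat_numeral)
  finally show "(\<integral>y. (scaled_G s y)\<^sup>2 \<partial>lborel) \<le> s ^ 3" .
  have V2: "(y\<^sup>2 * scaled_V s y)\<^sup>2 = (1 / (s\<^sup>2 * \<epsilon>\<^sup>2)) * ((s * y)\<^sup>2 * V (s * y))\<^sup>2" for y
    using s eps by (simp add: scaled_V_def power_mult_distrib power_divide field_simps)
  show "integrable lborel (\<lambda>y. (y\<^sup>2 * scaled_V s y)\<^sup>2)"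
    unfolding V2 by (intro integrable_mult_right integrable_dilate[OF s, of "\<lambda>y. (y\<^sup>2 * V y)\<^sup>2"] V2_int)
  have "(\<integral>y. (y\<^sup>2 * scaled_V s y)\<^sup>2 \<partial>lborel) = (1 / (s\<^sup>2 * \<epsilon>\<^sup>2)) * ((\<integral>y. (y\<^sup>2 * V y)\<^sup>2 \<partial>lborel) / s)"
    unfolding V2 by (simp only: integral_mult_right_zero integral_dilate[OF s, of "\<lambda>y. (y\<^sup>2 * V y)\<^sup>2"])
  also have "\<dots> \<le> (1 / (s\<^sup>2 * \<epsilon>\<^sup>2)) * (\<epsilon>\<^sup>2 / s)"
    using s by (intro mult_left_mono divide_right_mono V2_le) auto
  also have "\<dots> = 1 / s ^ 3" using s eps by (simp add: eval_nat_numeral)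
  finally show "(\<integral>y. (y\<^sup>2 * scaled_V s y)\<^sup>2 \<partial>lborel) \<le> 1 / s ^ 3" .
  have i: "integrable lborel (\<lambda>y. (1 + \<bar>s * y\<bar>) * \<bar>V (s * y)\<bar>)"
    by (rule integrable_dilate[OF s weighted_V_int])
  show "integrable lborel (\<lambda>y. (1 + \<bar>y\<bar>) * \<bar>scaled_V s y\<bar>)"
  proof (rule abs_integral_le(1)[OF _ integrable_mult_right[OF i, of "(1 + s) / \<epsilon>"]])
    show "(\<lambda>y. (1 + \<bar>y\<bar>) * \<bar>scaled_V s y\<bar>) \<in> borel_measurable lborel" unfolding scaled_V_def by measurable
    fix y
    have "s * (1 + \<bar>y\<bar>) \<le> (1 + s) * (1 + \<bar>s * y\<bar>)"
      using s by (simp add: abs_mult algebra_simps)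
    from mult_right_mono[OF this, of "\<bar>V (s * y)\<bar> / \<epsilon>"]
    show "\<bar>(1 + \<bar>y\<bar>) * \<bar>scaled_V s y\<bar>\<bar> \<le> (1 + s) / \<epsilon> * ((1 + \<bar>s * y\<bar>) * \<bar>V (s * y)\<bar>)"
      using s eps by (simp add: scaled_V_def abs_mult mult_ac)
  qed
  have absV: "\<bar>scaled_V s y\<bar> = (s / \<epsilon>) * \<bar>V (s * y)\<bar>" for y
    using s eps by (simp add: scaled_V_def abs_mult)
  have "(\<integral>y. \<bar>scaled_V s y\<bar> \<partial>lborel) = (s / \<epsilon>) * ((\<integral>y. \<bar>V y\<bar> \<partial>lborel) / s)"
    unfolding absV by (simp only: integral_mult_right_zero integral_dilate[OF s, of "\<lambda>y. \<bar>V y\<bar>"])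
  also have "\<dots> \<le> (s / \<epsilon>) * ((6 * \<epsilon>) / s)"
    using s eps by (intro mult_left_mono divide_right_mono abs_V_le) auto
  also have "\<dots> = 6" using s eps by simp
  finally show "(\<integral>y. \<bar>scaled_V s y\<bar> \<partial>lborel) \<le> 6" .
  show "\<bar>y\<bar> * \<bar>scaled_V s y\<bar> \<le> 2" for y
  proof -
    have "\<bar>y\<bar> * \<bar>scaled_V s y\<bar> = (\<bar>s * y\<bar> * \<bar>V (s * y)\<bar>) / \<epsilon>"
      unfolding absV using s by (simp add: abs_mult)
    also have "\<dots> \<le> (2 * \<epsilon>) / \<epsilon>" using eps by (intro divide_right_mono V_pointwise) auto
    finally show ?thesis using eps by simp
  qed
qed (use s K in simp_all)

end

text \<open>The function chosen by \<open>weak_deriv\<close> is a genuine weak derivative because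
  \<open>H1\<close> supplies one. Passing to Borel representatives changes functions on null sets
  only, so every L2 norm is preserved.\<close>

lemma KdV_data_exists:
  assumes eps: "\<epsilon> > 0" and H1: "H1 u0" and w: "square_integrable (\<lambda>x. x\<^sup>2 * u0 x)"
    and le: "H1_norm u0 + L2_norm (\<lambda>x. x\<^sup>2 * u0 x) \<le> \<epsilon>"
  obtains V G where "KdV_data V G \<epsilon>" "AE x in lebesgue. u0 x = V x"
proof -
  have "square_integrable (weak_deriv u0) \<and> is_weak_deriv u0 (weak_deriv u0)"
    unfolding weak_deriv_def by (rule someI_ex[OF conjunct2[OF H1[unfolded H1_def]]])
  then have g: "square_integrable (weak_deriv u0)" "is_weak_deriv u0 (weak_deriv u0)" by simp_all
  have u0: "square_integrable u0" using H1 by (simp add: H1_def)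
  obtain V G where VG: "G \<in> borel_measurable borel" "AE x in lebesgue. weak_deriv u0 x = G x"
    "primitive V G" "AE x in lebesgue. u0 x = V x"
    using H1_representative[OF u0 g] by blast
  have transfer: "integrable lborel (\<lambda>y. (f' y)\<^sup>2) \<and> (\<integral>y. (f' y)\<^sup>2 \<partial>lborel) \<le> \<epsilon>\<^sup>2"
    if f: "square_integrable f" "L2_norm f \<le> \<epsilon>" and ae: "AE x in lebesgue. f x = f' x"
      and m: "f' \<in> borel_measurable borel" for f f'
  proof -
    have m2: "(\<lambda>y. (f' y)\<^sup>2) \<in> borel_measurable lborel" using m by measurable
    have ae2: "AE x in lebesgue. (f x)\<^sup>2 = (f' x)\<^sup>2" using ae by eventually_elim simp
    have fi: "integrable lebesgue (\<lambda>y. (f y)\<^sup>2)" using f(1) by (simp add: square_integrable_def)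
    have m3: "(\<lambda>y. (f' y)\<^sup>2) \<in> borel_measurable lebesgue" using m2 by (intro borel_measurable_lebesgueI) simp
    have i: "integrable lebesgue (\<lambda>y. (f' y)\<^sup>2)" by (rule integrable_cong_AE_imp[OF fi m3]) (use ae2 in eventually_elim, simp)
    have "(\<integral>y. (f' y)\<^sup>2 \<partial>lborel) = (\<integral>y. (f y)\<^sup>2 \<partial>lebesgue)"
      unfolding integral_completion[OF m2, symmetric]
      by (rule integral_cong_AE[OF m3 borel_measurable_integrable[OF fi]]) (use ae2 in eventually_elim, simp)
    also have "\<dots> = (L2_norm f)\<^sup>2" by (rule L2_norm_squared[symmetric])
    also have "\<dots> \<le> \<epsilon>\<^sup>2" using f(2) by (intro power_mono L2_norm_nonneg)
    finally show ?thesis using i m2 by (simp add: integrable_completion)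
  qed
  have nn: "0 \<le> L2_norm (\<lambda>x. x\<^sup>2 * u0 x)" "0 \<le> H1_norm u0" by (simp_all add: L2_norm_nonneg H1_norm_def)
  have "L2_norm u0 \<le> H1_norm u0" "L2_norm (weak_deriv u0) \<le> H1_norm u0"
    unfolding H1_norm_def by (intro real_le_rsqrt; simp)+
  then have norms: "L2_norm u0 \<le> \<epsilon>" "L2_norm (weak_deriv u0) \<le> \<epsilon>" "L2_norm (\<lambda>x. x\<^sup>2 * u0 x) \<le> \<epsilon>"
    using le nn by linarith+
  have G2: "integrable lborel (\<lambda>y. (G y)\<^sup>2)" "(\<integral>y. (G y)\<^sup>2 \<partial>lborel) \<le> \<epsilon>\<^sup>2"
    using transfer[OF g(1) norms(2) VG(2,1)] by simp_all
  have Vm: "V \<in> borel_measurable borel"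
    by (rule borel_measurable_continuous_onI[OF primitive_continuous[OF VG(3,1) G2(1)]])
  have V2: "integrable lborel (\<lambda>y. (V y)\<^sup>2)" "(\<integral>y. (V y)\<^sup>2 \<partial>lborel) \<le> \<epsilon>\<^sup>2"
    using transfer[OF u0 norms(1) VG(4) Vm] by simp_all
  have W2: "integrable lborel (\<lambda>y. (y\<^sup>2 * V y)\<^sup>2)" "(\<integral>y. (y\<^sup>2 * V y)\<^sup>2 \<partial>lborel) \<le> \<epsilon>\<^sup>2"
  proof -
    have "AE x in lebesgue. x\<^sup>2 * u0 x = x\<^sup>2 * V x" using VG(4) by eventually_elim simp
    moreover have "(\<lambda>y. y\<^sup>2 * V y) \<in> borel_measurable borel" using Vm by measurable
    ultimately have "integrable lborel (\<lambda>y. (y\<^sup>2 * V y)\<^sup>2) \<and> (\<integral>y. (y\<^sup>2 * V y)\<^sup>2 \<partial>lborel) \<le> \<epsilon>\<^sup>2"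
      by (rule transfer[OF w norms(3)])
    then show "integrable lborel (\<lambda>y. (y\<^sup>2 * V y)\<^sup>2)" "(\<integral>y. (y\<^sup>2 * V y)\<^sup>2 \<partial>lborel) \<le> \<epsilon>\<^sup>2"
      by simp_all
  qed
  have "KdV_data V G \<epsilon>"
    by (intro KdV_data.intro eps VG G2 V2 W2)
  then show ?thesis using that VG(4) by blast
qed

text \<open>Dilating the variable of integration in the Airy representation turns it into the
  unit-time convolution. The derivative is inherited from \<open>W_deriv\<close>, so
  differentiability of the solution in x is derived rather than assumed.\<close>

lemma KdV_scaled_solution:
  fixes u :: "real \<Rightarrow> real \<Rightarrow> real"
  assumes sol: "linear_KdV_solution u0 u" and data: "KdV_data V G \<epsilon>" and ae: "AE x in lebesgue. u0 x = V x"
    and u0: "square_integrable u0" and s: "s > 0"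
    and scaled: "scaled_data K (s ^ 3) 6 (KdV_data.scaled_V V \<epsilon> s) (KdV_data.scaled_G G \<epsilon> s)"
  defines "W \<equiv> scaled_data.W (KdV_data.scaled_V V \<epsilon> s)"
    and "W' \<equiv> scaled_data.W' (KdV_data.scaled_V V \<epsilon> s)"
  shows "u (s ^ 3) x = \<epsilon> / s * W (x / s)"
    and "(u (s ^ 3) has_real_derivative \<epsilon> / s\<^sup>2 * W' (x / s)) (at x)"
proof -
  interpret KdV_data V G \<epsilon> by (rule data)
  interpret S: scaled_data K "s ^ 3" 6 "scaled_V s" "scaled_G s" by (rule scaled)
  have u0_meas: "u0 \<in> borel_measurable lebesgue" using u0 by (simp add: square_integrable_def)
  have "integrable lborel V"
    using abs_V_int V_meas by (subst integrable_abs_iff[symmetric]) simp_all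
  then have "integrable lebesgue V" using V_meas by (simp add: integrable_completion)
  then have u0_int: "integrable lebesgue u0"
    by (rule integrable_cong_AE_imp[OF _ u0_meas]) (use ae in eventually_elim, simp)
  have rep: "u (s ^ 3) x = \<epsilon> / s * W (x / s)" for x
  proof -
    have cont: "continuous_on UNIV (\<lambda>y. airy ((x - y) / s))"
      using s by (intro continuous_intros continuous_on_compose2[OF airy_continuous(1)[of UNIV]]) auto
    have m: "(\<lambda>y. V y * airy ((x - y) / s)) \<in> borel_measurable lborel"
      using borel_measurable_continuous_onI[OF cont] V_meas by simp
    have "(\<integral>y. u0 y * airy ((x - y) / s) \<partial>lebesgue) = (\<integral>y. V y * airy ((x - y) / s) \<partial>lebesgue)"
    proof (rule integral_cong_AE)
      show "AE y in lebesgue. u0 y * airy ((x - y) / s) = V y * airy ((x - y) / s)"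
        using ae by eventually_elim simp
      show "(\<lambda>y. u0 y * airy ((x - y) / s)) \<in> borel_measurable lebesgue"
        by (intro borel_measurable_times u0_meas continuous_lebesgue_measurable cont)
      show "(\<lambda>y. V y * airy ((x - y) / s)) \<in> borel_measurable lebesgue"
        using m by (intro borel_measurable_lebesgueI) simp
    qed
    also have "\<dots> = (\<integral>y. V y * airy ((x - y) / s) \<partial>lborel)" by (rule integral_completion[OF m])
    also have "\<dots> = s * (\<integral>y. V (s * y) * airy ((x - s * y) / s) \<partial>lborel)"
      using integral_dilate[OF s, of "\<lambda>y. V y * airy ((x - y) / s)"] s by simp
    also have "(\<integral>y. V (s * y) * airy ((x - s * y) / s) \<partial>lborel) = (\<integral>y. \<epsilon> / s * (airy (x / s - y) * scaled_V s y) \<partial>lborel)"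
      by (rule Bochner_Integration.integral_cong) (use s eps in \<open>simp_all add: scaled_V_def diff_divide_distrib\<close>)
    also have "\<dots> = \<epsilon> / s * W (x / s)"
      unfolding W_def S.W_def by (rule integral_mult_right_zero)
    finally show ?thesis
      using KdV_representation[OF sol s u0_int, of x] s by simp
  qed
  show "u (s ^ 3) x = \<epsilon> / s * W (x / s)" by (rule rep)
  have "((\<lambda>x. W (x / s)) has_real_derivative W' (x / s) * (1 / s)) (at x)"
    unfolding W_def W'_def
    by (rule DERIV_chain2[OF S.W_deriv]) (use s in \<open>auto intro!: derivative_eq_intros\<close>)
  from DERIV_cmult[OF this, of "\<epsilon> / s"]
  have "((\<lambda>x. \<epsilon> / s * W (x / s)) has_real_derivative \<epsilon> / s\<^sup>2 * W' (x / s)) (at x)"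
    by (simp add: power2_eq_square)
  then show "(u (s ^ 3) has_real_derivative \<epsilon> / s\<^sup>2 * W' (x / s)) (at x)"
    unfolding rep[abs_def, symmetric] .
qed

section \<open>From the scaled bounds to the bracket weights\<close>

lemma powr_quarter: "x \<ge> 0 \<Longrightarrow> x powr (1 / 4) = sqrt (sqrt x)"
  by (simp add: powr_half_sqrt[symmetric] powr_powr)

lemma bracket_scaled:
  assumes "s > 0"
  shows "bracket (s ^ 3) x = s * sqrt (1 + (x / s)\<^sup>2)"
proof -
  have "(s ^ 3) powr (2 / 3) = s\<^sup>2"
  proof -
    have "s ^ 3 = s powr 3" using assms by simp
    then have "(s ^ 3) powr (2 / 3) = s powr (3 * (2 / 3))" by (simp only: powr_powr)
    then show ?thesis using assms by simp
  qed
  moreover have "x\<^sup>2 + s\<^sup>2 = s\<^sup>2 * (1 + (x / s)\<^sup>2)"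
    using assms by (simp add: power_divide distrib_left)
  ultimately show ?thesis
    using assms unfolding bracket_def by (simp add: real_sqrt_mult)
qed

text \<open>The unit-time estimates use (1 + |X|)^(1/4), the proposition uses the bracket, which
  after division by t^(1/3) is (1 + X^2)^(1/2); the two weights agree up to a factor 2.\<close>

lemma root4_japanese_bracket:
  fixes X :: real
  defines "b \<equiv> sqrt (1 + X\<^sup>2)"
  shows "b \<ge> 1" "b \<le> 1 + \<bar>X\<bar>" "b powr (1 / 4) \<le> root4 X" "root4 X \<le> 2 * b powr (1 / 4)"
proof -
  show b1: "b \<ge> 1" by (simp add: b_def)
  show b2: "b \<le> 1 + \<bar>X\<bar>"
    unfolding b_def by (intro real_le_lsqrt) (auto simp: power2_sum)
  have X: "\<bar>X\<bar> \<le> b" unfolding b_def by (intro real_le_rsqrt) simp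
  show "b powr (1 / 4) \<le> root4 X"
    using b1 b2 by (simp add: powr_quarter root4_def)
  have "root4 X \<le> sqrt (sqrt (4\<^sup>2 * b))"
    unfolding root4_def using X b1 by (intro real_sqrt_le_mono) simp
  also have "\<dots> = sqrt (2\<^sup>2 * sqrt b)" by (simp only: real_sqrt_mult real_sqrt_abs abs_numeral) simp
  also have "\<dots> = 2 * sqrt (sqrt b)" by (simp only: real_sqrt_mult[of "2\<^sup>2"] real_sqrt_abs abs_numeral)
  finally show "root4 X \<le> 2 * b powr (1 / 4)" using b1 by (simp add: powr_quarter)
qed

text \<open>Differentiability is part of the conclusion because \<open>deriv\<close> carries no
  information at a point where the function is not differentiable. The constants are quantified
  before the data, and \<open>C\<^sub>E\<close> is a function of \<open>c0\<close> since the
  logarithm is bounded below only in terms of \<open>c0\<close>.\<close>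

theorem proposition1:
  shows "\<exists>C>0. \<exists>C\<^sub>E :: real \<Rightarrow> real. (\<forall>c0>0. C\<^sub>E c0 > 0) \<and>
    (\<forall>(\<epsilon>::real) (u0 :: real \<Rightarrow> real) (u :: real \<Rightarrow> real \<Rightarrow> real).
       \<epsilon> > 0 \<and> H1 u0 \<and> square_integrable (\<lambda>x. x\<^sup>2 * u0 x) \<and>
       H1_norm u0 + L2_norm (\<lambda>x. x\<^sup>2 * u0 x) \<le> \<epsilon> \<and>
       linear_KdV_solution u0 u \<longrightarrow>
         (\<forall>t>0. \<forall>x. u t differentiable (at x) \<and>
            t powr (1/4) * bracket t x powr (1/4) * \<bar>u t x\<bar>
            + t powr (3/4) * bracket t x powr (-1/4) * \<bar>deriv (u t) x\<bar> \<le> C * \<epsilon>) \<and>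
         (\<forall>c0>0. \<forall>(t, x)\<in>elliptic_region c0.
            bracket t x * \<bar>u t x\<bar>
            + t powr (1/2) * bracket t x powr (1/2) * \<bar>deriv (u t) x\<bar>
            \<le> C\<^sub>E c0 * \<epsilon> * ln (t powr (-1/3) * bracket t x)))"
proof -
  obtain K where K: "K > 0"
    "\<And>z. \<bar>airy z\<bar> \<le> K / root4 z" "\<And>z. \<bar>airy' z\<bar> \<le> K * root4 z"
    "\<And>z. z \<ge> 0 \<Longrightarrow> \<bar>airy z\<bar> \<le> K / (1 + z\<^sup>2)" "\<And>z. z \<ge> 0 \<Longrightarrow> \<bar>airy' z\<bar> \<le> K / (1 + z\<^sup>2)"
    using airy_bounds by metis
  \<comment> \<open>In the region the logarithm is smallest on the boundary x = c0 t^(1/3), where it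
    takes this value; it tends to 0 with \<open>c0\<close>, hence the division by
    \<open>L c0\<close> in the constant.\<close>
  define L where "L c0 = ln (sqrt (1 + c0\<^sup>2))" for c0 :: real
  have L: "L c0 > 0" if "c0 > 0" for c0 unfolding L_def using that by (intro ln_gt_zero) simp
  have main: "u t differentiable (at x) \<and>
        t powr (1/4) * bracket t x powr (1/4) * \<bar>u t x\<bar>
        + t powr (3/4) * bracket t x powr (-1/4) * \<bar>deriv (u t) x\<bar> \<le> 74 * K * \<epsilon> \<and>
      (\<forall>c0>0. x \<ge> c0 * t powr (1/3) \<longrightarrow>
        bracket t x * \<bar>u t x\<bar> + t powr (1/2) * bracket t x powr (1/2) * \<bar>deriv (u t) x\<bar>
          \<le> 206 * K / L c0 * \<epsilon> * ln (t powr (-1/3) * bracket t x))"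
    if eps: "\<epsilon> > 0" and H1: "H1 u0" and w: "square_integrable (\<lambda>x. x\<^sup>2 * u0 x)"
      and le: "H1_norm u0 + L2_norm (\<lambda>x. x\<^sup>2 * u0 x) \<le> \<epsilon>"
      and sol: "linear_KdV_solution u0 u" and t: "t > 0"
    for \<epsilon> t x :: real and u0 :: "real \<Rightarrow> real" and u :: "real \<Rightarrow> real \<Rightarrow> real"
  proof -
    obtain V G where VG: "KdV_data V G \<epsilon>" "AE x in lebesgue. u0 x = V x"
      using KdV_data_exists[OF eps H1 w le] by blast
    define s where "s = t powr (1/3)"
    have s: "s > 0" using t by (simp add: s_def)
    have s_powr: "t powr p = s powr (3 * p)" for p by (simp add: s_def powr_powr)
    have ts: "t = s ^ 3" using t s by (simp add: s_def powr_realpow[symmetric] powr_powr)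
    interpret KdV_data V G \<epsilon> by (rule VG(1))
    interpret S: scaled_data K "s ^ 3" 6 "scaled_V s" "scaled_G s"
      by (rule scaled_data[OF s K])
    have u0: "square_integrable u0" using H1 by (simp add: H1_def)
    note u_eqs = KdV_scaled_solution[OF sol VG u0 s S.scaled_data_axioms, folded ts]
    define X where "X = x / s"
    have u_eq: "\<bar>u t x\<bar> = \<epsilon> / s * \<bar>S.W X\<bar>"
      using u_eqs(1)[of x] s eps by (simp add: X_def abs_mult)
    have du_eq: "\<bar>deriv (u t) x\<bar> = \<epsilon> / s\<^sup>2 * \<bar>S.W' X\<bar>"
      using DERIV_imp_deriv[OF u_eqs(2)[of x]] s eps by (simp add: X_def abs_mult)
    \<comment> \<open>The bracket divided by s; with it all powers of s cancel against those in
      \<open>u_eq\<close> and \<open>du_eq\<close>.\<close>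
    define b where "b = sqrt (1 + X\<^sup>2)"
    note b = root4_japanese_bracket[of X, folded b_def]
    have br: "bracket t x = s * b"
      using bracket_scaled[OF s, of x] by (simp add: ts b_def X_def)
    define r where "r = b powr (1 / 4)"
    have r: "r > 0" "r \<le> root4 X" "root4 X \<le> 2 * r" using b by (simp_all add: r_def)
    have sp: "s powr p * s powr q = s powr (p + q)" for p q by (simp add: powr_add)
    have c1: "t powr (1/4) * bracket t x powr (1/4) * \<bar>u t x\<bar> = \<epsilon> * (r * \<bar>S.W X\<bar>)"
    proof -
      have "t powr (1/4) * bracket t x powr (1/4) = (s powr (3/4) * s powr (1/4)) * r"
        unfolding br s_powr r_def using s b(1) by (simp add: powr_mult)
      also have "\<dots> = s * r" unfolding sp using s by simp
      finally show ?thesis unfolding u_eq using s by simp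
    qed
    have c2: "t powr (3/4) * bracket t x powr (-1/4) * \<bar>deriv (u t) x\<bar> = \<epsilon> * (\<bar>S.W' X\<bar> / r)"
    proof -
      have "b powr (- 1 / 4) = 1 / r" using b(1) by (simp add: r_def powr_minus_divide)
      then have "t powr (3/4) * bracket t x powr (-1/4) = (s powr (9/4) * s powr (- 1/4)) * (1 / r)"
        unfolding br s_powr using s b(1) by (simp add: powr_mult)
      also have "\<dots> = s\<^sup>2 * (1 / r)" unfolding sp using s by (simp add: powr_numeral)
      finally show ?thesis unfolding du_eq using s by simp
    qed
    have c3: "t powr (1/2) * bracket t x powr (1/2) * \<bar>deriv (u t) x\<bar> = \<epsilon> * (sqrt b * \<bar>S.W' X\<bar>)"
    proof -
      have "t powr (1/2) * bracket t x powr (1/2) = (s powr (3/2) * s powr (1/2)) * sqrt b"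
        unfolding br s_powr using s b(1) by (simp add: powr_mult powr_half_sqrt)
      also have "\<dots> = s\<^sup>2 * sqrt b" unfolding sp using s by (simp add: powr_numeral)
      finally show ?thesis unfolding du_eq using s by simp
    qed
    have c4: "bracket t x * \<bar>u t x\<bar> = \<epsilon> * (b * \<bar>S.W X\<bar>)"
      unfolding br u_eq using s by simp
    \<comment> \<open>With the L1 bound 6, the two terms give 2 * 6 + 16 = 28 and, by the factor 2
      between the weights, 2 * (2 * 6 + 11) = 46.\<close>
    have hyp: "r * \<bar>S.W X\<bar> + \<bar>S.W' X\<bar> / r \<le> 74 * K"
    proof -
      have "r * \<bar>S.W X\<bar> \<le> root4 X * (K * (2 * 6 + 16) / root4 X)"
        using r S.W_bound[of X] root4_ge_1[of X] by (intro mult_mono) auto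
      also have "\<dots> = 28 * K" using root4_ge_1[of X] by simp
      finally have 1: "r * \<bar>S.W X\<bar> \<le> 28 * K" .
      have "\<bar>S.W' X\<bar> \<le> K * (2 * 6 + 11) * root4 X" by (rule S.W'_bound)
      also have "\<dots> \<le> K * (2 * 6 + 11) * (2 * r)" using r K(1) by (intro mult_left_mono) auto
      finally have "\<bar>S.W' X\<bar> / r \<le> 46 * K" using r(1) by (simp add: pos_divide_le_eq mult_ac)
      then show ?thesis using 1 by linarith
    qed
    \<comment> \<open>For X >= 1 the factor 2 between b and X gives 2 * (6 + 75) = 162 and 2 * (6 +
      16) = 44. For 0 < X < 1 the weights are bounded and the general estimates stay below the same
      total.\<close>
    have ell: "b * \<bar>S.W X\<bar> + sqrt b * \<bar>S.W' X\<bar> \<le> 206 * K" if "X > 0"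
    proof (cases "X \<ge> 1")
      case True
      have b2: "b \<le> 2 * X" using b(2) True by simp
      have "b * \<bar>S.W X\<bar> \<le> (2 * X) * (K * (6 + 75) / X)"
        using b2 S.W_elliptic_bound[OF True] True by (intro mult_mono) auto
      also have "\<dots> = 162 * K" using True by simp
      finally have 1: "b * \<bar>S.W X\<bar> \<le> 162 * K" .
      have "sqrt b \<le> sqrt (2\<^sup>2 * X)" using b2 True by (intro real_sqrt_le_mono) simp
      then have "sqrt b \<le> 2 * sqrt X" by (simp only: real_sqrt_mult real_sqrt_abs abs_numeral)
      then have "sqrt b * \<bar>S.W' X\<bar> \<le> (2 * sqrt X) * (K * (6 + 16) / sqrt X)"
        using S.W'_elliptic_bound[OF True] True by (intro mult_mono) auto
      also have "\<dots> = 44 * K" using True by simp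
      finally show ?thesis using 1 by linarith
    next
      case False
      have b2: "b \<le> 2" using b(2) False that by simp
      have "b * \<bar>S.W X\<bar> \<le> 2 * (K * 6)"
        using b2 S.W_bound_const[of X] b(1) by (intro mult_mono) auto
      moreover have "sqrt b * \<bar>S.W' X\<bar> \<le> 2 * (K * (2 * 6 + 11) * 2)"
      proof (rule mult_mono)
        show "sqrt b \<le> 2" using b2 by (intro real_le_lsqrt) auto
        have "root4 X \<le> 2 * root4 0" using False that by (intro S.root4_le_2) simp
        then have "root4 X \<le> 2" by (simp add: root4_def)
        then have "K * (2 * 6 + 11) * root4 X \<le> K * (2 * 6 + 11) * 2" using K(1) by (intro mult_left_mono) auto
        then show "\<bar>S.W' X\<bar> \<le> K * (2 * 6 + 11) * 2" using S.W'_bound[of X] by linarith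
      qed auto
      ultimately show ?thesis using K(1) by simp
    qed
    show ?thesis
    proof (intro conjI allI impI)
      show "u t differentiable (at x)" using u_eqs(2)[of x] real_differentiable_def by blast
      show "t powr (1/4) * bracket t x powr (1/4) * \<bar>u t x\<bar>
        + t powr (3/4) * bracket t x powr (-1/4) * \<bar>deriv (u t) x\<bar> \<le> 74 * K * \<epsilon>"
        unfolding c1 c2 using mult_left_mono[OF hyp, of \<epsilon>] eps by (simp add: algebra_simps)
      fix c0 :: real
      assume c0: "c0 > 0" and x: "x \<ge> c0 * t powr (1/3)"
      have Xc: "X \<ge> c0" using x s unfolding X_def s_def[symmetric] by (simp add: pos_le_divide_eq)
      have "t powr (-1/3) * bracket t x = b"
        unfolding br s_powr using s by (simp add: powr_minus_divide)
      moreover have "L c0 \<le> ln b"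
      proof -
        have "c0\<^sup>2 \<le> X\<^sup>2" using Xc c0 by (intro power_mono) auto
        then have "sqrt (1 + c0\<^sup>2) \<le> b" unfolding b_def by (intro real_sqrt_le_mono) simp
        then show ?thesis unfolding L_def by (intro ln_mono) (auto simp: add_pos_nonneg)
      qed
      ultimately have "1 \<le> ln (t powr (-1/3) * bracket t x) / L c0" using L[OF c0] by simp
      then have "206 * K * \<epsilon> * 1 \<le> 206 * K * \<epsilon> * (ln (t powr (-1/3) * bracket t x) / L c0)"
        using K(1) eps by (intro mult_left_mono) auto
      moreover have "bracket t x * \<bar>u t x\<bar> + t powr (1/2) * bracket t x powr (1/2) * \<bar>deriv (u t) x\<bar> \<le> 206 * K * \<epsilon>"
        unfolding c3 c4 using mult_left_mono[OF ell, of \<epsilon>] Xc c0 eps by (simp add: algebra_simps)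
      ultimately show "bracket t x * \<bar>u t x\<bar> + t powr (1/2) * bracket t x powr (1/2) * \<bar>deriv (u t) x\<bar>
          \<le> 206 * K / L c0 * \<epsilon> * ln (t powr (-1/3) * bracket t x)"
        by simp
    qed
  qed
  show ?thesis
  proof (rule exI[of _ "74 * K"], intro conjI exI[of _ "\<lambda>c0. 206 * K / L c0"] allI impI ballI)
    show "74 * K > 0" using K(1) by simp
    show "206 * K / L c0 > 0" if "c0 > 0" for c0 using K(1) L[OF that] by simp
  next
    fix \<epsilon> t x :: real and u0 u
    assume a: "0 < \<epsilon> \<and> H1 u0 \<and> square_integrable (\<lambda>x. x\<^sup>2 * u0 x) \<and>
       H1_norm u0 + L2_norm (\<lambda>x. x\<^sup>2 * u0 x) \<le> \<epsilon> \<and> linear_KdV_solution u0 u" and "0 < t"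
    then show "u t differentiable (at x)"
      "t powr (1/4) * bracket t x powr (1/4) * \<bar>u t x\<bar>
            + t powr (3/4) * bracket t x powr (-1/4) * \<bar>deriv (u t) x\<bar> \<le> 74 * K * \<epsilon>"
      using main by blast+
  next
    fix \<epsilon> c0 :: real and u0 u and p :: "real \<times> real"
    assume a: "0 < \<epsilon> \<and> H1 u0 \<and> square_integrable (\<lambda>x. x\<^sup>2 * u0 x) \<and>
       H1_norm u0 + L2_norm (\<lambda>x. x\<^sup>2 * u0 x) \<le> \<epsilon> \<and> linear_KdV_solution u0 u"
      and c0: "0 < c0" and p: "p \<in> elliptic_region c0"
    obtain t x where tx: "p = (t, x)" "t > 0" "x \<ge> c0 * t powr (1/3)"
      using p by (auto simp: elliptic_region_def)
    then show "case p of (t, x) \<Rightarrow> bracket t x * \<bar>u t x\<bar>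
            + t powr (1/2) * bracket t x powr (1/2) * \<bar>deriv (u t) x\<bar>
            \<le> 206 * K / L c0 * \<epsilon> * ln (t powr (-1/3) * bracket t x)"
      unfolding tx(1) prod.case using main a c0 by blast
  qed
qed

end
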